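(* Let $\psi\in C^\infty(\mathbb{R}^d)$ (complex-valued) and let $\varphi:\mathbb{R}^d\to\mathbb{R}^d$ be smooth. Then the following are equivalent. (i) $\psi\cdot(f\circ\varphi)\in\mathscr{S}(\mathbb{R}^d)$ for every $f\in\mathscr{S}(\mathbb{R}^d)$. (ii) The weighted composition operator $C_{\psi,\varphi}:\mathscr{S}(\mathbb{R}^d)\to\mathscr{S}(\mathbb{R}^d)$, $f\mapsto\psi\cdot(f\circ\varphi)$, is correctly defined and continuous. (iii) For all $\alpha,\lambda\in\mathbb{N}_0^d$ with $|\lambda|\le|\alpha|$ and for every $p>0$ there exists $q>0$ such that $$\sup_{x\in\mathbb{R}^d}\frac{(1+|x|)^p}{(1+|\varphi(x)|)^q}\left|F_{\alpha,\lambda}^{\varphi,\psi}(x)\right|<\infty.$$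
   Context: $\mathscr{S}(\mathbb{R}^d)$ is the Schwartz space of complex-valued rapidly decreasing smooth functions with its standard Fréchet topology, given by the norms $\|f\|_{p,\alpha}=\sup_x(1+|x|)^p|f^{(\alpha)}(x)|$, $p>0$, $\alpha\in\mathbb{N}_0^d$. Here $|x|$ is the Euclidean norm for $x\in\mathbb{R}^d$, $|\alpha|=\sum_j\alpha_j$ for a multi-index, and $f^{(\alpha)}=\partial^\alpha f$. Order on multi-indices: $\alpha\prec\beta$ iff $|\alpha|<|\beta|$, or $|\alpha|=|\beta|$ and $\alpha_1<\beta_1$, or $|\alpha|=|\beta|$, $\alpha_1=\beta_1,\dots,\alpha_k=\beta_k$ and $\alpha_{k+1}<\beta_{k+1}$ for some $1\le k<d$. As usual $\beta\le\alpha$ means componentwise. For $\beta\in\mathbb{N}_0^d\setminus\{0\}$, $\lambda\in\mathbb{N}_0^d$, let $p(\beta,\lambda)$ be the set of all $(k_1,\dots,k_{|\beta|};\ell_1,\dots,\ell_{|\beta|})\in\mathbb{N}_0^{2|\beta|d}$ (each $k_j,\ell_j\in\mathbb{N}_0^d$) such that for some $1\le s\le|\beta|$: $k_j=\ell_j=0$ for $1\le j\le|\beta|-s$; $|k_j|>0$ for $|\beta|-s+1\le j\le|\beta|$; $0\prec\ell_{|\beta|-s+1}\prec\cdots\prec\ell_{|\beta|}$; $\sum_{j=1}^{|\beta|}k_j=\lambda$ and $\sum_{j=1}^{|\beta|}|k_j|\ell_j=\beta$. Further $p(0,\lambda)=\emptyset$ if $\lambda\ne0$ and $p(0,0)$ is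 a one-element set. For $\psi\in C^\infty(\mathbb{R}^d)$, a smooth map $\varphi=(\varphi_1,\dots,\varphi_d):\mathbb{R}^d\to\mathbb{R}^d$, and $\alpha,\lambda\in\mathbb{N}_0^d$ with $|\lambda|\le|\alpha|$, $$F_{\alpha,\lambda}^{\varphi,\psi}(x)=\sum_{\substack{\beta\in\mathbb{N}_0^d\\ \beta\le\alpha,\ |\lambda|\le|\beta|}}\binom{\alpha}{\beta}\psi^{(\alpha-\beta)}(x)\sum_{p(\beta,\lambda)}\beta!\prod_{j=1}^{|\beta|}\frac{\left(\varphi^{(\ell_j)}(x)\right)^{k_j}}{k_j!\,(\ell_j!)^{|k_j|}},$$ where the inner sum runs over the elements of $p(\beta,\lambda)$, $\left(\varphi^{(\ell)}(x)\right)^{k}=\prod_{i=1}^d\left(\varphi_i^{(\ell)}(x)\right)^{k_i}$, $0^0=1$, empty sums are $0$ and empty products are $1$ (so the inner sum for $\beta=\lambda=0$ equals $1$). With this, $(\psi\cdot(f\circ\varphi))^{(\alpha)}(x)=\sum_{|\lambda|\le|\alpha|}f^{(\lambda)}(\varphi(x))F_{\alpha,\lambda}^{\varphi,\psi}(x)$ for all smooth $f$ (Leibniz rule and Faà di Bruno formula). *)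

theory Defs
  imports "HOL-Analysis.Analysis"
begin

text \<open>
  The space \<open>\<real>\<^sup>d\<close> is \<^typ>\<open>real ^ 'n\<close> with \<open>'n\<close> a finite linearly ordered index type, that is, an
  ordered copy of \<open>{1, \<dots>, d}\<close>; the linear order is needed for the lexicographic comparison of
  multi-indices. Multi-indices are elements of \<^typ>\<open>nat ^ 'n\<close>, for which \<open>\<le>\<close>, \<open>+\<close>, \<open>-\<close> and \<open>0\<close> are
  the componentwise ones of the library, and \<open>c *s l\<close> is the multiple of \<open>l\<close> by \<open>c\<close>.
\<close>

type_synonym 'n space = "(real, 'n) vec"

type_synonym 'n multi_index = "(nat, 'n) vec"

section \<open>Multi-indices\<close>

definition mi_size :: "('n::finite) multi_index \<Rightarrow> nat"
  where "mi_size \<alpha> = (\<Sum>i\<in>UNIV. \<alpha> $ i)"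

definition mi_fact :: "('n::finite) multi_index \<Rightarrow> nat"
  where "mi_fact \<alpha> = (\<Prod>i\<in>UNIV. fact (\<alpha> $ i))"

definition mi_choose :: "('n::finite) multi_index \<Rightarrow> 'n multi_index \<Rightarrow> nat"
  where "mi_choose \<alpha> \<beta> = (\<Prod>i\<in>UNIV. (\<alpha> $ i) choose (\<beta> $ i))"

definition mi_less :: "('n::{finite,linorder}) multi_index \<Rightarrow> 'n multi_index \<Rightarrow> bool"
    (infix "\<prec>" 50)
  where "\<alpha> \<prec> \<beta> \<longleftrightarrow> mi_size \<alpha> < mi_size \<beta> \<or>
    (mi_size \<alpha> = mi_size \<beta> \<and> (\<exists>i. (\<forall>j<i. \<alpha> $ j = \<beta> $ j) \<and> \<alpha> $ i < \<beta> $ i))"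

section \<open>Partial derivatives and smooth functions\<close>

definition partial_derivative ::
    "'n \<Rightarrow> (('n::finite) space \<Rightarrow> 'b) \<Rightarrow> 'n space \<Rightarrow> 'b::real_normed_vector"
  where "partial_derivative i f x = frechet_derivative f (at x) (axis i 1)"

text \<open>
  In \<open>\<partial>\<^sup>\<alpha> f\<close> the coordinates are processed in increasing order; for smooth functions, the only ones
  it is used for, the order is irrelevant.
\<close>
definition mi_derivative ::
    "'n multi_index \<Rightarrow> (('n::{finite,linorder}) space \<Rightarrow> 'b) \<Rightarrow> 'n space \<Rightarrow> 'b::real_normed_vector"
  where "mi_derivative \<alpha> f =
    fold (\<lambda>i. partial_derivative i ^^ (\<alpha> $ i)) (sorted_list_of_set UNIV) f"

fun C_diff :: "nat \<Rightarrow> (('n::finite) space \<Rightarrow> 'b::real_normed_vector) \<Rightarrow> bool"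
  where
    "C_diff 0 f \<longleftrightarrow> continuous_on UNIV f"
  | "C_diff (Suc m) f \<longleftrightarrow>
      (\<forall>x. f differentiable (at x)) \<and> (\<forall>i. C_diff m (partial_derivative i f))"

definition smooth :: "(('n::finite) space \<Rightarrow> 'b::real_normed_vector) \<Rightarrow> bool"
  where "smooth f \<longleftrightarrow> (\<forall>m. C_diff m f)"

section \<open>The Schwartz space\<close>

definition schwartz :: "(('n::{finite,linorder}) space \<Rightarrow> complex) set"
  where "schwartz = {f. smooth f \<and>
    (\<forall>p>0. \<forall>\<alpha>. bdd_above (range (\<lambda>x. (1 + norm x) powr p * norm (mi_derivative \<alpha> f x))))}"

text \<open>The real supremum is the intended one only for \<open>f \<in> schwartz\<close>, where the range is bounded.\<close>
definition schwartz_norm ::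
    "real \<Rightarrow> 'n multi_index \<Rightarrow> (('n::{finite,linorder}) space \<Rightarrow> complex) \<Rightarrow> real"
  where "schwartz_norm p \<alpha> f = (SUP x. (1 + norm x) powr p * norm (mi_derivative \<alpha> f x))"

definition schwartz_topology :: "(('n::{finite,linorder}) space \<Rightarrow> complex) topology"
  where "schwartz_topology = topology_generated_by
    {{g \<in> schwartz. schwartz_norm p \<alpha> (\<lambda>x. g x - f x) < \<epsilon>} | p \<alpha> f \<epsilon>.
      p > 0 \<and> f \<in> schwartz \<and> \<epsilon> > 0}"

lemma mi_derivative_zero: "mi_derivative \<alpha> (\<lambda>x. 0) = (\<lambda>x. 0)"
proof -
  have 1: "partial_derivative i (\<lambda>x. 0) = (\<lambda>x. 0)" for i :: 'a
    by (auto simp: partial_derivative_def)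
  have 2: "(partial_derivative i ^^ k) (\<lambda>x. 0) = (\<lambda>x. 0)" for i :: 'a and k
    by (induction k) (simp_all add: 1)
  have "fold (\<lambda>i. partial_derivative i ^^ (\<alpha> $ i)) xs (\<lambda>x. 0) = (\<lambda>x. 0)" for xs
    by (induction xs) (simp_all add: 2)
  then show ?thesis
    by (simp add: mi_derivative_def)
qed

lemma topspace_schwartz_topology [simp]: "topspace schwartz_topology = schwartz"
proof -
  have "f \<in> \<Union> {{h \<in> schwartz. schwartz_norm p \<alpha> (\<lambda>x. h x - g x) < \<epsilon>} | p \<alpha> g \<epsilon>.
      p > 0 \<and> g \<in> schwartz \<and> \<epsilon> > 0}"
    if f: "f \<in> schwartz" for f :: "('a::{finite,linorder}) space \<Rightarrow> complex"
  proof (rule UnionI)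
    show "f \<in> {h \<in> schwartz. schwartz_norm 1 0 (\<lambda>x. h x - f x) < 1}"
      using f by (simp add: schwartz_norm_def mi_derivative_zero)
    show "{h \<in> schwartz. schwartz_norm 1 0 (\<lambda>x. h x - f x) < 1} \<in>
        {{h \<in> schwartz. schwartz_norm p \<alpha> (\<lambda>x. h x - g x) < \<epsilon>} | p \<alpha> g \<epsilon>.
          p > 0 \<and> g \<in> schwartz \<and> \<epsilon> > 0}"
      unfolding mem_Collect_eq
      by (rule exI[of _ "1::real"], rule exI[of _ 0], rule exI[of _ f], rule exI[of _ "1::real"])
        (simp add: f)
  qed
  then show ?thesis
    unfolding schwartz_topology_def topology_generated_by_topspace by (intro equalityI subsetI) auto
qed

definition weighted_composition ::
    "('n space \<Rightarrow> complex) \<Rightarrow> ('n space \<Rightarrow> 'n space) \<Rightarrow>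
      ('n space \<Rightarrow> complex) \<Rightarrow> 'n space \<Rightarrow> complex"
  where "weighted_composition \<psi> \<phi> f = (\<lambda>x. \<psi> x * f (\<phi> x))"

section \<open>The functions \<open>F\<close> of the Leibniz and Faa di Bruno formula\<close>

text \<open>
  A tuple \<open>(k\<^sub>1, \<dots>, k\<^sub>m; l\<^sub>1, \<dots>, l\<^sub>m)\<close> with \<open>m = |\<beta>|\<close> is a pair of functions extensional on \<open>{1..m}\<close>
  (hence uniquely represented); \<open>\<mu>\<close> is the multi-index usually called \<open>lambda\<close>.
\<close>
definition fdb_indices :: "('n::{finite,linorder}) multi_index \<Rightarrow> 'n multi_index \<Rightarrow>
    ((nat \<Rightarrow> 'n multi_index) \<times> (nat \<Rightarrow> 'n multi_index)) set"
  where "fdb_indices \<beta> \<mu> =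
    (if \<beta> = 0 then (if \<mu> = 0 then {(\<lambda>_. undefined, \<lambda>_. undefined)} else {})
     else let m = mi_size \<beta> in
       {(k, l). k \<in> {1..m} \<rightarrow>\<^sub>E UNIV \<and> l \<in> {1..m} \<rightarrow>\<^sub>E UNIV \<and>
          (\<exists>s\<in>{1..m}.
            (\<forall>j\<in>{1..m-s}. k j = 0 \<and> l j = 0) \<and>
            (\<forall>j\<in>{m-s+1..m}. mi_size (k j) > 0) \<and>
            0 \<prec> l (m-s+1) \<and>
            (\<forall>j\<in>{m-s+1..<m}. l j \<prec> l (j+1)) \<and>
            (\<Sum>j=1..m. k j) = \<mu> \<and>
            (\<Sum>j=1..m. mi_size (k j) *s l j) = \<beta>)})"

definition fdb_sum :: "(('n::{finite,linorder}) space \<Rightarrow> 'n space) \<Rightarrow> 'n multi_index \<Rightarrow> 'n multi_index \<Rightarrow>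
    'n space \<Rightarrow> real"
  where "fdb_sum \<phi> \<beta> \<mu> x =
    (\<Sum>(k, l)\<in>fdb_indices \<beta> \<mu>. real (mi_fact \<beta>) *
       (\<Prod>j=1..mi_size \<beta>.
          (\<Prod>i\<in>UNIV. mi_derivative (l j) (\<lambda>y. \<phi> y $ i) x ^ (k j $ i)) /
          (real (mi_fact (k j)) * real (mi_fact (l j)) ^ mi_size (k j))))"

definition F_fun :: "(('n::{finite,linorder}) space \<Rightarrow> 'n space) \<Rightarrow> ('n space \<Rightarrow> complex) \<Rightarrow>
    'n multi_index \<Rightarrow> 'n multi_index \<Rightarrow> 'n space \<Rightarrow> complex"
  where "F_fun \<phi> \<psi> \<alpha> \<mu> x =
    (\<Sum>\<beta> | \<beta> \<le> \<alpha> \<and> mi_size \<mu> \<le> mi_size \<beta>.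
       of_nat (mi_choose \<alpha> \<beta>) * mi_derivative (\<alpha> - \<beta>) \<psi> x * of_real (fdb_sum \<phi> \<beta> \<mu> x))"

text \<open>Both index sets are finite, so the sums above do not fall back to the default value 0.\<close>

lemma finite_mi_atMost: "finite {\<beta>. \<beta> \<le> (\<alpha> :: ('n::finite) multi_index)}"
proof -
  have "vec_nth ` {\<beta>. \<beta> \<le> \<alpha>} \<subseteq> (\<Pi>\<^sub>E i\<in>UNIV. {..\<alpha> $ i})"
    by (auto simp: less_eq_vec_def)
  moreover have "finite (\<Pi>\<^sub>E i\<in>UNIV. {..\<alpha> $ i})"
    by (intro finite_PiE) auto
  ultimately have "finite (vec_nth ` {\<beta>. \<beta> \<le> \<alpha>})"
    using finite_subset by blast
  then show ?thesis
    by (rule finite_imageD) (auto simp: inj_on_def vec_eq_iff)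
qed

lemma finite_fdb_indices: "finite (fdb_indices \<beta> \<mu>)"
proof (cases "\<beta> = 0")
  case True
  then show ?thesis by (simp add: fdb_indices_def)
next
  case False
  define m where "m = mi_size \<beta>"
  have "fdb_indices \<beta> \<mu> \<subseteq> ({1..m} \<rightarrow>\<^sub>E {\<kappa>. \<kappa> \<le> \<mu>}) \<times> ({1..m} \<rightarrow>\<^sub>E {\<gamma>. \<gamma> \<le> \<beta>})"
  proof (rule subsetI, clarify)
    fix k l assume "(k, l) \<in> fdb_indices \<beta> \<mu>"
    then obtain s where k: "k \<in> {1..m} \<rightarrow>\<^sub>E UNIV" and l: "l \<in> {1..m} \<rightarrow>\<^sub>E UNIV"
      and low: "\<forall>j\<in>{1..m-s}. k j = 0 \<and> l j = 0"
      and high: "\<forall>j\<in>{m-s+1..m}. mi_size (k j) > 0"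
      and sk: "(\<Sum>j=1..m. k j) = \<mu>" and sl: "(\<Sum>j=1..m. mi_size (k j) *s l j) = \<beta>"
      using False by (auto simp: fdb_indices_def Let_def m_def)
    have "k j \<le> \<mu>" if "j \<in> {1..m}" for j
      unfolding sk[symmetric] less_eq_vec_def
      using that by (auto intro!: member_le_sum)
    moreover have "l j \<le> \<beta>" if j: "j \<in> {1..m}" for j
    proof (cases "j \<le> m - s")
      case True
      then show ?thesis using low j by (auto simp: less_eq_vec_def)
    next
      case False
      then have pos: "mi_size (k j) > 0" using high j by auto
      have "l j $ i \<le> \<beta> $ i" for i
      proof -
        have "l j $ i \<le> mi_size (k j) * l j $ i" using pos by simp
        also have "\<dots> \<le> (\<Sum>j=1..m. mi_size (k j) * l j $ i)"
          using j by (intro member_le_sum[of j _ "\<lambda>j. mi_size (k j) * l j $ i"]) auto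
        also have "\<dots> = \<beta> $ i" unfolding sl[symmetric] by simp
        finally show ?thesis .
      qed
      then show ?thesis by (simp add: less_eq_vec_def)
    qed
    ultimately show "k \<in> {1..m} \<rightarrow>\<^sub>E {\<kappa>. \<kappa> \<le> \<mu>} \<and> l \<in> {1..m} \<rightarrow>\<^sub>E {\<gamma>. \<gamma> \<le> \<beta>}"
      using k l by (auto simp: PiE_iff)
  qed
  moreover have "finite (({1..m} \<rightarrow>\<^sub>E {\<kappa>. \<kappa> \<le> \<mu>}) \<times> ({1..m} \<rightarrow>\<^sub>E {\<gamma>. \<gamma> \<le> \<beta>}))"
    by (intro finite_cartesian_product finite_PiE) (auto intro: finite_mi_atMost)
  ultimately show ?thesis by (rule finite_subset)
qed

end

theory Submission
  imports Defs
begin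

text \<open>
  The coefficient \<open>F_fun \<phi> \<psi> \<alpha> \<mu> x\<close> is the \<open>\<alpha>\<close>-th derivative at \<open>x\<close> of
  \<open>\<psi> \<cdot> (\<phi> - \<phi> x)\<^sup>\<mu> / \<mu>!\<close>; this gives both the formula for the derivatives of \<open>\<psi> \<cdot> (f \<circ> \<phi>)\<close> and
  test functions that isolate a single coefficient. The growth condition bounds the seminorms of
  \<open>\<psi> \<cdot> (f \<circ> \<phi>)\<close> by those of \<open>f\<close>. Conversely, if every \<open>\<psi> \<cdot> (f \<circ> \<phi>)\<close> is a Schwartz function,
  then on \<open>{x. |\<phi> x| \<le> R}\<close> the coefficient is a combination, with coefficients bounded in \<open>x\<close>, of
  derivatives of \<open>\<psi> \<cdot> (f \<circ> \<phi>)\<close> for finitely many \<open>f\<close>. So a failure of the growth condition occurs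
  along points \<open>x\<^sub>n\<close> with \<open>|\<phi> x\<^sub>n|\<close> tending rapidly to infinity, and a sum of small bumps at the points
  \<open>\<phi> x\<^sub>n\<close> is a Schwartz function \<open>f\<close> violating the hypothesis. This avoids the closed graph theorem.
\<close>

section \<open>Calculus of partial derivatives\<close>

text \<open>The map \<phi> need not be proper: the set where |\<phi> x| \<le> R can be unbounded, so
  continuity alone gives no bound for the coefficient there and the hypothesis has to be used a
  first time. It cannot be applied to the monomial centred at \<phi> x directly, because this
  function moves with x; expanding it around a fixed centre costs powers of the coordinates of
  \<phi> x, which are at most R in modulus. The second use has to defeat every exponent q with one
  function: the n-th witness is chosen for q = n + 1, and its bump gets the height (1 + |\<phi>
  x_n|)^-(n+1), which for large n lies below any fixed negative power. The explicit sum over ordered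
  tuples enters only where the coefficient is identified with a derivative: it is a multinomial
  expansion, and the order \<prec> serves to list each assignment of exponents exactly once.\<close>

lemma partial_derivative_eq:
  assumes "(f has_derivative D) (at x)"
  shows "partial_derivative i f x = D (axis i 1)"
  unfolding partial_derivative_def using frechet_derivative_at[OF assms] by simp

lemma has_frechet_derivative:
  assumes "f differentiable (at x)"
  shows "(f has_derivative frechet_derivative f (at x)) (at x)"
  using assms frechet_derivative_works by blast

lemma partial_derivative_const [simp]: "partial_derivative i (\<lambda>x. c) = (\<lambda>x. 0)"
  by (rule ext) (simp add: partial_derivative_def)

lemma partial_derivative_add:
  assumes "f differentiable (at x)" "g differentiable (at x)"
  shows "partial_derivative i (\<lambda>x. f x + g x) x = partial_derivative i f x + partial_derivative i g x"
  by (subst partial_derivative_eq[OF has_derivative_add[OF assms[THEN has_frechet_derivative]]])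
    (simp add: partial_derivative_def)

lemma (in bounded_linear) partial_derivative_image:
  assumes "g differentiable (at x)"
  shows "partial_derivative i (\<lambda>x. f (g x)) x = f (partial_derivative i g x)"
  by (subst partial_derivative_eq[OF has_derivative[OF has_frechet_derivative[OF assms]]])
    (simp add: partial_derivative_def)

lemma (in bounded_bilinear) partial_derivative_bilinear:
  assumes "f differentiable (at x)" "g differentiable (at x)"
  shows "partial_derivative i (\<lambda>x. prod (f x) (g x)) x =
    prod (partial_derivative i f x) (g x) + prod (f x) (partial_derivative i g x)"
  by (subst partial_derivative_eq[OF FDERIV[OF assms[THEN has_frechet_derivative]]])
    (simp add: partial_derivative_def)

lemma (in bounded_bilinear) differentiable_bilinear:
  assumes "f differentiable (at x)" "g differentiable (at x)"
  shows "(\<lambda>x. prod (f x) (g x)) differentiable (at x)"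
  using FDERIV[OF assms[THEN has_frechet_derivative]] by (auto simp: differentiable_def)

lemma (in bounded_linear) differentiable_image:
  assumes "g differentiable (at x)"
  shows "(\<lambda>x. f (g x)) differentiable (at x)"
  using has_derivative[OF assms[THEN has_frechet_derivative]] by (auto simp: differentiable_def)

lemma partial_derivative_compose:
  fixes \<phi> :: "('n::finite) space \<Rightarrow> ('m::finite) space"
  assumes "\<phi> differentiable (at x)" "f differentiable (at (\<phi> x))"
  shows "partial_derivative i (\<lambda>x. f (\<phi> x)) x =
    (\<Sum>j\<in>UNIV. partial_derivative i (\<lambda>x. \<phi> x $ j) x *\<^sub>R partial_derivative j f (\<phi> x))"
proof -
  let ?D = "frechet_derivative f (at (\<phi> x))" and ?E = "frechet_derivative \<phi> (at x)"
  have D: "(f has_derivative ?D) (at (\<phi> x))" and E: "(\<phi> has_derivative ?E) (at x)"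
    using assms has_frechet_derivative by auto
  have lin: "linear ?D"
    using D has_derivative_linear by blast
  have "((\<lambda>x. f (\<phi> x)) has_derivative (\<lambda>h. ?D (?E h))) (at x)"
    using has_derivative_compose[OF E D] .
  then have "partial_derivative i (\<lambda>x. f (\<phi> x)) x = ?D (?E (axis i 1))"
    by (rule partial_derivative_eq)
  also have "?E (axis i 1) = (\<Sum>j\<in>UNIV. (?E (axis i 1) $ j) *\<^sub>R axis j 1)"
    by (simp add: vec_eq_iff axis_def if_distrib cong: if_cong)
  also have "?D \<dots> = (\<Sum>j\<in>UNIV. (?E (axis i 1) $ j) *\<^sub>R ?D (axis j 1))"
    by (simp add: linear_sum[OF lin] linear_scale[OF lin])
  also have "\<dots> = (\<Sum>j\<in>UNIV. partial_derivative i (\<lambda>x. \<phi> x $ j) x *\<^sub>R partial_derivative j f (\<phi> x))"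
  proof (rule sum.cong)
    fix j
    have "((\<lambda>x. \<phi> x $ j) has_derivative (\<lambda>h. ?E h $ j)) (at x)"
      by (rule bounded_linear.has_derivative[OF bounded_linear_vec_nth E])
    then show "(?E (axis i 1) $ j) *\<^sub>R ?D (axis j 1) =
        partial_derivative i (\<lambda>x. \<phi> x $ j) x *\<^sub>R partial_derivative j f (\<phi> x)"
      using partial_derivative_eq[of "\<lambda>x. \<phi> x $ j"] by (simp add: partial_derivative_def)
  qed simp
  finally show ?thesis .
qed

lemma partial_derivative_shift:
  assumes "f differentiable (at (x - y))"
  shows "partial_derivative i (\<lambda>x. f (x - y)) x = partial_derivative i f (x - y)"
proof -
  have "((\<lambda>x. x - y) has_derivative (\<lambda>h. h)) (at x)"
    by (auto intro!: derivative_eq_intros)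
  from has_derivative_compose[OF this has_frechet_derivative[OF assms]]
  show ?thesis
    by (subst partial_derivative_eq) (auto simp: partial_derivative_def)
qed

text \<open>\<open>frechet_derivative\<close> is a choice among all derivatives. Functions that
  agree near x have the same derivatives at x, so the choice coincides, even when there is none to
  choose.\<close>

lemma partial_derivative_cong_open:
  assumes "open S" "x \<in> S" "\<And>t. t \<in> S \<Longrightarrow> f t = g t"
  shows "partial_derivative i f x = partial_derivative i g x"
proof -
  have "(f has_derivative D) (at x) \<longleftrightarrow> (g has_derivative D) (at x)" for D
    using has_derivative_transform_within_open[of f D x UNIV S g]
      has_derivative_transform_within_open[of g D x UNIV S f] assms by auto
  then show ?thesis
    by (simp add: partial_derivative_def frechet_derivative_def)
qed

section \<open>Smooth functions\<close>

lemma C_diff_Suc_imp: "C_diff (Suc m) f \<Longrightarrow> C_diff m f"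
proof (induction m arbitrary: f)
  case 0
  then show ?case
    by (auto intro!: continuous_at_imp_continuous_on differentiable_imp_continuous_within)
qed auto

lemma smooth_differentiable: "smooth f \<Longrightarrow> f differentiable (at x)"
  unfolding smooth_def using C_diff.simps(2) by blast

lemma smooth_partial_derivative: "smooth f \<Longrightarrow> smooth (partial_derivative i f)"
  unfolding smooth_def using C_diff.simps(2) by blast

lemma smooth_continuous_on: "smooth f \<Longrightarrow> continuous_on S f"
  unfolding smooth_def using C_diff.simps(1) continuous_on_subset by blast

text \<open>Smoothness is the weakest property that implies differentiability and passes to partial
  derivatives, so exhibiting an invariant P replaces an induction on the order.\<close>

lemma smooth_coinduct:
  assumes "P f"
    and step: "\<And>f. P f \<Longrightarrow> (\<forall>x. f differentiable (at x)) \<and> (\<forall>i. P (partial_derivative i f))"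
  shows "smooth f"
proof -
  have "C_diff m f" if "P f" for m f
    using that
  proof (induction m arbitrary: f)
    case 0
    then show ?case
      using step
      by (auto intro!: continuous_at_imp_continuous_on differentiable_imp_continuous_within)
  next
    case (Suc m)
    then show ?case
      using step by simp
  qed
  then show ?thesis
    using assms(1) by (simp add: smooth_def)
qed

lemma smooth_const [simp]: "smooth (\<lambda>x. c)"
  by (rule smooth_coinduct[where P = "\<lambda>f. \<exists>c. f = (\<lambda>x. c)"]) auto

text \<open>Agreeing locally with smooth functions passes to partial derivatives, which makes it an
  invariant for \<open>smooth_coinduct\<close>. It serves the locally finite series of
  bumps.\<close>

lemma smooth_local:
  assumes "\<And>x. \<exists>S g. open S \<and> x \<in> S \<and> smooth g \<and> (\<forall>t\<in>S. f t = g t)"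
  shows "smooth f"
proof (rule smooth_coinduct[where P = "\<lambda>f. \<forall>x. \<exists>S g. open S \<and> x \<in> S \<and> smooth g \<and> (\<forall>t\<in>S. f t = g t)"])
  fix f :: "'a space \<Rightarrow> 'b"
  assume *: "\<forall>x. \<exists>S g. open S \<and> x \<in> S \<and> smooth g \<and> (\<forall>t\<in>S. f t = g t)"
  show "(\<forall>x. f differentiable (at x)) \<and>
    (\<forall>i x. \<exists>S g. open S \<and> x \<in> S \<and> smooth g \<and> (\<forall>t\<in>S. partial_derivative i f t = g t))"
  proof (intro conjI allI)
    fix x
    obtain S g where S: "open S" "x \<in> S" "smooth g" "\<forall>t\<in>S. f t = g t"
      using * by blast
    have "(g has_derivative frechet_derivative g (at x)) (at x)"
      by (intro has_frechet_derivative smooth_differentiable S)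
    then have "(f has_derivative frechet_derivative g (at x)) (at x)"
      using has_derivative_transform_within_open[of g _ x UNIV S f] S by auto
    then show "f differentiable (at x)"
      by (auto simp: differentiable_def)
    fix i
    show "\<exists>S g. open S \<and> x \<in> S \<and> smooth g \<and> (\<forall>t\<in>S. partial_derivative i f t = g t)"
      using S
      by (intro exI[of _ S] exI[of _ "partial_derivative i g"])
        (auto intro!: smooth_partial_derivative partial_derivative_cong_open[of S])
  qed
qed (use assms in blast)

lemma (in bounded_linear) smooth_image:
  assumes "smooth g"
  shows "smooth (\<lambda>x. f (g x))"
proof (rule smooth_coinduct[where P = "\<lambda>u. \<exists>g. smooth g \<and> u = (\<lambda>x. f (g x))"])
  fix u
  assume "\<exists>g. smooth g \<and> u = (\<lambda>x. f (g x))"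
  then obtain g where g: "smooth g" "u = (\<lambda>x. f (g x))"
    by blast
  then have "partial_derivative i u = (\<lambda>x. f (partial_derivative i g x))" for i
    by (auto simp: partial_derivative_image smooth_differentiable)
  then show "(\<forall>x. u differentiable (at x)) \<and>
      (\<forall>i. \<exists>g. smooth g \<and> partial_derivative i u = (\<lambda>x. f (g x)))"
    using g by (auto intro: differentiable_image smooth_differentiable smooth_partial_derivative)
qed (use assms in blast)

lemma C_diff_add:
  "C_diff m f \<Longrightarrow> C_diff m g \<Longrightarrow> C_diff m (\<lambda>x. f x + g x)"
proof (induction m arbitrary: f g)
  case (Suc m)
  then have "partial_derivative i (\<lambda>x. f x + g x) =
      (\<lambda>x. partial_derivative i f x + partial_derivative i g x)" for i
    by (auto simp: partial_derivative_add)
  with Suc show ?case by simp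
qed (auto intro: continuous_intros)

lemma smooth_add: "smooth f \<Longrightarrow> smooth g \<Longrightarrow> smooth (\<lambda>x. f x + g x)"
  by (simp add: smooth_def C_diff_add)

lemma smooth_sum: "(\<And>a. a \<in> A \<Longrightarrow> smooth (f a)) \<Longrightarrow> smooth (\<lambda>x. \<Sum>a\<in>A. f a x)"
  by (induction A rule: infinite_finite_induct) (auto intro: smooth_add)

text \<open>Products are not closed under differentiation, only sums of products are; hence an
  induction on the order with \<open>C_diff_add\<close> instead of an invariant.\<close>

lemma (in bounded_bilinear) C_diff_bilinear:
  "C_diff m f \<Longrightarrow> C_diff m g \<Longrightarrow> C_diff m (\<lambda>x. prod (f x) (g x))"
proof (induction m arbitrary: f g)
  case (Suc m)
  then have "partial_derivative i (\<lambda>x. prod (f x) (g x)) =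
      (\<lambda>x. prod (partial_derivative i f x) (g x) + prod (f x) (partial_derivative i g x))" for i
    by (auto simp: partial_derivative_bilinear)
  moreover have "C_diff m f" "C_diff m g"
    using Suc C_diff_Suc_imp by blast+
  ultimately show ?case
    using Suc by (auto intro!: C_diff_add differentiable_bilinear)
qed (auto intro: continuous_on)

lemma (in bounded_bilinear) smooth_bilinear: "smooth f \<Longrightarrow> smooth g \<Longrightarrow> smooth (\<lambda>x. prod (f x) (g x))"
  by (simp add: smooth_def C_diff_bilinear)

lemmas smooth_scaleR = bounded_bilinear.smooth_bilinear[OF bounded_bilinear_scaleR]
lemmas smooth_mult = bounded_bilinear.smooth_bilinear[OF bounded_bilinear_mult]
lemmas smooth_vec_nth = bounded_linear.smooth_image[OF bounded_linear_vec_nth]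
lemmas smooth_of_real = bounded_linear.smooth_image[OF bounded_linear_of_real]

lemma smooth_diff: "smooth f \<Longrightarrow> smooth g \<Longrightarrow> smooth (\<lambda>x. f x - g x)"
  using smooth_add[of f "\<lambda>x. - g x"] bounded_linear.smooth_image[OF bounded_linear_minus[OF
      bounded_linear_ident], of g]
  by simp

lemma smooth_power: "smooth f \<Longrightarrow> smooth (\<lambda>x. f x ^ k)"
  for f :: "('n::finite) space \<Rightarrow> 'b::real_normed_algebra_1"
  by (induction k) (auto intro: smooth_mult)

lemma smooth_prod: "(\<And>a. a \<in> A \<Longrightarrow> smooth (f a)) \<Longrightarrow> smooth (\<lambda>x. \<Prod>a\<in>A. f a x)"
  for f :: "'a \<Rightarrow> ('n::finite) space \<Rightarrow> 'b::real_normed_field"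
  by (induction A rule: infinite_finite_induct) (auto intro: smooth_mult)

lemma smooth_ident: "smooth (\<lambda>x. x)"
proof -
  have 1: "partial_derivative i (\<lambda>x. x) = (\<lambda>x. axis i 1)" for i :: 'a
    by (rule ext) (simp add: partial_derivative_def)
  show ?thesis
    by (rule smooth_coinduct[where P = "\<lambda>f. f = (\<lambda>x. x) \<or> (\<exists>c. f = (\<lambda>x. c))"]) (auto simp: 1)
qed

lemmas smooth_component = smooth_vec_nth[OF smooth_ident]

lemma smooth_compose:
  fixes \<phi> :: "('n::finite) space \<Rightarrow> ('m::finite) space"
  assumes "smooth f" "smooth \<phi>"
  shows "smooth (\<lambda>x. f (\<phi> x))"
proof -
  have "C_diff m (\<lambda>x. f (\<phi> x))" if "smooth f" for m f
    using that
  proof (induction m arbitrary: f)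
    case 0
    have "continuous_on UNIV (f \<circ> \<phi>)"
      using 0 assms by (intro continuous_on_compose smooth_continuous_on)
    then show ?case
      by (simp add: o_def)
  next
    case (Suc m)
    have d: "\<phi> differentiable (at x)" "f differentiable (at y)" for x y
      using assms Suc smooth_differentiable by blast+
    have "(\<lambda>x. f (\<phi> x)) differentiable (at x)" for x
      using has_derivative_compose[OF d[THEN has_frechet_derivative]]
      by (auto simp: differentiable_def)
    moreover have "C_diff m (\<lambda>x. \<Sum>j\<in>UNIV. partial_derivative i (\<lambda>x. \<phi> x $ j) x *\<^sub>R
        partial_derivative j f (\<phi> x))" for i
    proof -
      have *: "C_diff m (\<lambda>x. \<Sum>j\<in>A. u j x)"
        if "\<And>j. C_diff m (u j)" for A and u :: "'m \<Rightarrow> 'n space \<Rightarrow> 'b"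
        using that smooth_const[unfolded smooth_def]
        by (induction A rule: infinite_finite_induct) (auto intro: C_diff_add)
      show ?thesis
        using smooth_partial_derivative[OF smooth_vec_nth[OF assms(2)]]
        by (intro * bounded_bilinear.C_diff_bilinear[OF bounded_bilinear_scaleR] Suc.IH
            smooth_partial_derivative Suc.prems) (simp add: smooth_def)
    qed
    moreover have "partial_derivative i (\<lambda>x. f (\<phi> x)) = (\<lambda>x. \<Sum>j\<in>UNIV.
        partial_derivative i (\<lambda>x. \<phi> x $ j) x *\<^sub>R partial_derivative j f (\<phi> x))" for i
      by (rule ext) (rule partial_derivative_compose[OF d])
    ultimately show ?case
      by simp
  qed
  then show ?thesis
    using assms(1) unfolding smooth_def by blast
qed

text \<open>G n stands for the n-th derivative of G 0. Restricting to a set S that contains the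
  values of u admits outer functions with singularities elsewhere, such as the reciprocal.\<close>

lemma smooth_compose_real:
  fixes G :: "nat \<Rightarrow> real \<Rightarrow> real"
  assumes u: "smooth u" "\<And>x. u x \<in> S"
    and G: "\<And>n t. t \<in> S \<Longrightarrow> (G n has_real_derivative G (Suc n) t) (at t)"
  shows "smooth (\<lambda>x. G 0 (u x))"
proof -
  have d: "((\<lambda>x. G n (u x)) has_derivative (\<lambda>h. G (Suc n) (u x) * frechet_derivative u (at x) h))
      (at x)" for n x
    using has_derivative_compose[OF has_frechet_derivative[OF smooth_differentiable[OF u(1)]]
      G[OF u(2), unfolded has_field_derivative_def]] .
  have p: "partial_derivative i (\<lambda>x. G n (u x)) = (\<lambda>x. G (Suc n) (u x) * partial_derivative i u
      x)" for n i
    by (rule ext) (simp add: partial_derivative_eq[OF d] partial_derivative_def[of _ u])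
  have "C_diff m (\<lambda>x. G n (u x))" for m n
  proof (induction m arbitrary: n)
    case 0
    show ?case
      using d by (auto intro!: continuous_at_imp_continuous_on has_derivative_continuous)
  next
    case (Suc m)
    then show ?case
      using d smooth_partial_derivative[OF u(1)]
      by (auto simp: p differentiable_def smooth_def
          intro!: bounded_bilinear.C_diff_bilinear[OF bounded_bilinear_mult])
  qed
  then show ?thesis
    by (simp add: smooth_def)
qed

text \<open>Otherwise the simplifier turns the unit vectors \<open>axis i 1\<close> into \<open>axis i (Suc 0)\<close>.\<close>
declare One_nat_def [simp del]

section \<open>Symmetry of second derivatives\<close>

lemma has_vector_derivative_along_axis:
  assumes "smooth f"
  shows "((\<lambda>s. f (x + s *\<^sub>R axis i 1)) has_vector_derivative
    partial_derivative i f (x + s *\<^sub>R axis i 1)) (at s)"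
proof -
  let ?D = "frechet_derivative f (at (x + s *\<^sub>R axis i 1))"
  have D: "(f has_derivative ?D) (at (x + s *\<^sub>R axis i 1))"
    by (intro has_frechet_derivative smooth_differentiable assms)
  have "((\<lambda>s. x + s *\<^sub>R axis i 1) has_derivative (\<lambda>h. h *\<^sub>R axis i 1)) (at s)"
    by (auto intro!: derivative_eq_intros)
  from has_derivative_compose[OF this D]
  have "((\<lambda>s. f (x + s *\<^sub>R axis i 1)) has_derivative (\<lambda>h. h *\<^sub>R ?D (axis i 1))) (at s)"
    by (simp add: linear_scale[OF has_derivative_linear[OF D]])
  then show ?thesis
    by (simp add: has_vector_derivative_def partial_derivative_def)
qed

text \<open>Two applications of the mean value theorem: in direction i to the increment g in
  direction j, then in direction j. The left-hand side is symmetric in i and j, whereas the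
  right-hand side shows the mixed derivative in one order.\<close>

lemma second_difference:
  fixes f :: "('n::finite) space \<Rightarrow> real"
  assumes f: "smooth f" and h: "0 < h"
  shows "\<exists>p. dist p x \<le> 2 * h \<and>
    f (x + h *\<^sub>R axis i 1 + h *\<^sub>R axis j 1) - f (x + h *\<^sub>R axis i 1) - f (x + h *\<^sub>R axis j 1) + f x
      = h\<^sup>2 * partial_derivative j (partial_derivative i f) p"
proof -
  define g where "g s = f (x + h *\<^sub>R axis j 1 + s *\<^sub>R axis i 1) - f (x + s *\<^sub>R axis i 1)" for s
  have "(g has_real_derivative partial_derivative i f (x + h *\<^sub>R axis j 1 + s *\<^sub>R axis i 1)
      - partial_derivative i f (x + s *\<^sub>R axis i 1)) (at s)" for s
    unfolding has_real_derivative_iff_has_vector_derivative g_def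
    by (intro has_vector_derivative_diff has_vector_derivative_along_axis f)
  from MVT2[OF h this] obtain z where z: "0 < z" "z < h" and
    1: "g h - g 0 = h * (partial_derivative i f (x + h *\<^sub>R axis j 1 + z *\<^sub>R axis i 1)
      - partial_derivative i f (x + z *\<^sub>R axis i 1))"
    by auto
  have "((\<lambda>s. partial_derivative i f ((x + z *\<^sub>R axis i 1) + s *\<^sub>R axis j 1)) has_real_derivative
      partial_derivative j (partial_derivative i f) ((x + z *\<^sub>R axis i 1) + s *\<^sub>R axis j 1)) (at
          s)" for s
    unfolding has_real_derivative_iff_has_vector_derivative
    by (intro has_vector_derivative_along_axis smooth_partial_derivative f)
  from MVT2[OF h this] obtain w where w: "0 < w" "w < h" and
    2: "partial_derivative i f ((x + z *\<^sub>R axis i 1) + h *\<^sub>R axis j 1) - partial_derivative i f (x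
        + z *\<^sub>R axis i 1)
      = h * partial_derivative j (partial_derivative i f) ((x + z *\<^sub>R axis i 1) + w *\<^sub>R axis j 1)"
    by auto
  have "norm (z *\<^sub>R axis i (1::real) + w *\<^sub>R axis j 1 :: (real, 'n) vec) \<le> 2 * h"
    by (rule norm_triangle_le) (use z w in simp)
  then have "dist (x + z *\<^sub>R axis i 1 + w *\<^sub>R axis j 1) x \<le> 2 * h"
    by (simp add: dist_norm add.assoc)
  moreover have "g h - g 0 = h\<^sup>2 * partial_derivative j (partial_derivative i f) (x + z *\<^sub>R axis i
      1 + w *\<^sub>R axis j 1)"
    using 1 2 by (simp add: power2_eq_square add_ac)
  ultimately show ?thesis
    by (intro exI[of _ "x + z *\<^sub>R axis i 1 + w *\<^sub>R axis j 1"]) (simp add: g_def algebra_simps)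
qed

text \<open>By the symmetry of the second difference, the two mixed derivatives take a common value
  at points p and q within 2h of x; continuity gives the claim as h tends to 0.\<close>

lemma partial_derivative_commute_real:
  fixes f :: "('n::finite) space \<Rightarrow> real"
  assumes f: "smooth f"
  shows "partial_derivative i (partial_derivative j f) x
      = partial_derivative j (partial_derivative i f) x"
proof -
  let ?A = "partial_derivative i (partial_derivative j f)"
  let ?B = "partial_derivative j (partial_derivative i f)"
  define h where "h n = inverse (real (Suc n))" for n
  have "\<exists>p q. dist p x \<le> 2 * h n \<and> dist q x \<le> 2 * h n \<and> ?A p = ?B q" for n
  proof -
    have h: "h n > 0" by (simp add: h_def)
    obtain p where p: "dist p x \<le> 2 * h n" "f (x + h n *\<^sub>R axis j 1 + h n *\<^sub>R axis i 1)
        - f (x + h n *\<^sub>R axis j 1) - f (x + h n *\<^sub>R axis i 1) + f x = (h n)\<^sup>2 * ?A p"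
      using second_difference[OF f h, of x j i] by blast
    obtain q where q: "dist q x \<le> 2 * h n" "f (x + h n *\<^sub>R axis i 1 + h n *\<^sub>R axis j 1)
        - f (x + h n *\<^sub>R axis i 1) - f (x + h n *\<^sub>R axis j 1) + f x = (h n)\<^sup>2 * ?B q"
      using second_difference[OF f h, of x i j] by blast
    have "(h n)\<^sup>2 * ?A p = (h n)\<^sup>2 * ?B q"
      unfolding p(2)[symmetric] q(2)[symmetric] by (simp add: algebra_simps)
    then show ?thesis
      using h p(1) q(1) by auto
  qed
  then obtain p q where pq: "\<And>n. dist (p n) x \<le> 2 * h n" "\<And>n. dist (q n) x \<le> 2 * h n"
    "\<And>n. ?A (p n) = ?B (q n)"
    by metis
  have h0: "(\<lambda>n. 2 * h n) \<longlonglongrightarrow> 0"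
    unfolding h_def using tendsto_mult_right_zero[OF LIMSEQ_inverse_real_of_nat] .
  have p: "p \<longlonglongrightarrow> x" and q: "q \<longlonglongrightarrow> x"
    by (rule metric_tendsto_imp_tendsto[OF h0], use pq(1,2) in \<open>simp add: h_def\<close>)+
  have cont: "isCont (partial_derivative a (partial_derivative b f)) x" for a b
    using smooth_continuous_on[of "partial_derivative a (partial_derivative b f)" UNIV] f
    by (auto simp: continuous_on_eq_continuous_at intro!: smooth_partial_derivative)
  have "(\<lambda>n. ?A (p n)) \<longlonglongrightarrow> ?A x" "(\<lambda>n. ?B (q n)) \<longlonglongrightarrow> ?B x"
    using isCont_tendsto_compose[OF cont p] isCont_tendsto_compose[OF cont q] by auto
  then show ?thesis
    using pq(3) LIMSEQ_unique by auto
qed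

text \<open>The mean value theorem requires real values; inner products with arbitrary vectors
  reduce to that case. This is the origin of the sort \<open>real_inner\<close> in the facts
  below.\<close>

lemma partial_derivative_commute:
  fixes f :: "('n::finite) space \<Rightarrow> 'b::real_inner"
  assumes f: "smooth f"
  shows "partial_derivative i (partial_derivative j f) = partial_derivative j (partial_derivative i f)"
proof
  fix x
  have 1: "partial_derivative i (\<lambda>x. g x \<bullet> c) = (\<lambda>x. partial_derivative i g x \<bullet> c)"
    if "smooth g" for g :: "'n space \<Rightarrow> 'b" and c i
    by (rule ext) (intro bounded_linear.partial_derivative_image[OF bounded_linear_inner_left]
        smooth_differentiable that)
  have "partial_derivative i (partial_derivative j f) x \<bullet> c
      = partial_derivative j (partial_derivative i f) x \<bullet> c" for c
    using partial_derivative_commute_real[OF bounded_linear.smooth_image[OF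
        bounded_linear_inner_left f], of i j c x]
    by (simp add: 1 f smooth_partial_derivative)
  then show "partial_derivative i (partial_derivative j f) x
      = partial_derivative j (partial_derivative i f) x"
    using vector_eq_rdot by blast
qed

section \<open>Multi-index derivatives\<close>

lemma mi_size_zero [simp]: "mi_size 0 = 0"
  by (simp add: mi_size_def)

lemma mi_size_eq_0_iff: "mi_size \<alpha> = 0 \<longleftrightarrow> \<alpha> = 0"
  by (simp add: mi_size_def vec_eq_iff)

lemma mi_size_add: "mi_size (\<alpha> + \<beta>) = mi_size \<alpha> + mi_size \<beta>"
  by (simp add: mi_size_def sum.distrib)

lemma mi_size_axis [simp]: "mi_size (axis i k) = k"
  by (simp add: mi_size_def axis_def)

lemma mi_fact_zero [simp]: "mi_fact 0 = 1"
  by (simp add: mi_fact_def)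

lemma mi_fact_pos [simp]: "mi_fact \<alpha> > 0"
  by (simp add: mi_fact_def prod_pos)

lemma mi_fact_nonzero [simp]: "mi_fact \<alpha> \<noteq> 0"
  using mi_fact_pos[of \<alpha>] by linarith

lemma mi_fact_add_axis: "mi_fact (\<alpha> + axis i 1) = Suc (\<alpha> $ i) * mi_fact \<alpha>"
proof -
  have split: "mi_fact \<beta> = fact (\<beta> $ i) * (\<Prod>j\<in>UNIV - {i}. fact (\<beta> $ j))" for \<beta> :: "'a multi_index"
    unfolding mi_fact_def by (rule prod.remove) auto
  have "(\<Prod>j\<in>UNIV - {i}. fact ((\<alpha> + axis i 1) $ j)) = (\<Prod>j\<in>UNIV - {i}. fact (\<alpha> $ j) :: nat)"
    by (rule prod.cong) (auto simp: axis_def)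
  moreover have "(\<alpha> + axis i 1) $ i = Suc (\<alpha> $ i)"
    by (simp add: axis_def)
  ultimately show ?thesis
    by (simp only: split fact_Suc of_nat_id mult.assoc)
qed

lemma axis_le_iff: "axis i 1 \<le> \<alpha> \<longleftrightarrow> 0 < \<alpha> $ i" for \<alpha> :: "('n::finite) multi_index"
  by (auto simp: less_eq_vec_def axis_def Suc_le_eq)

lemma mi_diff_add: "\<beta> \<le> \<alpha> \<Longrightarrow> \<alpha> - \<beta> + \<beta> = \<alpha>" for \<alpha> \<beta> :: "('n::finite) multi_index"
  by (simp add: less_eq_vec_def vec_eq_iff)

text \<open>The step may add any unit vector, so it fits rules such as
  \<open>mi_derivative_add_axis\<close> that single out no coordinate.\<close>

lemma multi_index_induct [case_names zero step]:
  fixes \<alpha> :: "('n::finite) multi_index"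
  assumes "P 0" and step: "\<And>\<alpha> i. P \<alpha> \<Longrightarrow> P (\<alpha> + axis i 1)"
  shows "P \<alpha>"
proof (induction "mi_size \<alpha>" arbitrary: \<alpha>)
  case 0
  then show ?case
    using assms(1) mi_size_eq_0_iff[of \<alpha>] by simp
next
  case (Suc m)
  then have "\<alpha> \<noteq> 0"
    by auto
  then obtain i where "\<alpha> $ i > 0"
    by (auto simp: vec_eq_iff)
  then have eq: "\<alpha> - axis i 1 + axis i 1 = \<alpha>"
    by (intro mi_diff_add) (simp add: axis_le_iff)
  then have "mi_size (\<alpha> - axis i 1) = m"
    using Suc(2) mi_size_add[of "\<alpha> - axis i 1" "axis i 1"] by simp
  then have "P (\<alpha> - axis i 1)"
    using Suc(1) by blast
  from step[OF this, of i] show ?case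
    by (simp only: eq)
qed

lemma finite_mi_size_le: "finite {\<mu> :: ('n::finite) multi_index. mi_size \<mu> \<le> m}"
proof (rule finite_subset)
  show "{\<mu> :: 'n multi_index. mi_size \<mu> \<le> m} \<subseteq> {\<beta>. \<beta> \<le> (\<chi> i. m)}"
  proof clarsimp
    fix \<mu> :: "'n multi_index"
    assume "mi_size \<mu> \<le> m"
    moreover have "\<mu> $ i \<le> mi_size \<mu>" for i
      unfolding mi_size_def by (rule member_le_sum) auto
    ultimately show "\<mu> \<le> (\<chi> i. m)"
      unfolding less_eq_vec_def using le_trans by fastforce
  qed
qed (rule finite_mi_atMost)

lemma mi_derivative_0 [simp]: "mi_derivative 0 f = f"
proof -
  have "fold (\<lambda>i. partial_derivative i ^^ ((0::'a multi_index) $ i)) xs f = f" for xs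
    by (induction xs) auto
  then show ?thesis
    by (simp add: mi_derivative_def)
qed

lemma smooth_funpow_partial_derivative: "smooth f \<Longrightarrow> smooth ((partial_derivative i ^^ k) f)"
  by (induction k) (auto intro: smooth_partial_derivative)

lemma funpow_partial_derivative_commute:
  fixes f :: "('n::finite) space \<Rightarrow> 'b::real_inner"
  assumes "smooth f"
  shows "partial_derivative j ((partial_derivative i ^^ k) f)
      = (partial_derivative i ^^ k) (partial_derivative j f)"
  by (induction k) (simp_all add: partial_derivative_commute[of _ j i]
      smooth_funpow_partial_derivative assms)

text \<open>Partial derivatives commute, so the additional one in direction i moves through the
  coordinates processed before i and can be taken first.\<close>

lemma mi_derivative_add_axis:
  fixes f :: "('n::{finite,linorder}) space \<Rightarrow> 'b::real_inner"
  assumes "smooth f"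
  shows "mi_derivative (\<alpha> + axis i 1) f = mi_derivative \<alpha> (partial_derivative i f)"
proof -
  \<comment> \<open>Coordinates other than i keep their exponents; this covers the part of the list
    after i.\<close>
  have notin: "fold (\<lambda>k. partial_derivative k ^^ ((\<alpha> + axis i 1) $ k)) xs g =
      fold (\<lambda>k. partial_derivative k ^^ (\<alpha> $ k)) xs g" if "i \<notin> set xs" for xs and g :: "'n space \<Rightarrow> 'b"
    using that by (intro fold_cong) (auto simp: axis_def)
  have "fold (\<lambda>k. partial_derivative k ^^ ((\<alpha> + axis i 1) $ k)) xs f =
      fold (\<lambda>k. partial_derivative k ^^ (\<alpha> $ k)) xs (partial_derivative i f)"
    if "distinct xs" "i \<in> set xs" "smooth f" for xs and f :: "'n space \<Rightarrow> 'b"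
    using that
  proof (induction xs arbitrary: f)
    case (Cons a xs)
    show ?case
    proof (cases "a = i")
      case True
      then have "(partial_derivative a ^^ ((\<alpha> + axis i 1) $ a)) f
          = (partial_derivative a ^^ (\<alpha> $ a)) (partial_derivative i f)"
        by (simp add: axis_def funpow_swap1 flip: Suc_eq_plus1)
      then show ?thesis
        using notin[of xs] Cons True by simp
    next
      case False
      then have "(\<alpha> + axis i 1) $ a = \<alpha> $ a"
        by (simp add: axis_def)
      then show ?thesis
        using False Cons by (simp add: smooth_funpow_partial_derivative
            funpow_partial_derivative_commute)
    qed
  qed simp
  from this[of "sorted_list_of_set UNIV" f] assms show ?thesis
    by (simp add: mi_derivative_def)
qed

lemma smooth_mi_derivative:
  fixes f :: "('n::{finite,linorder}) space \<Rightarrow> 'b::real_inner"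
  shows "smooth f \<Longrightarrow> smooth (mi_derivative \<alpha> f)"
  by (induction \<alpha> arbitrary: f rule: multi_index_induct)
    (simp_all add: mi_derivative_add_axis smooth_partial_derivative)

lemma mi_derivative_const: "mi_derivative \<alpha> (\<lambda>x. c) = (\<lambda>x. if \<alpha> = 0 then c else 0)"
  for c :: "'b::real_inner"
proof (induction \<alpha> rule: multi_index_induct)
  case (step \<alpha> i)
  have "(\<alpha> + axis i 1) $ i \<noteq> 0"
    by (simp add: axis_def)
  then have "\<alpha> + axis i 1 \<noteq> 0"
    by (metis zero_index)
  then show ?case
    by (simp add: mi_derivative_add_axis mi_derivative_zero)
qed simp

lemma mi_derivative_add:
  fixes f g :: "('n::{finite,linorder}) space \<Rightarrow> 'b::real_inner"
  assumes "smooth f" "smooth g"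
  shows "mi_derivative \<alpha> (\<lambda>x. f x + g x) = (\<lambda>x. mi_derivative \<alpha> f x + mi_derivative \<alpha> g x)"
  using assms
proof (induction \<alpha> arbitrary: f g rule: multi_index_induct)
  case (step \<alpha> i)
  have "partial_derivative i (\<lambda>x. f x + g x) = (\<lambda>x. partial_derivative i f x + partial_derivative i g x)"
    by (rule ext) (intro partial_derivative_add smooth_differentiable step)
  then show ?case
    using step by (simp add: mi_derivative_add_axis smooth_add smooth_partial_derivative)
qed simp

lemma mi_derivative_bounded_linear:
  fixes g :: "('n::{finite,linorder}) space \<Rightarrow> 'b::real_inner" and f :: "'b \<Rightarrow> 'c::real_inner"
  assumes f: "bounded_linear f" and "smooth g"
  shows "mi_derivative \<alpha> (\<lambda>x. f (g x)) = (\<lambda>x. f (mi_derivative \<alpha> g x))"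
  using assms(2)
proof (induction \<alpha> arbitrary: g rule: multi_index_induct)
  case (step \<alpha> i)
  have "partial_derivative i (\<lambda>x. f (g x)) = (\<lambda>x. f (partial_derivative i g x))"
    by (rule ext) (intro bounded_linear.partial_derivative_image[OF f] smooth_differentiable step)
  then show ?case
    using step
    by (simp add: mi_derivative_add_axis bounded_linear.smooth_image[OF f] smooth_partial_derivative)
qed simp

lemma mi_derivative_cmult:
  fixes f :: "('n::{finite,linorder}) space \<Rightarrow> complex"
  shows "smooth f \<Longrightarrow> mi_derivative \<alpha> (\<lambda>x. c * f x) = (\<lambda>x. c * mi_derivative \<alpha> f x)"
  by (rule mi_derivative_bounded_linear[OF bounded_linear_mult_right])

lemma mi_derivative_diff:
  fixes f g :: "('n::{finite,linorder}) space \<Rightarrow> complex"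
  assumes "smooth f" "smooth g"
  shows "mi_derivative \<alpha> (\<lambda>x. f x - g x) = (\<lambda>x. mi_derivative \<alpha> f x - mi_derivative \<alpha> g x)"
  using mi_derivative_add[of f "\<lambda>x. - 1 * g x" \<alpha>] mi_derivative_cmult[of g \<alpha> "-1"] assms
    smooth_mult[OF smooth_const, of g "-1"]
  by simp

lemma mi_derivative_sum:
  fixes f :: "'a \<Rightarrow> ('n::{finite,linorder}) space \<Rightarrow> 'b::real_inner"
  assumes "\<And>a. a \<in> A \<Longrightarrow> smooth (f a)"
  shows "mi_derivative \<alpha> (\<lambda>x. \<Sum>a\<in>A. f a x) = (\<lambda>x. \<Sum>a\<in>A. mi_derivative \<alpha> (f a) x)"
  using assms
  by (induction A rule: infinite_finite_induct)
    (simp_all add: mi_derivative_zero mi_derivative_add smooth_sum)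

lemma mi_derivative_shift:
  fixes f :: "('n::{finite,linorder}) space \<Rightarrow> 'b::real_inner"
  assumes "smooth f"
  shows "mi_derivative \<alpha> (\<lambda>x. f (x - y)) = (\<lambda>x. mi_derivative \<alpha> f (x - y))"
  using assms
proof (induction \<alpha> arbitrary: f rule: multi_index_induct)
  case (step \<alpha> i)
  have "partial_derivative i (\<lambda>x. f (x - y)) = (\<lambda>x. partial_derivative i f (x - y))"
    by (rule ext) (intro partial_derivative_shift smooth_differentiable step)
  then show ?case
    using step smooth_compose[OF _ smooth_diff[OF smooth_ident smooth_const[of y]], of f]
    by (simp add: mi_derivative_add_axis smooth_partial_derivative)
qed simp

lemma mi_derivative_cong_open:
  assumes "open S" "\<And>t. t \<in> S \<Longrightarrow> f t = g t" "t \<in> S"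
  shows "mi_derivative \<alpha> f t = mi_derivative \<alpha> g t"
proof -
  have 1: "\<forall>t\<in>S. (partial_derivative i ^^ k) f t = (partial_derivative i ^^ k) g t"
    if "\<forall>t\<in>S. f t = g t" for i k and f g :: "'a space \<Rightarrow> 'b"
    using that
    by (induction k) (auto intro: partial_derivative_cong_open[OF assms(1)])
  have "\<forall>t\<in>S. fold (\<lambda>i. partial_derivative i ^^ (\<alpha> $ i)) xs f t =
      fold (\<lambda>i. partial_derivative i ^^ (\<alpha> $ i)) xs g t" if "\<forall>t\<in>S. f t = g t" for xs
          and f g :: "'a space \<Rightarrow> 'b"
    using that 1 by (induction xs arbitrary: f g) simp_all
  then show ?thesis
    using assms by (simp add: mi_derivative_def)
qed

section \<open>Taylor coefficients and the Leibniz rule\<close>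

text \<open>With the factor 1/\<alpha>! the Leibniz rule becomes a Cauchy product, without binomial
  coefficients.\<close>

definition taylor_coeff :: "('n::{finite,linorder}) multi_index \<Rightarrow> ('n space \<Rightarrow> complex) \<Rightarrow> 'n space
    \<Rightarrow> complex"
  where "taylor_coeff \<alpha> f x = mi_derivative \<alpha> f x / of_nat (mi_fact \<alpha>)"

lemma taylor_coeff_partial_derivative:
  assumes "smooth f"
  shows "taylor_coeff \<alpha> (partial_derivative i f) x = of_nat (Suc (\<alpha> $ i)) * taylor_coeff (\<alpha> + axis
      i 1) f x"
  using mi_fact_pos[of \<alpha>]
  by (simp add: taylor_coeff_def mi_derivative_add_axis[OF assms] mi_fact_add_axis del: of_nat_Suc
      mult_Suc)

lemma taylor_coeff_add:
  "smooth f \<Longrightarrow> smooth g \<Longrightarrow> taylor_coeff \<alpha> (\<lambda>x. f x + g x) x = taylor_coeff \<alpha> f x + taylor_coeff \<alpha> g x"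
  by (simp add: taylor_coeff_def mi_derivative_add add_divide_distrib)

lemma taylor_coeff_cmult:
  "smooth f \<Longrightarrow> taylor_coeff \<alpha> (\<lambda>x. c * f x) x = c * taylor_coeff \<alpha> f x"
  by (simp add: taylor_coeff_def mi_derivative_cmult)

text \<open>For power series with coefficients T and U this is the product rule for the derivative
  in the i-th variable. It rests on \<alpha>_i + 1 = \<beta>_i + (\<alpha>_i + 1 - \<beta>_i), which
  splits each term into two.\<close>

lemma convolution_add_axis:
  fixes T U :: "('n::finite) multi_index \<Rightarrow> complex"
  shows "of_nat (Suc (\<alpha> $ i)) * (\<Sum>\<beta>\<in>{..\<alpha> + axis i 1}. T \<beta> * U (\<alpha> + axis i 1 - \<beta>)) =
    (\<Sum>\<beta>\<in>{..\<alpha>}. of_nat (Suc (\<beta> $ i)) * T (\<beta> + axis i 1) * U (\<alpha> - \<beta>)) +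
    (\<Sum>\<beta>\<in>{..\<alpha>}. T \<beta> * (of_nat (Suc ((\<alpha> - \<beta>) $ i)) * U (\<alpha> - \<beta> + axis i 1)))"
proof -
  let ?e = "axis i (1::nat)"
  have fin: "finite {..\<alpha>}" for \<alpha> :: "'n multi_index"
    unfolding atMost_def by (rule finite_mi_atMost)
  have "of_nat (Suc (\<alpha> $ i)) * (\<Sum>\<beta>\<in>{..\<alpha> + ?e}. T \<beta> * U (\<alpha> + ?e - \<beta>)) =
      (\<Sum>\<beta>\<in>{..\<alpha> + ?e}. of_nat (\<beta> $ i) * T \<beta> * U (\<alpha> + ?e - \<beta>)) +
      (\<Sum>\<beta>\<in>{..\<alpha> + ?e}. of_nat (Suc (\<alpha> $ i) - \<beta> $ i) * T \<beta> * U (\<alpha> + ?e - \<beta>))"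
    unfolding sum.distrib[symmetric] sum_distrib_left
  proof (rule sum.cong)
    fix \<beta> :: "'n multi_index"
    assume "\<beta> \<in> {..\<alpha> + ?e}"
    then have "\<beta> $ i \<le> (\<alpha> + ?e) $ i"
      unfolding atMost_iff less_eq_vec_def by blast
    then have "of_nat (Suc (\<alpha> $ i)) = of_nat (\<beta> $ i) + (of_nat (Suc (\<alpha> $ i) - \<beta> $ i) :: complex)"
      unfolding of_nat_add[symmetric] by (simp add: axis_def)
    then show "of_nat (Suc (\<alpha> $ i)) * (T \<beta> * U (\<alpha> + ?e - \<beta>)) =
        of_nat (\<beta> $ i) * T \<beta> * U (\<alpha> + ?e - \<beta>) + of_nat (Suc (\<alpha> $ i) - \<beta> $ i) * T \<beta> * U (\<alpha> + ?e - \<beta>)"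
      by (simp only: distrib_right mult.assoc)
  qed simp
  \<comment> \<open>Terms with \<beta>_i = 0 vanish; the others are reindexed by removing
    e_i.\<close>
  also have "(\<Sum>\<beta>\<in>{..\<alpha> + ?e}. of_nat (\<beta> $ i) * T \<beta> * U (\<alpha> + ?e - \<beta>)) =
      (\<Sum>\<beta>\<in>{..\<alpha>}. of_nat (Suc (\<beta> $ i)) * T (\<beta> + ?e) * U (\<alpha> - \<beta>))"
  proof -
    have "(\<Sum>\<beta>\<in>{..\<alpha> + ?e}. of_nat (\<beta> $ i) * T \<beta> * U (\<alpha> + ?e - \<beta>)) =
        (\<Sum>\<beta>\<in>{\<beta> \<in> {..\<alpha> + ?e}. \<beta> $ i > 0}. of_nat (\<beta> $ i) * T \<beta> * U (\<alpha> + ?e - \<beta>))"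
      by (rule sum.mono_neutral_right[OF fin]) auto
    also have "\<dots> = (\<Sum>\<beta>\<in>{..\<alpha>}. of_nat (Suc (\<beta> $ i)) * T (\<beta> + ?e) * U (\<alpha> - \<beta>))"
    proof (rule sum.reindex_bij_witness[where i = "\<lambda>\<beta>. \<beta> + ?e" and j = "\<lambda>\<beta>. \<beta> - ?e"])
      fix \<beta> :: "'n multi_index"
      assume *: "\<beta> \<in> {\<beta> \<in> {..\<alpha> + ?e}. \<beta> $ i > 0}"
      then show eq: "\<beta> - ?e + ?e = \<beta>"
        by (intro mi_diff_add) (simp add: axis_le_iff)
      have "\<beta> $ k \<le> (\<alpha> + ?e) $ k" for k
        using * by (simp add: less_eq_vec_def)
      then have "(\<beta> - ?e) $ k \<le> \<alpha> $ k" for k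
        by (simp add: le_diff_conv)
      then show "\<beta> - ?e \<in> {..\<alpha>}"
        by (simp add: less_eq_vec_def)
      have "\<alpha> - (\<beta> - ?e) = \<alpha> + ?e - \<beta>"
        using * by (auto simp: vec_eq_iff axis_def)
      moreover have "Suc ((\<beta> - ?e) $ i) = \<beta> $ i"
        using * by (auto simp: axis_def)
      ultimately show "of_nat (Suc ((\<beta> - ?e) $ i)) * T (\<beta> - ?e + ?e) * U (\<alpha> - (\<beta> - ?e)) =
          of_nat (\<beta> $ i) * T \<beta> * U (\<alpha> + ?e - \<beta>)"
        unfolding eq by (simp del: of_nat_Suc)
    qed (auto simp: less_eq_vec_def axis_def vec_eq_iff)
    finally show ?thesis .
  qed
  \<comment> \<open>An index below \<alpha> + e_i but not below \<alpha> has \<beta>_i = \<alpha>_i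
    + 1, where the integer factor is 0.\<close>
  also have "(\<Sum>\<beta>\<in>{..\<alpha> + ?e}. of_nat (Suc (\<alpha> $ i) - \<beta> $ i) * T \<beta> * U (\<alpha> + ?e - \<beta>)) =
      (\<Sum>\<beta>\<in>{..\<alpha>}. of_nat (Suc (\<alpha> $ i) - \<beta> $ i) * T \<beta> * U (\<alpha> + ?e - \<beta>))"
  proof (rule sum.mono_neutral_right[OF fin])
    show "{..\<alpha>} \<subseteq> {..\<alpha> + ?e}"
      by (auto simp: less_eq_vec_def intro: le_trans[OF _ le_add1])
    show "\<forall>\<beta>\<in>{..\<alpha> + ?e} - {..\<alpha>}. of_nat (Suc (\<alpha> $ i) - \<beta> $ i) * T \<beta> * U (\<alpha> + ?e - \<beta>) = 0"
    proof
      fix \<beta>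
      assume *: "\<beta> \<in> {..\<alpha> + ?e} - {..\<alpha>}"
      then obtain k where k: "\<not> \<beta> $ k \<le> \<alpha> $ k" and le: "\<And>k. \<beta> $ k \<le> (\<alpha> + ?e) $ k"
        by (auto simp: less_eq_vec_def)
      have "k = i"
        using k le[of k] by (cases "k = i") (auto simp: axis_def)
      then show "of_nat (Suc (\<alpha> $ i) - \<beta> $ i) * T \<beta> * U (\<alpha> + ?e - \<beta>) = 0"
        using k by simp
    qed
  qed
  also have "\<dots> = (\<Sum>\<beta>\<in>{..\<alpha>}. T \<beta> * (of_nat (Suc ((\<alpha> - \<beta>) $ i)) * U (\<alpha> - \<beta> + axis i 1)))"
  proof (rule sum.cong)
    fix \<beta> :: "'n multi_index"
    assume "\<beta> \<in> {..\<alpha>}"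
    then have le: "\<beta> $ k \<le> \<alpha> $ k" for k
      by (simp add: less_eq_vec_def)
    have "\<alpha> + ?e - \<beta> = \<alpha> - \<beta> + ?e"
      using le by (simp add: vec_eq_iff)
    then show "of_nat (Suc (\<alpha> $ i) - \<beta> $ i) * T \<beta> * U (\<alpha> + ?e - \<beta>) =
        T \<beta> * (of_nat (Suc ((\<alpha> - \<beta>) $ i)) * U (\<alpha> - \<beta> + ?e))"
      using le[of i] by (simp add: Suc_diff_le del: of_nat_Suc)
  qed simp
  finally show ?thesis .
qed

text \<open>Both sides obey the same recursion from \<alpha> to \<alpha> + e_i, by the product rule
  on the left and \<open>convolution_add_axis\<close> on the right; the factor \<alpha>_i + 1 is
  then cancelled.\<close>

lemma taylor_coeff_mult:
  assumes "smooth f" "smooth g"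
  shows "taylor_coeff \<alpha> (\<lambda>x. f x * g x) x = (\<Sum>\<beta>\<in>{..\<alpha>}. taylor_coeff \<beta> f x * taylor_coeff (\<alpha> - \<beta>) g x)"
  using assms
proof (induction \<alpha> arbitrary: f g rule: multi_index_induct)
  case zero
  have "{..0 :: 'a multi_index} = {0}"
    by (auto simp: less_eq_vec_def vec_eq_iff)
  then show ?case
    by (simp add: taylor_coeff_def)
next
  case (step \<alpha> i)
  note sm = step.prems step.prems[THEN smooth_partial_derivative]
  have pd: "partial_derivative i (\<lambda>x. f x * g x) = (\<lambda>x. partial_derivative i f x * g x + f x *
      partial_derivative i g x)"
    by (rule ext) (intro bounded_bilinear.partial_derivative_bilinear[OF bounded_bilinear_mult]
        smooth_differentiable step)
  have "of_nat (Suc (\<alpha> $ i)) * taylor_coeff (\<alpha> + axis i 1) (\<lambda>x. f x * g x) x =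
      taylor_coeff \<alpha> (\<lambda>x. partial_derivative i f x * g x + f x * partial_derivative i g x) x"
    by (simp only: taylor_coeff_partial_derivative[OF smooth_mult[OF step.prems], symmetric] pd)
  also have "\<dots> = taylor_coeff \<alpha> (\<lambda>x. partial_derivative i f x * g x) x + taylor_coeff \<alpha> (\<lambda>x. f x *
      partial_derivative i g x) x"
    by (intro taylor_coeff_add smooth_mult sm)
  also have "\<dots> = (\<Sum>\<beta>\<in>{..\<alpha>}. taylor_coeff \<beta> (partial_derivative i f) x * taylor_coeff (\<alpha> - \<beta>) g x) +
      (\<Sum>\<beta>\<in>{..\<alpha>}. taylor_coeff \<beta> f x * taylor_coeff (\<alpha> - \<beta>) (partial_derivative i g) x)"
    by (intro arg_cong2[of _ _ _ _ "(+)"] step.IH sm)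
  also have "\<dots> = of_nat (Suc (\<alpha> $ i)) *
      (\<Sum>\<beta>\<in>{..\<alpha> + axis i 1}. taylor_coeff \<beta> f x * taylor_coeff (\<alpha> + axis i 1 - \<beta>) g x)"
    unfolding taylor_coeff_partial_derivative[OF step.prems(1)] taylor_coeff_partial_derivative[OF
        step.prems(2)]
    by (rule convolution_add_axis[of \<alpha> i "\<lambda>\<beta>. taylor_coeff \<beta> f x" "\<lambda>\<beta>. taylor_coeff \<beta> g x", symmetric])
  finally show ?case
    by (simp del: of_nat_Suc)
qed

section \<open>Jets and composition\<close>

text \<open>The factor 1/\<mu>! normalises the \<mu>-th derivative at y to 1; all other derivatives
  vanish there.\<close>

definition taylor_monomial :: "'n space \<Rightarrow> ('n::finite) multi_index \<Rightarrow> 'n space \<Rightarrow> complex"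
  where "taylor_monomial y \<mu> t = (\<Prod>i\<in>UNIV. of_real (t $ i - y $ i) ^ (\<mu> $ i)) / of_nat (mi_fact \<mu>)"

lemma prod_power_add_axis:
  fixes u :: "'n::finite \<Rightarrow> 'a::comm_monoid_mult"
  shows "(\<Prod>i\<in>UNIV. u i ^ ((\<mu> + axis j 1) $ i)) = u j * (\<Prod>i\<in>UNIV. u i ^ (\<mu> $ i))"
proof -
  have "(\<Prod>i\<in>UNIV. u i ^ ((\<mu> + axis j 1) $ i)) = (\<Prod>i\<in>UNIV. u i ^ (\<mu> $ i) * (if i = j then u j else 1))"
    by (rule prod.cong) (auto simp: axis_def mult.commute simp flip: Suc_eq_plus1)
  then show ?thesis
    by (simp add: prod.distrib mult.commute)
qed

text \<open>This recursion for u^\<mu>/\<mu>! carries the later inductions on the exponent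
  \<mu>.\<close>

lemma monomial_add_axis:
  fixes u :: "'n::finite \<Rightarrow> complex"
  shows "of_nat (Suc (\<mu> $ j)) * ((\<Prod>i\<in>UNIV. u i ^ ((\<mu> + axis j 1) $ i)) / of_nat (mi_fact (\<mu> + axis
      j 1))) =
    u j * ((\<Prod>i\<in>UNIV. u i ^ (\<mu> $ i)) / of_nat (mi_fact \<mu>))"
  unfolding prod_power_add_axis mi_fact_add_axis
  by (simp del: of_nat_Suc mult_Suc)

lemma smooth_taylor_monomial_compose:
  "smooth \<phi> \<Longrightarrow> smooth (\<lambda>t. taylor_monomial y \<mu> (\<phi> t))"
  unfolding taylor_monomial_def divide_inverse
  by (intro smooth_mult smooth_prod smooth_power smooth_of_real smooth_diff smooth_vec_nth) simp_all

lemma smooth_taylor_monomial: "smooth (taylor_monomial y \<mu>)"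
  using smooth_taylor_monomial_compose[OF smooth_ident] .

lemma smooth_of_real_component: "smooth \<phi> \<Longrightarrow> smooth (\<lambda>t. of_real (\<phi> t $ i - c) :: complex)"
  by (intro smooth_of_real smooth_diff smooth_vec_nth) simp_all

lemma mi_derivative_component:
  "mi_derivative \<beta> (\<lambda>t :: ('n::{finite,linorder}) space. of_real (t $ i - y $ i) :: complex) y =
    (if \<beta> = axis i 1 then 1 else 0)"
proof (induction \<beta> rule: multi_index_induct)
  case zero
  have "(0::'n multi_index) \<noteq> axis i 1"
    by (auto simp: vec_eq_iff axis_def)
  then show ?case by simp
next
  case (step \<beta> j)
  have "((\<lambda>t :: 'n space. of_real (t $ i - y $ i) :: complex) has_derivative (\<lambda>h. of_real (h $
      i))) (at x)" for x
    by (intro bounded_linear.has_derivative[OF bounded_linear_of_real])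
      (auto intro!: derivative_eq_intros bounded_linear.has_derivative[OF bounded_linear_vec_nth])
  from partial_derivative_eq[OF this]
  have "partial_derivative j (\<lambda>t :: 'n space. of_real (t $ i - y $ i) :: complex) = (\<lambda>x. if i
      = j then 1 else 0)"
    by (simp add: fun_eq_iff axis_def)
  then have "mi_derivative (\<beta> + axis j 1) (\<lambda>t :: 'n space. of_real (t $ i - y $ i) :: complex) y =
      mi_derivative \<beta> (\<lambda>x. if i = j then 1 else 0) y"
    by (subst mi_derivative_add_axis) (simp_all only: smooth_of_real_component[OF smooth_ident])
  also have "\<dots> = (if \<beta> = 0 \<and> i = j then 1 else 0)"
    by (simp add: mi_derivative_const mi_derivative_zero)
  also have "\<beta> = 0 \<and> i = j \<longleftrightarrow> \<beta> + axis j 1 = axis i 1"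
  proof
    assume *: "\<beta> + axis j 1 = axis i 1"
    then have "\<beta> = 0"
      using mi_size_add[of \<beta> "axis j 1"] mi_size_eq_0_iff[of \<beta>] by simp
    then show "\<beta> = 0 \<and> i = j"
      using * by (simp add: axis_eq_axis)
  qed simp
  finally show ?case .
qed

lemma taylor_coeff_taylor_monomial:
  "taylor_coeff \<nu> (taylor_monomial y \<mu>) y = (if \<nu> = \<mu> then 1 / of_nat (mi_fact \<mu>) else 0)"
  for \<nu> :: "('n::{finite,linorder}) multi_index"
proof (induction \<mu> arbitrary: \<nu> rule: multi_index_induct)
  case zero
  have "taylor_monomial y 0 = (\<lambda>t. 1)"
    by (simp add: taylor_monomial_def fun_eq_iff)
  then show ?case
    by (simp add: taylor_coeff_def mi_derivative_const)
next
  case (step \<mu> i)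
  have fin: "finite {..\<nu>}"
    unfolding atMost_def by (rule finite_mi_atMost)
  have "of_nat (Suc (\<mu> $ i)) * taylor_coeff \<nu> (taylor_monomial y (\<mu> + axis i 1)) y =
      taylor_coeff \<nu> (\<lambda>t. of_real (t $ i - y $ i) * taylor_monomial y \<mu> t) y"
    unfolding taylor_coeff_cmult[OF smooth_taylor_monomial,
        symmetric] taylor_monomial_def monomial_add_axis ..
  also have "\<dots> = (\<Sum>\<beta>\<in>{..\<nu>}. taylor_coeff \<beta> (\<lambda>t. of_real (t $ i - y $ i)) y * taylor_coeff (\<nu> - \<beta>)
      (taylor_monomial y \<mu>) y)"
    by (intro taylor_coeff_mult smooth_of_real_component smooth_ident smooth_taylor_monomial)
  \<comment> \<open>The linear factor vanishes at y, so its only non-zero Taylor coefficient there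
    has degree e_i.\<close>
  also have "\<dots> = (\<Sum>\<beta>\<in>{..\<nu>}. if \<beta> = axis i 1 then taylor_coeff (\<nu> - axis i 1) (taylor_monomial y \<mu>)
      y else 0)"
    using mi_fact_add_axis[of 0 i]
    by (intro sum.cong) (auto simp: taylor_coeff_def mi_derivative_component simp del: of_real_diff)
  also have "\<dots> = (if axis i 1 \<le> \<nu> then taylor_coeff (\<nu> - axis i 1) (taylor_monomial y \<mu>) y else 0)"
    using fin by (simp add: sum.delta)
  also have "\<dots> = (if \<nu> = \<mu> + axis i 1 then 1 / of_nat (mi_fact \<mu>) else 0)"
  proof -
    have "axis i 1 \<le> \<nu> \<and> \<nu> - axis i 1 = \<mu> \<longleftrightarrow> \<nu> = \<mu> + axis i 1"
      using mi_diff_add[of "axis i 1" \<nu>] by (auto simp: less_eq_vec_def)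
    then show ?thesis
      unfolding step.IH by auto
  qed
  finally have eq: "of_nat (Suc (\<mu> $ i)) * taylor_coeff \<nu> (taylor_monomial y (\<mu> + axis i 1)) y =
      (if \<nu> = \<mu> + axis i 1 then 1 / of_nat (mi_fact \<mu>) else 0)" .
  have "taylor_coeff \<nu> (taylor_monomial y (\<mu> + axis i 1)) y =
      (if \<nu> = \<mu> + axis i 1 then 1 / of_nat (mi_fact \<mu>) else 0) / of_nat (Suc (\<mu> $ i))"
    by (rule eq_divide_imp[OF of_nat_neq_0 trans[OF mult.commute eq]])
  then show ?case
    by (simp add: mi_fact_add_axis del: of_nat_Suc mult_Suc)
qed

lemma mi_derivative_taylor_monomial:
  "mi_derivative \<nu> (taylor_monomial y \<mu>) y = (if \<nu> = \<mu> then 1 else 0)"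
  using taylor_coeff_taylor_monomial[of \<nu> y \<mu>]
  by (auto simp: taylor_coeff_def split: if_splits)

text \<open>A derivative either hits the weight or, by the chain rule, replaces f by one of its
  partial derivatives and multiplies the weight by a derivative of \<phi>. So order |\<beta>| meets
  only derivatives of f up to that order. The weight is arbitrary because it changes in the
  induction.\<close>

lemma mi_derivative_weighted_eq_0:
  fixes a f :: "_ \<Rightarrow> complex" and \<phi> :: "('n::{finite,linorder}) space \<Rightarrow> 'n space"
  assumes "smooth a" "smooth f" "smooth \<phi>"
    and "\<And>\<mu>. mi_size \<mu> \<le> m \<Longrightarrow> mi_derivative \<mu> f (\<phi> x) = 0" "mi_size \<beta> \<le> m"
  shows "mi_derivative \<beta> (\<lambda>t. a t * f (\<phi> t)) x = 0"
  using assms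
proof (induction \<beta> arbitrary: a f m rule: multi_index_induct)
  case zero
  then show ?case
    using zero(4)[of 0] by simp
next
  case (step \<beta> i)
  note sm = smooth_mult smooth_scaleR smooth_partial_derivative smooth_vec_nth step.prems(1-3)
    smooth_compose[OF step.prems(2,3)] smooth_compose[OF smooth_partial_derivative[OF
        step.prems(2)] step.prems(3)]
  let ?b = "\<lambda>j t. partial_derivative i (\<lambda>t. \<phi> t $ j) t *\<^sub>R a t"
  have size: "mi_size \<beta> \<le> m - 1" "m \<ge> 1"
    using step.prems(5) by (auto simp: mi_size_add)
  have "partial_derivative i (\<lambda>t. a t * f (\<phi> t)) t =
      partial_derivative i a t * f (\<phi> t) + (\<Sum>j\<in>UNIV. ?b j t * partial_derivative j f (\<phi> t))" for t
  proof -
    have "partial_derivative i (\<lambda>t. a t * f (\<phi> t)) t =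
        partial_derivative i a t * f (\<phi> t) + a t * partial_derivative i (\<lambda>t. f (\<phi> t)) t"
      by (intro bounded_bilinear.partial_derivative_bilinear[OF bounded_bilinear_mult]
          smooth_differentiable sm)
    also have "partial_derivative i (\<lambda>t. f (\<phi> t)) t =
        (\<Sum>j\<in>UNIV. partial_derivative i (\<lambda>x. \<phi> x $ j) t *\<^sub>R partial_derivative j f (\<phi> t))"
      by (intro partial_derivative_compose smooth_differentiable sm)
    finally show ?thesis
      by (simp add: sum_distrib_left)
  qed
  then have "partial_derivative i (\<lambda>t. a t * f (\<phi> t)) =
      (\<lambda>t. partial_derivative i a t * f (\<phi> t) + (\<Sum>j\<in>UNIV. ?b j t * partial_derivative j f (\<phi> t)))" ..
  then have "mi_derivative (\<beta> + axis i 1) (\<lambda>t. a t * f (\<phi> t)) x =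
      mi_derivative \<beta> (\<lambda>t. partial_derivative i a t * f (\<phi> t) + (\<Sum>j\<in>UNIV. ?b j t *
          partial_derivative j f (\<phi> t))) x"
    by (subst mi_derivative_add_axis) (auto intro: sm)
  also have "\<dots> = mi_derivative \<beta> (\<lambda>t. partial_derivative i a t * f (\<phi> t)) x +
      (\<Sum>j\<in>UNIV. mi_derivative \<beta> (\<lambda>t. ?b j t * partial_derivative j f (\<phi> t)) x)"
    by (subst mi_derivative_add mi_derivative_sum, (intro sm smooth_sum)+)+ (rule refl)
  also have "mi_derivative \<beta> (\<lambda>t. partial_derivative i a t * f (\<phi> t)) x = 0"
    using size by (intro step.IH[where m = "m - 1"] sm step.prems(4)) auto
  also have "(\<Sum>j\<in>UNIV. mi_derivative \<beta> (\<lambda>t. ?b j t * partial_derivative j f (\<phi> t)) x) = 0"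
  proof (intro sum.neutral ballI step.IH[where m = "m - 1"] sm)
    fix j and \<mu> :: "'n multi_index"
    assume "mi_size \<mu> \<le> m - 1"
    then show "mi_derivative \<mu> (partial_derivative j f) (\<phi> x) = 0"
      using step.prems(4)[of "\<mu> + axis j 1"] size
      by (simp add: mi_derivative_add_axis step.prems mi_size_add)
  qed (use size in simp)
  finally show ?case by simp
qed

text \<open>
  Subtracting from \<open>f\<close> its Taylor polynomial at \<open>\<phi> x\<close> leaves a function with vanishing jet, so the
  coefficients of the chain rule are the derivatives obtained for the Taylor monomials.
\<close>
lemma mi_derivative_weighted:
  fixes \<psi> f :: "_ \<Rightarrow> complex" and \<phi> :: "('n::{finite,linorder}) space \<Rightarrow> 'n space"
  assumes "smooth \<psi>" "smooth f" "smooth \<phi>"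
  shows "mi_derivative \<alpha> (\<lambda>t. \<psi> t * f (\<phi> t)) x =
    (\<Sum>\<mu> | mi_size \<mu> \<le> mi_size \<alpha>. mi_derivative \<mu> f (\<phi> x) *
      mi_derivative \<alpha> (\<lambda>t. \<psi> t * taylor_monomial (\<phi> x) \<mu> (\<phi> t)) x)"
proof -
  let ?M = "{\<mu> :: 'n multi_index. mi_size \<mu> \<le> mi_size \<alpha>}"
  let ?c = "\<lambda>\<mu>. mi_derivative \<mu> f (\<phi> x)"
  let ?t = "taylor_monomial (\<phi> x)"
  let ?P = "\<lambda>t. \<Sum>\<mu>\<in>?M. ?c \<mu> * ?t \<mu> t"
  note sm = smooth_mult smooth_sum smooth_diff smooth_compose[OF assms(2,3)] smooth_const
      smooth_taylor_monomial
    smooth_taylor_monomial_compose assms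
  have jet: "mi_derivative \<nu> (\<lambda>t. f t - ?P t) (\<phi> x) = 0" if "mi_size \<nu> \<le> mi_size \<alpha>" for \<nu>
  proof -
    have "mi_derivative \<nu> (\<lambda>t. f t - ?P t) (\<phi> x) = ?c \<nu> - (\<Sum>\<mu>\<in>?M. ?c \<mu> * (if \<nu> = \<mu> then 1 else 0))"
      by (simp add: mi_derivative_diff mi_derivative_sum mi_derivative_cmult
          mi_derivative_taylor_monomial sm)
    also have "\<dots> = 0"
      using that by (simp add: if_distrib sum.delta'[OF finite_mi_size_le] cong: if_cong)
    finally show ?thesis .
  qed
  have "mi_derivative \<alpha> (\<lambda>t. \<psi> t * (f (\<phi> t) - ?P (\<phi> t))) x = 0"
    by (rule mi_derivative_weighted_eq_0[where f = "\<lambda>t. f t - ?P t" and m = "mi_size \<alpha>"])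
      (intro sm jet order.refl; assumption)+
  moreover have "(\<lambda>t. \<psi> t * (f (\<phi> t) - ?P (\<phi> t))) =
      (\<lambda>t. \<psi> t * f (\<phi> t) - (\<Sum>\<mu>\<in>?M. ?c \<mu> * (\<psi> t * ?t \<mu> (\<phi> t))))"
    by (simp add: fun_eq_iff right_diff_distrib sum_distrib_left mult.left_commute)
  moreover have "mi_derivative \<alpha> (\<lambda>t. \<psi> t * f (\<phi> t) - (\<Sum>\<mu>\<in>?M. ?c \<mu> * (\<psi> t * ?t \<mu> (\<phi> t)))) x =
      mi_derivative \<alpha> (\<lambda>t. \<psi> t * f (\<phi> t)) x -
      (\<Sum>\<mu>\<in>?M. ?c \<mu> * mi_derivative \<alpha> (\<lambda>t. \<psi> t * ?t \<mu> (\<phi> t)) x)"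
    by (simp add: mi_derivative_diff mi_derivative_sum mi_derivative_cmult sm)
  ultimately show ?thesis
    by simp
qed

section \<open>The combinatorics of the Faa di Bruno formula\<close>

text \<open>
  An element of \<open>fdb_indices \<beta> \<mu>\<close> is a sorted listing of the finitely supported function \<open>l\<^sub>j \<mapsto> k\<^sub>j\<close>.
  Such functions make the index sets symmetric, and raising one value by a unit vector relates them
  for \<open>\<mu>\<close> and \<open>\<mu> + e\<^sub>i\<close>.
\<close>
definition partition_functions ::
    "('n::finite) multi_index set \<Rightarrow> 'n multi_index \<Rightarrow> 'n multi_index \<Rightarrow> ('n multi_index \<Rightarrow> 'n
        multi_index) set"
  where "partition_functions S \<beta> \<mu> = {g. (\<forall>v. v \<notin> S \<longrightarrow> g v = 0) \<and>
    (\<Sum>v\<in>S. g v) = \<mu> \<and> (\<Sum>v\<in>S. mi_size (g v) *s v) = \<beta>}"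

text \<open>Let u_i be the power series with coefficients a v i for v \<in> S. The multinomial
  expansion of u^\<mu>/\<mu>! makes its coefficient of degree \<beta> the sum of these weights over
  \<open>partition_functions S \<beta> \<mu>\<close>; g v records, for each coordinate i, how often
  the term of degree v is chosen.\<close>

definition partition_weight ::
    "('n::finite) multi_index set \<Rightarrow> ('n multi_index \<Rightarrow> 'n \<Rightarrow> complex) \<Rightarrow> ('n multi_index \<Rightarrow> 'n
        multi_index) \<Rightarrow> complex"
  where "partition_weight S a g = (\<Prod>v\<in>S. (\<Prod>i\<in>UNIV. a v i ^ (g v $ i)) / of_nat (mi_fact (g v)))"

lemma finite_partition_functions:
  assumes "finite S"
  shows "finite (partition_functions S \<beta> \<mu>)"
proof (rule finite_subset)
  show "partition_functions S \<beta> \<mu> \<subseteq>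
      {g. \<forall>v. (v \<in> S \<longrightarrow> g v \<in> {\<kappa>. \<kappa> \<le> \<mu>}) \<and> (v \<notin> S \<longrightarrow> g v = 0)}"
    using assms
    by (auto simp: partition_functions_def less_eq_vec_def intro!: member_le_sum)
  show "finite {g. \<forall>v. (v \<in> S \<longrightarrow> g v \<in> {\<kappa>. \<kappa> \<le> \<mu>}) \<and> (v \<notin> S \<longrightarrow> g v = 0)}"
    by (intro finite_set_of_finite_funs assms finite_mi_atMost)
qed

lemma partition_functions_upd:
  assumes S: "finite S" "v \<in> S"
  shows "g(v := g v + axis i 1) \<in> partition_functions S (\<beta> + v) (\<mu> + axis i 1)
      \<longleftrightarrow> g \<in> partition_functions S \<beta> \<mu>"
proof -
  let ?g = "g(v := g v + axis i 1)"
  have g: "?g u = g u + (if u = v then axis i 1 else 0)" for u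
    by simp
  have "(\<Sum>u\<in>S. ?g u) = (\<Sum>u\<in>S. g u) + axis i 1"
    unfolding g sum.distrib using S by simp
  moreover have "(\<Sum>u\<in>S. mi_size (?g u) *s u) = (\<Sum>u\<in>S. mi_size (g u) *s u) + v"
  proof -
    have "mi_size (?g u) *s u = mi_size (g u) *s u + (if u = v then v else 0)" for u
    proof -
      have "(c + 1) *s v = c *s v + v" for c
        by (simp add: vec_eq_iff distrib_right)
      then show ?thesis
        by (simp add: mi_size_add)
    qed
    then show ?thesis
      using S by (simp add: sum.distrib)
  qed
  moreover have "(\<forall>u. u \<notin> S \<longrightarrow> ?g u = 0) \<longleftrightarrow> (\<forall>u. u \<notin> S \<longrightarrow> g u = 0)"
    using S by auto
  ultimately show ?thesis
    unfolding partition_functions_def mem_Collect_eq by (simp only: add_right_cancel)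
qed

lemma partition_weight_upd:
  assumes S: "finite S" "v \<in> S"
  shows "of_nat (Suc (g v $ i)) * partition_weight S a (g(v := g v + axis i 1))
      = a v i * partition_weight S a g"
proof -
  let ?h = "\<lambda>g v. (\<Prod>i\<in>UNIV. a v i ^ (g v $ i)) / of_nat (mi_fact (g v))"
  let ?g = "g(v := g v + axis i 1)"
  have "partition_weight S a ?g = ?h ?g v * (\<Prod>u\<in>S - {v}. ?h ?g u)"
    unfolding partition_weight_def by (rule prod.remove[OF S])
  also have "(\<Prod>u\<in>S - {v}. ?h ?g u) = (\<Prod>u\<in>S - {v}. ?h g u)"
    by (rule prod.cong) auto
  finally have "of_nat (Suc (g v $ i)) * partition_weight S a ?g = a v i * ?h g v * (\<Prod>u\<in>S - {v}. ?h g u)"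
    using monomial_add_axis[of "g v" i "a v"] by (simp only: fun_upd_same mult.assoc[symmetric])
  also have "\<dots> = a v i * partition_weight S a g"
    unfolding partition_weight_def using prod.remove[OF S, of "?h g"] by (simp only: mult.assoc)
  finally show ?thesis .
qed

lemma partition_functions_le:
  assumes g: "g \<in> partition_functions S \<beta> \<mu>" and S: "finite S" "v \<in> S" and "g v \<noteq> 0"
  shows "v \<le> \<beta>"
  unfolding less_eq_vec_def
proof
  fix i
  have "mi_size (g v) > 0"
    using \<open>g v \<noteq> 0\<close> mi_size_eq_0_iff[of "g v"] by auto
  then have "v $ i \<le> mi_size (g v) * v $ i"
    by simp
  also have "\<dots> \<le> (\<Sum>u\<in>S. mi_size (g u) * u $ i)"
    using S by (intro member_le_sum[of v S "\<lambda>u. mi_size (g u) * u $ i"]) auto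
  also have "\<dots> = \<beta> $ i"
    using g by (auto simp: partition_functions_def)
  finally show "v $ i \<le> \<beta> $ i" .
qed

text \<open>Double counting of pairs (v, g) with multiplicity g(v)_i. For fixed g the multiplicities
  add up to \<mu>_i + 1; for fixed v, taking e_i away from g v leads bijectively to the functions
  for \<beta> - v and \<mu>, and \<open>partition_weight_upd\<close> compares the weights.\<close>

lemma partition_sum_rec:
  assumes S: "finite S"
  shows "of_nat (Suc (\<mu> $ i)) * (\<Sum>g\<in>partition_functions S \<beta> (\<mu> + axis i 1). partition_weight S a g) =
    (\<Sum>v\<in>{v \<in> S. v \<le> \<beta>}. a v i * (\<Sum>g\<in>partition_functions S (\<beta> - v) \<mu>. partition_weight S a g))"
proof -
  let ?K = "partition_functions S" and ?w = "partition_weight S a"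
  let ?up = "\<lambda>(v, g). (v, g(v := g v + axis i 1))" and ?down = "\<lambda>(v, g). (v, g(v := g v - axis i 1))"
  let ?A = "SIGMA v:{v \<in> S. v \<le> \<beta>}. ?K (\<beta> - v) \<mu>"
  let ?B = "SIGMA v:S. ?K \<beta> (\<mu> + axis i 1)"
  have up_down: "?up (?down (v, g)) = (v, g)" if "g v $ i > 0" for v
      and g :: "'a multi_index \<Rightarrow> 'a multi_index"
    using mi_diff_add[of "axis i 1" "g v"] that by (simp add: axis_le_iff)
  have fin: "finite ?B"
    using S by (intro finite_SigmaI finite_partition_functions)
  have "of_nat (Suc (\<mu> $ i)) * (\<Sum>g\<in>?K \<beta> (\<mu> + axis i 1). ?w g) =
      (\<Sum>g\<in>?K \<beta> (\<mu> + axis i 1). \<Sum>v\<in>S. of_nat (g v $ i) * ?w g)"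
    unfolding sum_distrib_left
  proof (rule sum.cong)
    fix g assume "g \<in> ?K \<beta> (\<mu> + axis i 1)"
    then have "(\<Sum>v\<in>S. g v) $ i = Suc (\<mu> $ i)"
      by (simp add: partition_functions_def axis_def)
    then have "Suc (\<mu> $ i) = (\<Sum>v\<in>S. g v $ i)"
      by simp
    then show "of_nat (Suc (\<mu> $ i)) * ?w g = (\<Sum>v\<in>S. of_nat (g v $ i) * ?w g)"
      by (simp only: of_nat_sum sum_distrib_right)
  qed simp
  also have "\<dots> = (\<Sum>(v, g)\<in>?B. of_nat (g v $ i) * ?w g)"
    using S by (subst sum.swap) (simp add: sum.Sigma finite_partition_functions)
  \<comment> \<open>Only pairs of positive multiplicity allow e_i to be taken away; on the others
    the subtraction is truncated and not reversible.\<close>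
  also have "\<dots> = (\<Sum>(v, g)\<in>{(v, g) \<in> ?B. g v $ i > 0}. of_nat (g v $ i) * ?w g)"
    by (rule sum.mono_neutral_right[OF fin]) auto
  also have "\<dots> = (\<Sum>(v, g)\<in>?A. a v i * ?w g)"
  proof (rule sum.reindex_bij_witness[where i = ?up and j = ?down])
    fix p assume "p \<in> {(v, g) \<in> ?B. g v $ i > 0}"
    then obtain v g where p: "p = (v, g)" "v \<in> S" "g \<in> ?K \<beta> (\<mu> + axis i 1)" "g v $ i > 0"
      by auto
    show "?up (?down p) = p"
      using up_down p by simp
    define h where "h = g(v := g v - axis i 1)"
    have g: "g = h(v := h v + axis i 1)"
      using up_down p by (simp add: h_def)
    \<comment> \<open>A non-zero value at v forces v \<le> \<beta>, so \<beta> - v is a genuine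
      difference.\<close>
    have "g v \<noteq> 0"
      using p(4) by auto
    with partition_functions_le[OF p(3) S p(2)] have le: "v \<le> \<beta>"
      by simp
    then have "h \<in> ?K (\<beta> - v) \<mu>"
      using p(3) partition_functions_upd[OF S p(2), of h i "\<beta> - v" \<mu>]
          by (simp only: mi_diff_add g[symmetric])
    then show "?down p \<in> ?A"
      using p le by (simp add: h_def)
    have "g v $ i = Suc (h v $ i)"
      by (subst g) (simp add: axis_def)
    then show "(case ?down p of (v, g) \<Rightarrow> a v i * ?w g) = (case p of (v, g) \<Rightarrow> of_nat (g v $ i) * ?w g)"
      using partition_weight_upd[OF S p(2), of h i a] p(1)
          by (simp only: split h_def[symmetric] g[symmetric])
  next
    fix p assume "p \<in> ?A"
    then obtain v g where p: "p = (v, g)" "v \<in> S" "v \<le> \<beta>" "g \<in> ?K (\<beta> - v) \<mu>"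
      by auto
    then have "g(v := g v + axis i 1) \<in> ?K \<beta> (\<mu> + axis i 1)"
      using partition_functions_upd[OF S p(2), of g i "\<beta> - v" \<mu>] by (simp only: mi_diff_add)
    then show "?up p \<in> {(v, g) \<in> ?B. g v $ i > 0}"
      using p by (simp add: axis_def)
    show "?down (?up p) = p"
      using p by simp
  qed
  also have "\<dots> = (\<Sum>v\<in>{v \<in> S. v \<le> \<beta>}. a v i * (\<Sum>g\<in>?K (\<beta> - v) \<mu>. ?w g))"
    using S by (simp add: sum.Sigma[symmetric] finite_partition_functions sum_distrib_left)
  finally show ?thesis .
qed

lemma partition_sum_zero:
  assumes S: "finite S"
  shows "(\<Sum>g\<in>partition_functions S \<beta> 0. partition_weight S a g) = (if \<beta> = 0 then 1 else 0)"
proof -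
  have "g = (\<lambda>v. 0)" if "g \<in> partition_functions S \<beta> 0" for g
  proof
    fix v
    show "g v = 0"
    proof (cases "v \<in> S")
      case True
      have "g v $ i = 0" for i
        using S that True member_le_sum[of v S "\<lambda>v. g v $ i"]
        by (auto simp: partition_functions_def vec_eq_iff)
      then show ?thesis
        by (simp add: vec_eq_iff)
    qed (use that in \<open>simp add: partition_functions_def\<close>)
  qed
  moreover have "(\<lambda>v. 0) \<in> partition_functions S \<beta> 0 \<longleftrightarrow> \<beta> = 0"
    by (auto simp: partition_functions_def)
  ultimately have "partition_functions S \<beta> 0 = (if \<beta> = 0 then {\<lambda>v. 0} else {})"
    by (auto split: if_splits)
  then show ?thesis
    by (simp add: partition_weight_def)
qed

text \<open>Both sides satisfy the same recursion in \<mu>, from the Leibniz rule and from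
  \<open>partition_sum_rec\<close>. Since each u i vanishes at x, the degree v = 0 drops out. S is
  built from a bound B instead of \<beta>, so that it stays fixed when the induction hypothesis is
  used at \<beta> - v.\<close>

lemma taylor_coeff_monomial_compose:
  fixes u :: "'n \<Rightarrow> ('n::{finite,linorder}) space \<Rightarrow> complex"
  assumes u: "\<And>i. smooth (u i)" "\<And>i. u i x = 0" and "\<beta> \<le> B"
  defines "S \<equiv> {v. v \<le> B \<and> v \<noteq> 0}"
  shows "taylor_coeff \<beta> (\<lambda>t. (\<Prod>i\<in>UNIV. u i t ^ (\<mu> $ i)) / of_nat (mi_fact \<mu>)) x =
    (\<Sum>g\<in>partition_functions S \<beta> \<mu>. partition_weight S (\<lambda>v i. taylor_coeff v (u i) x) g)"
  using \<open>\<beta> \<le> B\<close>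
proof (induction \<mu> arbitrary: \<beta> rule: multi_index_induct)
  have S: "finite S"
    unfolding S_def by (rule finite_subset[OF _ finite_mi_atMost[of B]]) auto
  {
    case zero
    show ?case
      using partition_sum_zero[OF S] by (simp add: taylor_coeff_def mi_derivative_const)
  next
    case (step \<mu> i)
    let ?q = "\<lambda>\<mu> t. (\<Prod>i\<in>UNIV. u i t ^ (\<mu> $ i)) / of_nat (mi_fact \<mu>)"
    let ?a = "\<lambda>v i. taylor_coeff v (u i) x"
    let ?P = "\<lambda>\<beta> \<mu>. \<Sum>g\<in>partition_functions S \<beta> \<mu>. partition_weight S ?a g"
    have sm: "smooth (?q \<mu>)" for \<mu>
      unfolding divide_inverse by (intro smooth_mult smooth_prod smooth_power u smooth_const)
    have fin: "finite {..\<beta>}"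
      unfolding atMost_def by (rule finite_mi_atMost)
    have "of_nat (Suc (\<mu> $ i)) * taylor_coeff \<beta> (?q (\<mu> + axis i 1)) x =
        taylor_coeff \<beta> (\<lambda>t. u i t * ?q \<mu> t) x"
      unfolding taylor_coeff_cmult[OF sm, symmetric] monomial_add_axis ..
    also have "\<dots> = (\<Sum>v\<in>{..\<beta>}. ?a v i * taylor_coeff (\<beta> - v) (?q \<mu>) x)"
      by (rule taylor_coeff_mult[OF u(1) sm])
    also have "\<dots> = (\<Sum>v\<in>{v \<in> S. v \<le> \<beta>}. ?a v i * taylor_coeff (\<beta> - v) (?q \<mu>) x)"
    proof (rule sum.mono_neutral_right[OF fin])
      show "\<forall>v\<in>{..\<beta>} - {v \<in> S. v \<le> \<beta>}. ?a v i * taylor_coeff (\<beta> - v) (?q \<mu>) x = 0"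
      proof
        fix v assume "v \<in> {..\<beta>} - {v \<in> S. v \<le> \<beta>}"
        then have "v = 0"
          using step.prems by (auto simp: S_def dest: order_trans)
        then show "?a v i * taylor_coeff (\<beta> - v) (?q \<mu>) x = 0"
          by (simp add: taylor_coeff_def u)
      qed
    qed auto
    also have "\<dots> = (\<Sum>v\<in>{v \<in> S. v \<le> \<beta>}. ?a v i * ?P (\<beta> - v) \<mu>)"
    proof (intro sum.cong refl arg_cong2[of _ _ _ _ "(*)"] step.IH)
      fix v
      show "\<beta> - v \<le> B"
        using step.prems by (auto simp: less_eq_vec_def intro: order_trans[OF diff_le_self])
    qed
    also have "\<dots> = of_nat (Suc (\<mu> $ i)) * ?P \<beta> (\<mu> + axis i 1)"
      by (rule partition_sum_rec[OF S, symmetric])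
    finally show ?case
      by (simp del: of_nat_Suc)
  }
qed

section \<open>The linear order on multi-indices\<close>

lemma mi_less_irrefl: "\<not> mi_less \<alpha> \<alpha>"
  by (simp add: mi_less_def)

lemma mi_less_trans:
  assumes "mi_less \<alpha> \<beta>" "mi_less \<beta> \<gamma>"
  shows "mi_less \<alpha> \<gamma>"
proof (cases "mi_size \<alpha> = mi_size \<beta> \<and> mi_size \<beta> = mi_size \<gamma>")
  case True
  then obtain i j where ij: "\<forall>k<i. \<alpha> $ k = \<beta> $ k" "\<alpha> $ i < \<beta> $ i" "\<forall>k<j. \<beta> $ k = \<gamma> $ k" "\<beta> $ j < \<gamma> $ j"
    using assms by (auto simp: mi_less_def)
  \<comment> \<open>\<alpha> and \<gamma> agree before the earlier of the two places and differ
    there.\<close>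
  have "\<alpha> $ min i j < \<gamma> $ min i j"
    using ij by (cases i j rule: linorder_cases) (auto simp: min_def)
  then show ?thesis
    using True ij unfolding mi_less_def by (intro disjI2 conjI exI[of _ "min i j"]) auto
qed (use assms in \<open>auto simp: mi_less_def\<close>)

lemma mi_less_total:
  assumes "\<alpha> \<noteq> \<beta>"
  shows "mi_less \<alpha> \<beta> \<or> mi_less \<beta> \<alpha>"
proof -
  define I where "I = {i. \<alpha> $ i \<noteq> \<beta> $ i}"
  have I: "finite I" "I \<noteq> {}"
    using assms by (auto simp: I_def vec_eq_iff)
  have "\<forall>j<Min I. \<alpha> $ j = \<beta> $ j"
  proof (intro allI impI)
    fix j assume "j < Min I"
    then have "j \<notin> I"
      using I(1) by (meson Min_le leD)
    then show "\<alpha> $ j = \<beta> $ j"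
      by (simp add: I_def)
  qed
  moreover have "\<alpha> $ Min I \<noteq> \<beta> $ Min I"
    using Min_in[OF I] by (simp add: I_def)
  ultimately have "(\<exists>i. (\<forall>j<i. \<alpha> $ j = \<beta> $ j) \<and> \<alpha> $ i < \<beta> $ i) \<or>
      (\<exists>i. (\<forall>j<i. \<beta> $ j = \<alpha> $ j) \<and> \<beta> $ i < \<alpha> $ i)"
    by (cases "\<alpha> $ Min I < \<beta> $ Min I") fastforce+
  then show ?thesis
    by (cases "mi_size \<alpha>" "mi_size \<beta>" rule: linorder_cases) (simp_all add: mi_less_def)
qed

definition mi_less_eq :: "('n::{finite,linorder}) multi_index \<Rightarrow> 'n multi_index \<Rightarrow> bool"
  where "mi_less_eq \<alpha> \<beta> \<longleftrightarrow> mi_less \<alpha> \<beta> \<or> \<alpha> = \<beta>"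

text \<open>A named interpretation, since \<le> on vectors is the componentwise order. It provides
  \<open>mi.sorted_list_of_set\<close> and the uniqueness of strictly sorted lists.\<close>

interpretation mi: linorder mi_less_eq mi_less
  by (unfold_locales; unfold mi_less_eq_def) (use mi_less_irrefl mi_less_trans mi_less_total in blast)+

lemma zero_mi_less: "mi_less 0 \<alpha> \<longleftrightarrow> \<alpha> \<noteq> 0"
  using mi_size_eq_0_iff[of \<alpha>] by (auto simp: mi_less_def)

lemma mi_size_sum: "mi_size (\<Sum>a\<in>A. f a) = (\<Sum>a\<in>A. mi_size (f a))"
  by (induction A rule: infinite_finite_induct) (simp_all add: mi_size_add)

lemma mi_size_scale: "mi_size (c *s \<alpha>) = c * mi_size \<alpha>"
  by (simp add: mi_size_def sum_distrib_left)

section \<open>Sorted tuples and finitely supported functions\<close>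

definition sorted_tuple ::
    "nat \<Rightarrow> nat \<Rightarrow> (nat \<Rightarrow> ('n::{finite,linorder}) multi_index) \<Rightarrow> (nat \<Rightarrow> 'n multi_index) \<Rightarrow> bool"
  where "sorted_tuple m s k l \<longleftrightarrow> s \<in> {1..m} \<and>
    (\<forall>j\<in>{1..m-s}. k j = 0 \<and> l j = 0) \<and>
    (\<forall>j\<in>{m-s+1..m}. mi_size (k j) > 0) \<and>
    mi_less 0 (l (m-s+1)) \<and>
    (\<forall>j\<in>{m-s+1..<m}. mi_less (l j) (l (j+1)))"

lemma fdb_indices_iff:
  assumes "\<beta> \<noteq> 0"
  shows "(k, l) \<in> fdb_indices \<beta> \<mu> \<longleftrightarrow>
    k \<in> {1..mi_size \<beta>} \<rightarrow>\<^sub>E UNIV \<and> l \<in> {1..mi_size \<beta>} \<rightarrow>\<^sub>E UNIV \<and>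
    (\<exists>s. sorted_tuple (mi_size \<beta>) s k l) \<and>
    (\<Sum>j=1..mi_size \<beta>. k j) = \<mu> \<and> (\<Sum>j=1..mi_size \<beta>. mi_size (k j) *s l j) = \<beta>"
  using assms unfolding fdb_indices_def sorted_tuple_def Let_def by auto

text \<open>In a sorted tuple the non-zero l_j are distinct, and k_j = 0 wherever l_j = 0. So the
  sum has at most one non-zero term and reads off the k_j that belongs to v without choosing
  j.\<close>

definition tuple_function :: "nat \<Rightarrow> (nat \<Rightarrow> ('n::finite) multi_index) \<Rightarrow> (nat \<Rightarrow> 'n multi_index) \<Rightarrow> 'n
    multi_index \<Rightarrow> 'n multi_index"
  where "tuple_function m k l v = (\<Sum>j\<in>{j \<in> {1..m}. l j = v}. k j)"

text \<open>The support is listed in increasing order at the right end of {1..m}; the offset m - s +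
  1 translates positions to list indices, which begin at 0. The restricted abstractions yield the
  extensional functions required by \<open>fdb_indices\<close>.\<close>

definition function_tuple :: "nat \<Rightarrow> (('n::{finite,linorder}) multi_index \<Rightarrow> 'n multi_index) \<Rightarrow>
    (nat \<Rightarrow> 'n multi_index) \<times> (nat \<Rightarrow> 'n multi_index)"
  where "function_tuple m g =
    (let xs = mi.sorted_list_of_set {v. g v \<noteq> 0}; s = length xs
     in (\<lambda>j\<in>{1..m}. if j \<le> m - s then 0 else g (xs ! (j - (m - s + 1))),
         \<lambda>j\<in>{1..m}. if j \<le> m - s then 0 else xs ! (j - (m - s + 1))))"

lemma sorted_tupleD:
  assumes "sorted_tuple m s k l"
  shows "1 \<le> s" "s \<le> m"
    and "\<And>j. j \<in> {1..m-s} \<Longrightarrow> k j = 0" "\<And>j. j \<in> {1..m-s} \<Longrightarrow> l j = 0"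
    and "\<And>j. j \<in> {m-s+1..m} \<Longrightarrow> mi_size (k j) > 0"
  using assms unfolding sorted_tuple_def by auto

lemma sorted_tuple_less:
  assumes "sorted_tuple m s k l" "m - s + 1 \<le> i" "i < j" "j \<le> m"
  shows "mi_less (l i) (l j)"
  using assms(3,4)
proof (induction j)
  case (Suc j)
  have step: "mi_less (l j) (l (Suc j))"
  proof -
    have "j \<in> {m-s+1..<m}"
      using assms(2) Suc.prems by simp
    then show ?thesis
      using assms(1) unfolding sorted_tuple_def Suc_eq_plus1 by blast
  qed
  show ?case
    using Suc step mi_less_trans by (cases "i = j") auto
qed simp

lemma sorted_tuple_inj: "sorted_tuple m s k l \<Longrightarrow> inj_on l {m-s+1..m}"
  by (rule linorder_inj_onI) (use sorted_tuple_less mi_less_irrefl in \<open>fastforce+\<close>)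

lemma sorted_tuple_nonzero:
  assumes "sorted_tuple m s k l" "j \<in> {m-s+1..m}"
  shows "l j \<noteq> 0"
proof -
  have "mi_less 0 (l (m-s+1))"
    using assms(1) unfolding sorted_tuple_def by blast
  then have "mi_less 0 (l j)"
    using sorted_tuple_less[OF assms(1), of "m-s+1" j] mi_less_trans assms(2)
    by (cases "j = m-s+1") auto
  then show ?thesis
    by (simp add: zero_mi_less)
qed

lemma tuple_function_eq:
  assumes t: "sorted_tuple m s k l" and j: "j \<in> {m-s+1..m}"
  shows "tuple_function m k l (l j) = k j"
proof -
  have "{i \<in> {1..m}. l i = l j} = {j}"
  proof (intro set_eqI iffI)
    fix i assume "i \<in> {i \<in> {1..m}. l i = l j}"
    then have i: "i \<in> {1..m}" "l i = l j" by auto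
    have "i \<notin> {1..m-s}"
      using sorted_tupleD(4)[OF t, of i] i(2) sorted_tuple_nonzero[OF t j] by metis
    then have "i \<in> {m-s+1..m}"
      using i(1) by auto
    then show "i \<in> {j}"
      using sorted_tuple_inj[OF t] i j by (auto dest: inj_onD)
  qed (use j in auto)
  then show ?thesis
    by (simp add: tuple_function_def)
qed

lemma tuple_function_eq_0:
  assumes t: "sorted_tuple m s k l" and v: "v \<notin> l ` {m-s+1..m}"
  shows "tuple_function m k l v = 0"
  unfolding tuple_function_def
proof (intro sum.neutral ballI)
  fix j assume "j \<in> {j \<in> {1..m}. l j = v}"
  then have "j \<in> {1..m-s}"
    using v by (auto simp: image_iff)
  then show "k j = 0"
    by (rule sorted_tupleD[OF t])
qed

lemma tuple_function_nonzero_iff: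
  assumes t: "sorted_tuple m s k l"
  shows "{v. tuple_function m k l v \<noteq> 0} = l ` {m-s+1..m}"
proof -
  have "k j \<noteq> 0" if "j \<in> {m-s+1..m}" for j
    using sorted_tupleD(5)[OF t that] by auto
  then show ?thesis
    using tuple_function_eq[OF t] tuple_function_eq_0[OF t] by force
qed

text \<open>Stated in \<open>comm_monoid_set\<close> to serve both the sums that define a partition
  and the product of weights. The padding of the tuple and the points of S off the support all carry
  a value h 0 v, which is neutral.\<close>

lemma (in comm_monoid_set) tuple_function_reindex:
  assumes t: "sorted_tuple m s k l" and S: "finite S" "l ` {m-s+1..m} \<subseteq> S" and h: "\<And>v. h 0 v = \<^bold>1"
  shows "F (\<lambda>v. h (tuple_function m k l v) v) S = F (\<lambda>j. h (k j) (l j)) {1..m}"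
proof -
  have "F (\<lambda>v. h (tuple_function m k l v) v) S = F (\<lambda>v. h (tuple_function m k l v) v) (l ` {m-s+1..m})"
    using S h by (intro mono_neutral_right) (auto simp: tuple_function_eq_0[OF t])
  also have "\<dots> = F (\<lambda>j. h (k j) (l j)) {m-s+1..m}"
    by (subst reindex[OF sorted_tuple_inj[OF t]]) (auto intro!: cong simp: tuple_function_eq[OF t])
  also have "\<dots> = F (\<lambda>j. h (k j) (l j)) {1..m}"
  proof (rule mono_neutral_left)
    show "\<forall>j\<in>{1..m} - {m-s+1..m}. h (k j) (l j) = \<^bold>1"
    proof
      fix j assume "j \<in> {1..m} - {m-s+1..m}"
      then have "j \<in> {1..m-s}"
        by auto
      then show "h (k j) (l j) = \<^bold>1"
        using sorted_tupleD(3)[OF t] h by simp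
    qed
  qed auto
  finally show ?thesis .
qed

lemma tuple_function_mem_partition_functions:
  assumes "\<beta> \<noteq> 0" and S: "S = {v. v \<le> \<beta> \<and> v \<noteq> 0}"
    and kl: "(k, l) \<in> fdb_indices \<beta> \<mu>" and t: "sorted_tuple (mi_size \<beta>) s k l"
  shows "l ` {mi_size \<beta> - s + 1..mi_size \<beta>} \<subseteq> S"
    and "tuple_function (mi_size \<beta>) k l \<in> partition_functions S \<beta> \<mu>"
proof -
  let ?m = "mi_size \<beta>"
  have finS: "finite S"
    unfolding S by (rule finite_subset[OF _ finite_mi_atMost[of \<beta>]]) auto
  have sums: "(\<Sum>j=1..?m. k j) = \<mu>" "(\<Sum>j=1..?m. mi_size (k j) *s l j) = \<beta>"
    using kl[unfolded fdb_indices_iff[OF \<open>\<beta> \<noteq> 0\<close>]] by blast+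
  show sub: "l ` {?m - s + 1..?m} \<subseteq> S"
  proof
    fix v assume "v \<in> l ` {?m - s + 1..?m}"
    then obtain j where j: "j \<in> {?m - s + 1..?m}" "v = l j"
      by blast
    then have pos: "mi_size (k j) > 0"
      using sorted_tupleD(5)[OF t] by blast
    have "l j $ i \<le> \<beta> $ i" for i
    proof -
      have "l j $ i \<le> mi_size (k j) * l j $ i" using pos by simp
      also have "\<dots> \<le> (\<Sum>j=1..?m. mi_size (k j) * l j $ i)"
        using j by (intro member_le_sum[of j _ "\<lambda>j. mi_size (k j) * l j $ i"]) auto
      also have "\<dots> = (\<Sum>j=1..?m. mi_size (k j) *s l j) $ i" by simp
      finally show ?thesis unfolding sums .
    qed
    then show "v \<in> S"
      using j sorted_tuple_nonzero[OF t] by (auto simp: S less_eq_vec_def)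
  qed
  have zero: "tuple_function ?m k l v = 0" if "v \<notin> S" for v
    using that sub by (intro tuple_function_eq_0[OF t]) auto
  show "tuple_function ?m k l \<in> partition_functions S \<beta> \<mu>"
    using zero sum.tuple_function_reindex[OF t finS sub, of "\<lambda>\<kappa> v. \<kappa>"]
      sum.tuple_function_reindex[OF t finS sub, of "\<lambda>\<kappa> v. mi_size \<kappa> *s v"]
    by (simp add: partition_functions_def sums vec_eq_iff)
qed

text \<open>The l_j behind the padding form a strictly sorted list of the support, and such a list
  is unique.\<close>

lemma function_tuple_tuple_function:
  assumes "\<beta> \<noteq> 0" and kl: "(k, l) \<in> fdb_indices \<beta> \<mu>"
  shows "function_tuple (mi_size \<beta>) (tuple_function (mi_size \<beta>) k l) = (k, l)"
proof -
  let ?m = "mi_size \<beta>" let ?g = "tuple_function ?m k l"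
  obtain s where t: "sorted_tuple ?m s k l" and k: "k \<in> {1..?m} \<rightarrow>\<^sub>E UNIV" and l: "l \<in> {1..?m} \<rightarrow>\<^sub>E UNIV"
    using kl[unfolded fdb_indices_iff[OF \<open>\<beta> \<noteq> 0\<close>]] by blast
  define xs where "xs = map l [?m - s + 1..<Suc ?m]"
  have s: "1 \<le> s" "s \<le> ?m"
    using sorted_tupleD[OF t] by auto
  have nth: "xs ! i = l (?m - s + 1 + i)" if "i < s" for i
    using that s by (simp add: xs_def del: upt_Suc)
  have len: "length xs = s"
    using s by (simp add: xs_def)
  have "sorted_wrt mi_less xs"
    unfolding sorted_wrt_iff_nth_less len
    using nth sorted_tuple_less[OF t] s by auto
  moreover have "set xs = {v. ?g v \<noteq> 0}"
    unfolding tuple_function_nonzero_iff[OF t] xs_def by auto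
  ultimately have xs: "mi.sorted_list_of_set {v. ?g v \<noteq> 0} = xs"
    by (intro mi.strict_sorted_equal mi.strict_sorted_list_of_set)
      (simp_all add: tuple_function_nonzero_iff[OF t])
  have low: "k j = 0" "l j = 0" if "j \<in> {1..?m}" "j \<le> ?m - s" for j
    using sorted_tupleD(3,4)[OF t, of j] that by auto
  have high: "xs ! (j - (?m - s + 1)) = l j" "?g (l j) = k j" if "j \<in> {1..?m}" "\<not> j \<le> ?m - s" for j
    using that s nth[of "j - (?m - s + 1)"] tuple_function_eq[OF t, of j] by auto
  have "function_tuple ?m ?g = (restrict k {1..?m}, restrict l {1..?m})"
    unfolding function_tuple_def Let_def xs len
    by (auto simp: high low simp del: atLeastAtMost_iff intro!: restrict_ext)
  also have "\<dots> = (k, l)"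
    using k l by (simp add: PiE_restrict)
  finally show ?thesis .
qed

lemma function_tuple_mem_fdb_indices:
  assumes "\<beta> \<noteq> 0" and S: "S = {v. v \<le> \<beta> \<and> v \<noteq> 0}" and g: "g \<in> partition_functions S \<beta> \<mu>"
  shows "function_tuple (mi_size \<beta>) g \<in> fdb_indices \<beta> \<mu>"
    and "case function_tuple (mi_size \<beta>) g of (k, l) \<Rightarrow> tuple_function (mi_size \<beta>) k l = g"
proof -
  let ?m = "mi_size \<beta>"
  define X where "X = {v. g v \<noteq> 0}"
  define xs where "xs = mi.sorted_list_of_set X"
  define s where "s = length xs"
  obtain k l where kl: "function_tuple ?m g = (k, l)"
    by fastforce
  have finS: "finite S"
    unfolding S by (rule finite_subset[OF _ finite_mi_atMost[of \<beta>]]) auto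
  have sums: "(\<Sum>v\<in>S. g v) = \<mu>" "(\<Sum>v\<in>S. mi_size (g v) *s v) = \<beta>" and XS: "X \<subseteq> S"
    using g by (auto simp: partition_functions_def X_def)
  have finX: "finite X"
    using XS finS finite_subset by blast
  have setxs: "set xs = X"
    using finX by (simp add: xs_def)
  have sX: "s = card X"
    by (simp add: s_def xs_def)
  \<comment> \<open>The tuple has |\<beta>| places. The support fits because each of its points
    contributes at least 1 to the sum of |g v| |v|, which is |\<beta>|.\<close>
  have "card X = (\<Sum>v\<in>X. 1)"
    by simp
  also have "\<dots> \<le> (\<Sum>v\<in>X. mi_size (g v) * mi_size v)"
  proof (rule sum_mono)
    fix v assume "v \<in> X"
    then have "mi_size (g v) \<noteq> 0" "mi_size v \<noteq> 0"
      using XS by (auto simp: mi_size_eq_0_iff X_def S)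
    then show "1 \<le> mi_size (g v) * mi_size v"
      by (simp add: Suc_le_eq One_nat_def)
  qed
  also have "\<dots> \<le> (\<Sum>v\<in>S. mi_size (g v) * mi_size v)"
    by (rule sum_mono2[OF finS XS]) simp
  also have "\<dots> = ?m"
    using arg_cong[OF sums(2), of mi_size] by (simp add: mi_size_sum mi_size_scale)
  finally have sm: "s \<le> ?m"
    by (simp add: sX)
  \<comment> \<open>An empty support would give \<beta> = 0, while \<open>fdb_indices\<close>
    demands s \<ge> 1.\<close>
  have "X \<noteq> {}"
  proof
    assume "X = {}"
    then have "g v = 0" for v
      by (auto simp: X_def)
    then have "(\<Sum>v\<in>S. mi_size (g v) *s v) = 0"
      by simp
    then show False
      using sums(2) \<open>\<beta> \<noteq> 0\<close> by simp
  qed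
  then have s1: "1 \<le> s"
    using finX sX by (simp add: Suc_le_eq card_gt_0_iff One_nat_def)
  have low: "k j = 0" "l j = 0" if "j \<in> {1..?m-s}" for j
    using kl that by (auto simp: function_tuple_def Let_def X_def[symmetric] xs_def[symmetric]
        s_def[symmetric])
  have high: "k j = g (l j)" "l j = xs ! (j - (?m-s+1))" if "j \<in> {?m-s+1..?m}" for j
    using kl that by (auto simp: function_tuple_def Let_def X_def[symmetric] xs_def[symmetric]
        s_def[symmetric])
  have mem: "l j \<in> X" if "j \<in> {?m-s+1..?m}" for j
  proof -
    have "j - (?m-s+1) < s"
      using that sm s1 by auto
    then show ?thesis
      using high(2)[OF that] setxs by (auto simp: s_def)
  qed
  have image: "l ` {?m-s+1..?m} = X"
  proof
    show "X \<subseteq> l ` {?m-s+1..?m}"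
    proof
      fix v assume "v \<in> X"
      then obtain i where i: "i < s" "v = xs ! i"
        using setxs by (auto simp: in_set_conv_nth s_def)
      have j: "?m-s+1+i \<in> {?m-s+1..?m}"
        using i(1) sm unfolding atLeastAtMost_iff by linarith
      from high(2)[OF this] have "v = l (?m-s+1+i)"
        by (simp only: i(2) diff_add_inverse)
      then show "v \<in> l ` {?m-s+1..?m}"
        using j by (rule image_eqI)
    qed
  qed (use mem in auto)
  have sorted: "sorted_wrt mi_less xs"
    by (simp add: xs_def mi.strict_sorted_list_of_set)
  have t: "sorted_tuple ?m s k l"
    unfolding sorted_tuple_def
  proof (intro conjI ballI)
    fix j assume j: "j \<in> {?m-s+1..?m}"
    show "mi_size (k j) > 0"
      using high(1)[OF j] mem[OF j] mi_size_eq_0_iff[of "k j"] by (simp add: X_def)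
  next
    show "mi_less 0 (l (?m-s+1))"
    proof -
      have "?m-s+1 \<in> {?m-s+1..?m}"
        using s1 sm unfolding atLeastAtMost_iff by linarith
      from mem[OF this] show ?thesis
        using XS unfolding zero_mi_less S by blast
    qed
  next
    fix j assume j: "j \<in> {?m-s+1..<?m}"
    have "mi_less (xs ! (j - (?m-s+1))) (xs ! (j + 1 - (?m-s+1)))"
      using j s1 sm by (intro sorted_wrt_nth_less[OF sorted]) (auto simp: s_def)
    then show "mi_less (l j) (l (j + 1))"
      using high(2)[of j] high(2)[of "j + 1"] j by auto
  qed (use low sm s1 in auto)
  have tf: "tuple_function ?m k l v = g v" for v
  proof (cases "v \<in> X")
    case True
    then obtain j where "j \<in> {?m-s+1..?m}" "v = l j"
      using image by blast
    then show ?thesis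
      using tuple_function_eq[OF t] high(1) by simp
  next
    case False
    then show ?thesis
      using tuple_function_eq_0[OF t, of v] image by (simp add: X_def)
  qed
  then show "case function_tuple ?m g of (k, l) \<Rightarrow> tuple_function ?m k l = g"
    by (simp add: kl fun_eq_iff)
  have ext: "k \<in> {1..?m} \<rightarrow>\<^sub>E UNIV" "l \<in> {1..?m} \<rightarrow>\<^sub>E UNIV"
    using kl by (auto simp: function_tuple_def Let_def)
  have lS: "l ` {?m-s+1..?m} \<subseteq> S"
    using image XS by simp
  have "(\<Sum>j=1..?m. k j) = \<mu>"
    using sum.tuple_function_reindex[OF t finS lS, of "\<lambda>\<kappa> v. \<kappa>"] sums by (simp add: tf)
  moreover have "(\<Sum>j=1..?m. mi_size (k j) *s l j) = \<beta>"
    using sum.tuple_function_reindex[OF t finS lS, of "\<lambda>\<kappa> v. mi_size \<kappa> *s v"] sums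
        by (simp add: tf vec_eq_iff)
  ultimately show "function_tuple ?m g \<in> fdb_indices \<beta> \<mu>"
    unfolding kl fdb_indices_iff[OF \<open>\<beta> \<noteq> 0\<close>] using ext t by blast
qed

text \<open>Trades the ordered index set of the Faa di Bruno sum for the one on which
  \<open>partition_sum_rec\<close> operates.\<close>

lemma sum_fdb_indices:
  fixes h :: "('n::{finite,linorder}) multi_index \<Rightarrow> 'n multi_index \<Rightarrow> 'a::comm_semiring_1"
  assumes "\<beta> \<noteq> 0" and h: "\<And>v. h 0 v = 1"
  defines "S \<equiv> {v. v \<le> \<beta> \<and> v \<noteq> 0}"
  shows "(\<Sum>(k, l)\<in>fdb_indices \<beta> \<mu>. \<Prod>j=1..mi_size \<beta>. h (k j) (l j)) =
    (\<Sum>g\<in>partition_functions S \<beta> \<mu>. \<Prod>v\<in>S. h (g v) v)"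
proof (rule sum.reindex_bij_witness[where i = "function_tuple (mi_size \<beta>)"
      and j = "\<lambda>(k, l). tuple_function (mi_size \<beta>) k l"])
  fix p assume "p \<in> fdb_indices \<beta> \<mu>"
  then obtain k l where p: "p = (k, l)" "(k, l) \<in> fdb_indices \<beta> \<mu>"
    by (cases p) auto
  then obtain s where t: "sorted_tuple (mi_size \<beta>) s k l"
    using p(2)[unfolded fdb_indices_iff[OF \<open>\<beta> \<noteq> 0\<close>]] by blast
  have finS: "finite S"
    unfolding S_def by (rule finite_subset[OF _ finite_mi_atMost[of \<beta>]]) auto
  note mem = tuple_function_mem_partition_functions[OF \<open>\<beta> \<noteq> 0\<close> S_def[THEN meta_eq_to_obj_eq] p(2) t]
  show "function_tuple (mi_size \<beta>) (case p of (k, l) \<Rightarrow> tuple_function (mi_size \<beta>) k l) = p"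
    using function_tuple_tuple_function[OF \<open>\<beta> \<noteq> 0\<close> p(2)] p(1) by simp
  show "(case p of (k, l) \<Rightarrow> tuple_function (mi_size \<beta>) k l) \<in> partition_functions S \<beta> \<mu>"
    using mem(2) p(1) by simp
  show "(\<Prod>v\<in>S. h ((case p of (k, l) \<Rightarrow> tuple_function (mi_size \<beta>) k l) v) v) =
      (case p of (k, l) \<Rightarrow> \<Prod>j=1..mi_size \<beta>. h (k j) (l j))"
    using prod.tuple_function_reindex[OF t finS mem(1), of h] h p(1) by simp
next
  fix g assume "g \<in> partition_functions S \<beta> \<mu>"
  from function_tuple_mem_fdb_indices[OF \<open>\<beta> \<noteq> 0\<close> S_def[THEN meta_eq_to_obj_eq] this]
  show "(case function_tuple (mi_size \<beta>) g of (k, l) \<Rightarrow> tuple_function (mi_size \<beta>) k l) = g"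
    "function_tuple (mi_size \<beta>) g \<in> fdb_indices \<beta> \<mu>"
    by (simp_all add: split_def)
qed

section \<open>The coefficients as derivatives\<close>

lemma fdb_sum_eq:
  fixes \<phi> :: "('n::{finite,linorder}) space \<Rightarrow> 'n space"
  assumes \<phi>: "smooth \<phi>"
  shows "of_real (fdb_sum \<phi> \<beta> \<mu> x) =
    of_nat (mi_fact \<beta>) * taylor_coeff \<beta> (\<lambda>t. taylor_monomial (\<phi> x) \<mu> (\<phi> t)) x"
proof (cases "\<beta> = 0")
  case True
  have "taylor_monomial (\<phi> x) \<mu> (\<phi> x) = (if \<mu> = 0 then 1 else 0)"
    using mi_derivative_taylor_monomial[of 0 "\<phi> x" \<mu>] by auto
  then show ?thesis
    using True by (simp add: fdb_sum_def fdb_indices_def taylor_coeff_def)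
next
  case False
  define S where "S = {v. v \<le> \<beta> \<and> v \<noteq> 0}"
  define d where "d v i = (of_real (mi_derivative v (\<lambda>y. \<phi> y $ i) x) :: complex)" for v i
  \<comment> \<open>The factor of the summand that belongs to one pair (k_j, l_j); a padding pair
    contributes 1, as \<open>sum_fdb_indices\<close> requires.\<close>
  define h where "h \<kappa> v = (\<Prod>i\<in>UNIV. d v i ^ (\<kappa> $ i)) /
      (of_nat (mi_fact \<kappa>) * of_nat (mi_fact v) ^ mi_size \<kappa>)" for \<kappa> v :: "'n multi_index"
  have h0: "h 0 v = 1" for v
    by (simp add: h_def)
  have "of_real (fdb_sum \<phi> \<beta> \<mu> x) =
      of_nat (mi_fact \<beta>) * (\<Sum>(k, l)\<in>fdb_indices \<beta> \<mu>. \<Prod>j=1..mi_size \<beta>. h (k j) (l j))"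
    by (simp add: fdb_sum_def h_def d_def sum_distrib_left split_def)
  also have "(\<Sum>(k, l)\<in>fdb_indices \<beta> \<mu>. \<Prod>j=1..mi_size \<beta>. h (k j) (l j)) =
      (\<Sum>g\<in>partition_functions S \<beta> \<mu>. \<Prod>v\<in>S. h (g v) v)"
    unfolding S_def using h0 by (rule sum_fdb_indices[OF False, of h])
  also have "\<dots> = (\<Sum>g\<in>partition_functions S \<beta> \<mu>.
      partition_weight S (\<lambda>v i. taylor_coeff v (\<lambda>t. of_real (\<phi> t $ i - \<phi> x $ i)) x) g)"
    unfolding partition_weight_def
  proof (intro sum.cong prod.cong refl)
    fix g v assume "v \<in> S"
    then have v: "v \<noteq> 0"
      by (simp add: S_def)
    \<comment> \<open>Subtracting the constant \<phi> x affects only the degree v = 0, which S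
      omits.\<close>
    have "mi_derivative v (\<lambda>t. of_real (\<phi> t $ i) - of_real (\<phi> x $ i)) x = d v i" for i
      using v by (simp add: mi_derivative_diff mi_derivative_const smooth_of_real smooth_vec_nth \<phi>
          mi_derivative_bounded_linear[OF bounded_linear_of_real] d_def)
    then have "taylor_coeff v (\<lambda>t. of_real (\<phi> t $ i - \<phi> x $ i)) x = d v i / of_nat (mi_fact v)" for i
      by (simp add: taylor_coeff_def)
    \<comment> \<open>The power of v! with exponent |g v| splits over the coordinates and turns each
      derivative into a Taylor coefficient.\<close>
    then show "h (g v) v =
        (\<Prod>i\<in>UNIV. taylor_coeff v (\<lambda>t. of_real (\<phi> t $ i - \<phi> x $ i)) x ^ (g v $ i)) / of_nat
            (mi_fact (g v))"
      by (simp add: h_def power_divide prod_dividef mi_size_def power_sum mult.commute)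
  qed
  also have "\<dots> = taylor_coeff \<beta> (\<lambda>t. taylor_monomial (\<phi> x) \<mu> (\<phi> t)) x"
    unfolding taylor_monomial_def S_def
    by (rule taylor_coeff_monomial_compose[symmetric]) (auto intro: smooth_of_real_component \<phi>
        simp del: of_real_diff)
  finally show ?thesis .
qed

lemma mi_choose_fact:
  assumes "\<beta> \<le> \<alpha>"
  shows "(of_nat (mi_choose \<alpha> \<beta>) :: complex) = of_nat (mi_fact \<alpha>) / (of_nat (mi_fact \<beta>) * of_nat
      (mi_fact (\<alpha> - \<beta>)))"
proof -
  have "mi_fact \<beta> * mi_fact (\<alpha> - \<beta>) * mi_choose \<alpha> \<beta> = mi_fact \<alpha>"
    unfolding mi_fact_def mi_choose_def prod.distrib[symmetric]
    using assms by (intro prod.cong) (auto simp: less_eq_vec_def binomial_fact_lemma)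
  then have "of_nat (mi_fact \<alpha>) = (of_nat (mi_fact \<beta>) * of_nat (mi_fact (\<alpha> - \<beta>)) * of_nat
      (mi_choose \<alpha> \<beta>) :: complex)"
    by (metis of_nat_mult)
  then show ?thesis
    by simp
qed

lemma F_fun_eq:
  fixes \<phi> :: "('n::{finite,linorder}) space \<Rightarrow> 'n space"
  assumes \<phi>: "smooth \<phi>" and \<psi>: "smooth \<psi>"
  shows "F_fun \<phi> \<psi> \<alpha> \<mu> x = mi_derivative \<alpha> (\<lambda>t. \<psi> t * taylor_monomial (\<phi> x) \<mu> (\<phi> t)) x"
proof -
  let ?q = "\<lambda>t. taylor_monomial (\<phi> x) \<mu> (\<phi> t)"
  have fin: "finite {..\<alpha>}"
    unfolding atMost_def by (rule finite_mi_atMost)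
  \<comment> \<open>This accounts for the restriction |\<mu>| \<le> |\<beta>| in
    \<open>F_fun\<close>: the monomial vanishes to order |\<mu>| at \<phi> x, so its composite with
    \<phi> has no lower Taylor coefficients at x.\<close>
  have small: "taylor_coeff \<beta> ?q x = 0" if "mi_size \<beta> < mi_size \<mu>" for \<beta>
  proof -
    have "mi_derivative \<beta> (\<lambda>t. 1 * taylor_monomial (\<phi> x) \<mu> (\<phi> t)) x = 0"
      using that by (intro mi_derivative_weighted_eq_0[where m = "mi_size \<beta>"])
        (auto simp: mi_derivative_taylor_monomial smooth_taylor_monomial \<phi>)
    then show ?thesis
      by (simp add: taylor_coeff_def)
  qed
  have "mi_derivative \<alpha> (\<lambda>t. \<psi> t * ?q t) x = of_nat (mi_fact \<alpha>) * taylor_coeff \<alpha> (\<lambda>t. ?q t * \<psi> t) x"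
    by (simp add: taylor_coeff_def mult.commute[of "\<psi> _"])
  also have "\<dots> = of_nat (mi_fact \<alpha>) * (\<Sum>\<beta>\<in>{..\<alpha>}. taylor_coeff \<beta> ?q x * taylor_coeff (\<alpha> - \<beta>) \<psi> x)"
    by (simp add: taylor_coeff_mult smooth_taylor_monomial_compose \<phi> \<psi>)
  also have "(\<Sum>\<beta>\<in>{..\<alpha>}. taylor_coeff \<beta> ?q x * taylor_coeff (\<alpha> - \<beta>) \<psi> x) =
      (\<Sum>\<beta> | \<beta> \<le> \<alpha> \<and> mi_size \<mu> \<le> mi_size \<beta>. taylor_coeff \<beta> ?q x * taylor_coeff (\<alpha> - \<beta>) \<psi> x)"
  proof (rule sum.mono_neutral_right[OF fin])
    show "\<forall>\<beta>\<in>{..\<alpha>} - {\<beta>. \<beta> \<le> \<alpha> \<and> mi_size \<mu> \<le> mi_size \<beta>}.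
        taylor_coeff \<beta> ?q x * taylor_coeff (\<alpha> - \<beta>) \<psi> x = 0"
    proof
      fix \<beta> assume "\<beta> \<in> {..\<alpha>} - {\<beta>. \<beta> \<le> \<alpha> \<and> mi_size \<mu> \<le> mi_size \<beta>}"
      then have "mi_size \<beta> < mi_size \<mu>"
        by auto
      then show "taylor_coeff \<beta> ?q x * taylor_coeff (\<alpha> - \<beta>) \<psi> x = 0"
        by (simp add: small)
    qed
  qed auto
  also have "of_nat (mi_fact \<alpha>) * \<dots> = F_fun \<phi> \<psi> \<alpha> \<mu> x"
    unfolding F_fun_def sum_distrib_left
  proof (rule sum.cong)
    fix \<beta> assume "\<beta> \<in> {\<beta>. \<beta> \<le> \<alpha> \<and> mi_size \<mu> \<le> mi_size \<beta>}"
    then have "\<beta> \<le> \<alpha>" by simp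
    then show "of_nat (mi_fact \<alpha>) * (taylor_coeff \<beta> ?q x * taylor_coeff (\<alpha> - \<beta>) \<psi> x) =
        of_nat (mi_choose \<alpha> \<beta>) * mi_derivative (\<alpha> - \<beta>) \<psi> x * of_real (fdb_sum \<phi> \<beta> \<mu> x)"
      by (simp add: fdb_sum_eq[OF \<phi>] mi_choose_fact taylor_coeff_def[of "\<alpha> - \<beta>"])
  qed simp
  finally show ?thesis ..
qed

lemma faa_di_bruno_leibniz:
  fixes \<phi> :: "('n::{finite,linorder}) space \<Rightarrow> 'n space"
  assumes "smooth \<psi>" "smooth f" "smooth \<phi>"
  shows "mi_derivative \<alpha> (\<lambda>t. \<psi> t * f (\<phi> t)) x =
    (\<Sum>\<mu> | mi_size \<mu> \<le> mi_size \<alpha>. mi_derivative \<mu> f (\<phi> x) * F_fun \<phi> \<psi> \<alpha> \<mu> x)"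
  using mi_derivative_weighted[OF assms] F_fun_eq[OF assms(3,1)] by simp

section \<open>Schwartz functions\<close>

lemma one_plus_norm_pos [simp]: "0 < 1 + norm x"
  by (rule add_pos_nonneg) simp_all

lemma one_plus_norm_nonzero [simp]: "1 + norm x \<noteq> 0"
  using one_plus_norm_pos[of x] by linarith

lemma schwartz_smooth: "f \<in> schwartz \<Longrightarrow> smooth f"
  by (simp add: schwartz_def)

lemma schwartz_norm_upper:
  assumes "f \<in> schwartz" "p > 0"
  shows "(1 + norm x) powr p * norm (mi_derivative \<alpha> f x) \<le> schwartz_norm p \<alpha> f"
  unfolding schwartz_norm_def using assms by (intro cSUP_upper) (auto simp: schwartz_def)

lemma schwartz_norm_least:
  assumes "\<And>x. (1 + norm x) powr p * norm (mi_derivative \<alpha> f x) \<le> C"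
  shows "schwartz_norm p \<alpha> f \<le> C"
  unfolding schwartz_norm_def using assms by (intro cSUP_least) auto

lemma schwartzI:
  assumes "smooth f" "\<And>p \<alpha>. p > 0 \<Longrightarrow> \<exists>C. \<forall>x. (1 + norm x) powr p * norm (mi_derivative \<alpha> f x) \<le> C"
  shows "f \<in> schwartz"
  using assms unfolding schwartz_def bdd_above_def by blast

lemma schwartz_diff_bound:
  assumes "f \<in> schwartz" "g \<in> schwartz" "p > 0"
  shows "(1 + norm x) powr p * norm (mi_derivative \<alpha> (\<lambda>x. f x - g x) x) \<le>
    schwartz_norm p \<alpha> f + schwartz_norm p \<alpha> g"
proof -
  have "(1 + norm x) powr p * norm (mi_derivative \<alpha> (\<lambda>x. f x - g x) x) \<le>
      (1 + norm x) powr p * norm (mi_derivative \<alpha> f x) + (1 + norm x) powr p * norm (mi_derivative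
          \<alpha> g x)"
    unfolding mi_derivative_diff[OF assms(1,2)[THEN schwartz_smooth]] distrib_left[symmetric]
    by (intro mult_left_mono norm_triangle_ineq4) simp
  then show ?thesis
    using schwartz_norm_upper[OF assms(1,3), of x \<alpha>] schwartz_norm_upper[OF assms(2,3), of x \<alpha>]
        by linarith
qed

lemma schwartz_diff: "f \<in> schwartz \<Longrightarrow> g \<in> schwartz \<Longrightarrow> (\<lambda>x. f x - g x) \<in> schwartz"
  by (rule schwartzI) (auto intro: smooth_diff schwartz_smooth schwartz_diff_bound)

lemma schwartz_norm_uminus: "schwartz_norm p \<alpha> (\<lambda>x. g x - f x) = schwartz_norm p \<alpha> (\<lambda>x. f x - g x)"
  if "f \<in> schwartz" "g \<in> schwartz"
  using that by (simp add: schwartz_norm_def mi_derivative_diff schwartz_smooth norm_minus_commute)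

lemma schwartz_norm_triangle:
  assumes "f \<in> schwartz" "g \<in> schwartz" "h \<in> schwartz" "p > 0"
  shows "schwartz_norm p \<alpha> (\<lambda>x. f x - h x) \<le> schwartz_norm p \<alpha> (\<lambda>x. f x - g x) + schwartz_norm p \<alpha>
      (\<lambda>x. g x - h x)"
proof (rule schwartz_norm_least)
  fix x
  have "(\<lambda>x. f x - h x) = (\<lambda>x. (f x - g x) - (h x - g x))"
    by simp
  then show "(1 + norm x) powr p * norm (mi_derivative \<alpha> (\<lambda>x. f x - h x) x) \<le>
      schwartz_norm p \<alpha> (\<lambda>x. f x - g x) + schwartz_norm p \<alpha> (\<lambda>x. g x - h x)"
    using schwartz_diff_bound[OF schwartz_diff[OF assms(1,2)] schwartz_diff[OF assms(3,2)]
        assms(4), of x \<alpha>]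
    by (simp add: schwartz_norm_uminus[OF assms(3,2)])
qed

lemma openin_schwartz_ball:
  assumes "p > 0" "f \<in> schwartz" "\<epsilon> > 0"
  shows "openin schwartz_topology {g \<in> schwartz. schwartz_norm p \<alpha> (\<lambda>x. g x - f x) < \<epsilon>}"
  unfolding schwartz_topology_def by (rule topology_generated_by_Basis) (use assms in blast)

text \<open>Compatibility with differences reduces the comparison of T g and T h to a seminorm of T
  (g - h). As finitely many seminorms control it, a finite intersection of subbasic balls around h
  is mapped into the given ball.\<close>

lemma continuous_map_schwartz:
  fixes T :: "(('a::{finite,linorder}) space \<Rightarrow> complex) \<Rightarrow> ('b::{finite,linorder}) space \<Rightarrow> complex"
  assumes T: "\<And>f. f \<in> schwartz \<Longrightarrow> T f \<in> schwartz"
    and diff: "\<And>f g. (\<lambda>x. T f x - T g x) = T (\<lambda>x. f x - g x)"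
    and bound: "\<And>p \<alpha>. p > 0 \<Longrightarrow> \<exists>M q C. finite M \<and> (\<forall>\<mu>\<in>M. q \<mu> > 0 \<and> C \<mu> \<ge> 0) \<and>
      (\<forall>f\<in>schwartz. schwartz_norm p \<alpha> (T f) \<le> (\<Sum>\<mu>\<in>M. C \<mu> * schwartz_norm (q \<mu>) \<mu> f))"
  shows "continuous_map schwartz_topology schwartz_topology T"
  unfolding schwartz_topology_def
proof (rule continuous_on_generated_topo, fold schwartz_topology_def)
  show "T ` topspace schwartz_topology \<subseteq> \<Union> {{g \<in> schwartz. schwartz_norm p \<alpha> (\<lambda>x. g x - f x) < \<epsilon>}
      | p \<alpha> f \<epsilon>.
      p > 0 \<and> f \<in> schwartz \<and> \<epsilon> > 0}"
    using T topspace_schwartz_topology unfolding schwartz_topology_def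
        topology_generated_by_topspace by blast
next
  fix U :: "('b space \<Rightarrow> complex) set"
  assume "U \<in> {{g \<in> schwartz. schwartz_norm p \<alpha> (\<lambda>x. g x - f x) < \<epsilon>} | p \<alpha> f \<epsilon>.
      p > 0 \<and> f \<in> schwartz \<and> \<epsilon> > 0}"
  then obtain p \<alpha> f \<epsilon> where U: "U = {g \<in> schwartz. schwartz_norm p \<alpha> (\<lambda>x. g x - f x) < \<epsilon>}"
    and p: "p > 0" and f: "f \<in> schwartz" and "\<epsilon> > 0"
    by blast
  obtain M q C where M: "finite M" "\<forall>\<mu>\<in>M. q \<mu> > 0 \<and> C \<mu> \<ge> 0"
    and le: "\<And>u. u \<in> schwartz \<Longrightarrow> schwartz_norm p \<alpha> (T u) \<le> (\<Sum>\<mu>\<in>M. C \<mu> * schwartz_norm (q \<mu>) \<mu> u)"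
    using bound[OF p, of \<alpha>] by blast
  show "openin schwartz_topology (T -` U \<inter> topspace schwartz_topology)"
  proof (subst openin_subopen, intro ballI)
    fix h assume "h \<in> T -` U \<inter> topspace schwartz_topology"
    then have h: "h \<in> schwartz" and e: "schwartz_norm p \<alpha> (\<lambda>x. T h x - f x) < \<epsilon>"
      by (auto simp: U)
    \<comment> \<open>The room left in the ball, shared among the seminorms; the summand 1 in the
      denominator allows all C to be 0 and makes the estimate below strict.\<close>
    define \<delta> where "\<delta> = (\<epsilon> - schwartz_norm p \<alpha> (\<lambda>x. T h x - f x)) / (1 + sum C M)"
    have C: "sum C M \<ge> 0"
      using M by (intro sum_nonneg) auto
    then have \<delta>: "\<delta> > 0"
      using e by (simp add: \<delta>_def)
    \<comment> \<open>Intersecting with \<open>schwartz\<close> covers an empty M, for which the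
      inner intersection is everything.\<close>
    define V where "V = schwartz \<inter> (\<Inter>\<mu>\<in>M. {g \<in> schwartz. schwartz_norm (q \<mu>) \<mu> (\<lambda>x. g x - h x) < \<delta>})"
    have "openin schwartz_topology V"
    proof -
      have "openin schwartz_topology ((\<Inter>\<mu>\<in>M. {g \<in> schwartz. schwartz_norm (q \<mu>) \<mu> (\<lambda>x. g x - h x) < \<delta>})
          \<inter> topspace schwartz_topology)"
        using M \<delta> h by (intro openin_INT) (auto intro!: openin_schwartz_ball)
      then show ?thesis
        by (simp add: V_def Int_commute)
    qed
    moreover have "h \<in> V"
      using h \<delta> by (simp add: V_def schwartz_norm_def mi_derivative_zero)
    moreover have "V \<subseteq> T -` U \<inter> topspace schwartz_topology"
    proof
      fix g assume gV: "g \<in> V"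
      then have g: "g \<in> schwartz"
        by (simp add: V_def)
      have "schwartz_norm p \<alpha> (\<lambda>x. T g x - T h x) \<le> (\<Sum>\<mu>\<in>M. C \<mu> * schwartz_norm (q \<mu>) \<mu> (\<lambda>x. g x - h x))"
        unfolding diff by (intro le schwartz_diff g h)
      also have "\<dots> \<le> (\<Sum>\<mu>\<in>M. C \<mu> * \<delta>)"
        using gV M by (intro sum_mono mult_left_mono) (auto simp: V_def less_imp_le)
      also have "\<dots> < (1 + sum C M) * \<delta>"
        using \<delta> by (simp add: sum_distrib_right distrib_right)
      also have "\<dots> = \<epsilon> - schwartz_norm p \<alpha> (\<lambda>x. T h x - f x)"
        using C by (simp add: \<delta>_def)
      finally have "schwartz_norm p \<alpha> (\<lambda>x. T g x - f x) < \<epsilon>"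
        using schwartz_norm_triangle[OF T[OF g] T[OF h] f p, of \<alpha>] by linarith
      then show "g \<in> T -` U \<inter> topspace schwartz_topology"
        using g T by (simp add: U)
    qed
    ultimately show "\<exists>V. openin schwartz_topology V \<and> h \<in> V \<and> V \<subseteq> T -` U \<inter> topspace schwartz_topology"
      by blast
  qed
qed

section \<open>From the growth condition to continuity\<close>

lemma weighted_composition_bound:
  fixes \<phi> :: "('n::{finite,linorder}) space \<Rightarrow> 'n space"
  assumes \<psi>: "smooth \<psi>" and \<phi>: "smooth \<phi>"
    and F: "\<And>\<mu>. mi_size \<mu> \<le> mi_size \<alpha> \<Longrightarrow> \<exists>q::real. q > 0 \<and>
      bdd_above (range (\<lambda>x. (1 + norm x) powr p / (1 + norm (\<phi> x)) powr q * norm (F_fun \<phi> \<psi> \<alpha> \<mu> x)))"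
  shows "\<exists>q C. (\<forall>\<mu>. mi_size \<mu> \<le> mi_size \<alpha> \<longrightarrow> q \<mu> > 0 \<and> C \<mu> \<ge> 0) \<and>
    (\<forall>f\<in>schwartz. \<forall>x. (1 + norm x) powr p * norm (mi_derivative \<alpha> (weighted_composition \<psi> \<phi> f) x) \<le>
      (\<Sum>\<mu> | mi_size \<mu> \<le> mi_size \<alpha>. C \<mu> * schwartz_norm (q \<mu>) \<mu> f))"
proof -
  have "\<exists>q C. q > 0 \<and> (\<forall>x. (1 + norm x) powr p / (1 + norm (\<phi> x)) powr q * norm (F_fun \<phi> \<psi> \<alpha> \<mu> x) \<le> C)"
    if "mi_size \<mu> \<le> mi_size \<alpha>" for \<mu>
    using F[OF that] by (auto simp: bdd_above_def)
  then obtain q C where qC: "\<And>\<mu> :: 'n multi_index. mi_size \<mu> \<le> mi_size \<alpha> \<Longrightarrow> q \<mu> > 0"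
    "\<And>\<mu> x. mi_size \<mu> \<le> mi_size \<alpha> \<Longrightarrow>
      (1 + norm x) powr p / (1 + norm (\<phi> x)) powr q \<mu> * norm (F_fun \<phi> \<psi> \<alpha> \<mu> x) \<le> C \<mu>"
    by metis
  \<comment> \<open>The bound at a single point, here 0, shows that C \<mu> is non-negative.\<close>
  have C: "C \<mu> \<ge> 0" if "mi_size \<mu> \<le> mi_size \<alpha>" for \<mu> :: "'n multi_index"
    by (rule order_trans[OF _ qC(2)[OF that, of 0]]) simp
  show ?thesis
  proof (rule exI[of _ q], rule exI[of _ C], intro conjI ballI allI)
    fix f :: "'n space \<Rightarrow> complex" and x
    assume f: "f \<in> schwartz"
    have "(1 + norm x) powr p * norm (mi_derivative \<alpha> (weighted_composition \<psi> \<phi> f) x) \<le>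
        (1 + norm x) powr p * (\<Sum>\<mu> | mi_size \<mu> \<le> mi_size \<alpha>. norm (mi_derivative \<mu> f (\<phi> x) * F_fun \<phi>
            \<psi> \<alpha> \<mu> x))"
      unfolding weighted_composition_def faa_di_bruno_leibniz[OF \<psi> schwartz_smooth[OF f] \<phi>]
      by (intro mult_left_mono norm_sum) simp
    also have "\<dots> \<le> (\<Sum>\<mu> | mi_size \<mu> \<le> mi_size \<alpha>. C \<mu> * schwartz_norm (q \<mu>) \<mu> f)"
      unfolding sum_distrib_left
    proof (rule sum_mono)
      fix \<mu> :: "'n multi_index"
      assume "\<mu> \<in> {\<mu>. mi_size \<mu> \<le> mi_size \<alpha>}"
      then have \<mu>: "mi_size \<mu> \<le> mi_size \<alpha>"
        by simp
      have pos: "(1 + norm (\<phi> x)) powr q \<mu> > 0"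
        by simp
      \<comment> \<open>Multiplying and dividing by (1 + |\<phi> x|)^q separates the growth
        condition from a seminorm of f evaluated at \<phi> x.\<close>
      have "(1 + norm x) powr p * norm (mi_derivative \<mu> f (\<phi> x) * F_fun \<phi> \<psi> \<alpha> \<mu> x) =
          ((1 + norm x) powr p / (1 + norm (\<phi> x)) powr q \<mu> * norm (F_fun \<phi> \<psi> \<alpha> \<mu> x)) *
          ((1 + norm (\<phi> x)) powr q \<mu> * norm (mi_derivative \<mu> f (\<phi> x)))"
        using pos by (simp add: norm_mult)
      also have "\<dots> \<le> C \<mu> * schwartz_norm (q \<mu>) \<mu> f"
        by (intro mult_mono qC schwartz_norm_upper f \<mu> C) simp
      finally show "(1 + norm x) powr p * norm (mi_derivative \<mu> f (\<phi> x) * F_fun \<phi> \<psi> \<alpha> \<mu> x) \<le>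
          C \<mu> * schwartz_norm (q \<mu>) \<mu> f" .
    qed
    finally show "(1 + norm x) powr p * norm (mi_derivative \<alpha> (weighted_composition \<psi> \<phi> f) x) \<le>
        (\<Sum>\<mu> | mi_size \<mu> \<le> mi_size \<alpha>. C \<mu> * schwartz_norm (q \<mu>) \<mu> f)" .
  qed (use qC C in auto)
qed

lemma weighted_composition_continuous:
  fixes \<phi> :: "('n::{finite,linorder}) space \<Rightarrow> 'n space"
  assumes \<psi>: "smooth \<psi>" and \<phi>: "smooth \<phi>"
    and F: "\<And>\<alpha> \<mu> p. mi_size \<mu> \<le> mi_size \<alpha> \<Longrightarrow> p > 0 \<Longrightarrow> \<exists>q::real. q > 0 \<and>
      bdd_above (range (\<lambda>x. (1 + norm x) powr p / (1 + norm (\<phi> x)) powr q * norm (F_fun \<phi> \<psi> \<alpha> \<mu> x)))"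
  shows "weighted_composition \<psi> \<phi> ` schwartz \<subseteq> schwartz"
    and "continuous_map schwartz_topology schwartz_topology (weighted_composition \<psi> \<phi>)"
proof -
  have mem: "weighted_composition \<psi> \<phi> f \<in> schwartz" if f: "f \<in> schwartz" for f
  proof (rule schwartzI)
    show "smooth (weighted_composition \<psi> \<phi> f)"
      unfolding weighted_composition_def using smooth_mult[OF \<psi> smooth_compose[OF
          schwartz_smooth[OF f] \<phi>]] .
    fix p :: real and \<alpha> :: "'n multi_index"
    assume "p > 0"
    then obtain q C where
      "\<forall>f\<in>schwartz. \<forall>x. (1 + norm x) powr p * norm (mi_derivative \<alpha> (weighted_composition \<psi> \<phi> f) x) \<le>
        (\<Sum>\<mu> | mi_size \<mu> \<le> mi_size \<alpha>. C \<mu> * schwartz_norm (q \<mu>) \<mu> f)"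
      using weighted_composition_bound[OF \<psi> \<phi> F] by blast
    with f show "\<exists>C. \<forall>x. (1 + norm x) powr p * norm (mi_derivative \<alpha> (weighted_composition \<psi> \<phi> f) x) \<le> C"
      by blast
  qed
  then show "weighted_composition \<psi> \<phi> ` schwartz \<subseteq> schwartz"
    by blast
  show "continuous_map schwartz_topology schwartz_topology (weighted_composition \<psi> \<phi>)"
  proof (rule continuous_map_schwartz[OF mem])
    show "(\<lambda>x. weighted_composition \<psi> \<phi> f x - weighted_composition \<psi> \<phi> g x) =
        weighted_composition \<psi> \<phi> (\<lambda>x. f x - g x)" for f g
      by (simp add: weighted_composition_def right_diff_distrib)
    fix p :: real and \<alpha> :: "'n multi_index"
    assume "p > 0"
    then obtain q C where "\<forall>\<mu>. mi_size \<mu> \<le> mi_size \<alpha> \<longrightarrow> q \<mu> > 0 \<and> C \<mu> \<ge> 0"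
      "\<forall>f\<in>schwartz. \<forall>x. (1 + norm x) powr p * norm (mi_derivative \<alpha> (weighted_composition \<psi> \<phi> f) x) \<le>
        (\<Sum>\<mu> | mi_size \<mu> \<le> mi_size \<alpha>. C \<mu> * schwartz_norm (q \<mu>) \<mu> f)"
      using weighted_composition_bound[OF \<psi> \<phi> F] by blast
    then show "\<exists>M q C. finite M \<and> (\<forall>\<mu>\<in>M. q \<mu> > 0 \<and> C \<mu> \<ge> 0) \<and>
        (\<forall>f\<in>schwartz. schwartz_norm p \<alpha> (weighted_composition \<psi> \<phi> f)
            \<le> (\<Sum>\<mu>\<in>M. C \<mu> * schwartz_norm (q \<mu>) \<mu> f))"
      by (intro exI[of _ "{\<mu>. mi_size \<mu> \<le> mi_size \<alpha>}"] exI[of _ q] exI[of _ C])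
        (auto intro: schwartz_norm_least finite_mi_size_le)
  qed
qed

section \<open>Cutoff functions\<close>

text \<open>With u = 1/t, the derivative of P(u) exp(-u) with respect to t is u^2 (P(u) - P'(u))
  exp(-u), which dictates the recursion.\<close>

fun flat_poly :: "nat \<Rightarrow> real poly"
  where
    "flat_poly 0 = 1"
  | "flat_poly (Suc n) = [:0, 0, 1:] * (flat_poly n - pderiv (flat_poly n))"

text \<open>\<open>flat n\<close> is the \<open>n\<close>-th derivative of the function \<open>exp (- 1 / t)\<close>, extended by \<open>0\<close> to \<open>t \<le> 0\<close>.\<close>
definition flat :: "nat \<Rightarrow> real \<Rightarrow> real"
  where "flat n t = (if t > 0 then poly (flat_poly n) (1 / t) * exp (- (1 / t)) else 0)"

lemma poly_mult_exp_minus_tendsto_0: "((\<lambda>u. poly p u * exp (- u)) \<longlongrightarrow> 0) at_top" for p :: "real poly"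
  unfolding poly_altdef sum_distrib_right
proof (rule tendsto_null_sum)
  fix i
  have "((\<lambda>u. coeff p i * (u ^ i / exp u)) \<longlongrightarrow> 0) at_top"
    by (rule tendsto_mult_right_zero[OF tendsto_power_div_exp_0])
  then show "((\<lambda>u. coeff p i * u ^ i * exp (- u)) \<longlongrightarrow> 0) at_top"
    by (simp add: exp_minus divide_inverse mult.assoc)
qed

lemma flat_has_derivative: "(flat n has_real_derivative flat (Suc n) t) (at t)"
proof (cases t "0 :: real" rule: linorder_cases)
  case less
  have "((\<lambda>t. 0) has_real_derivative flat (Suc n) t) (at t)"
    using less by (simp add: flat_def)
  then show ?thesis
    by (rule has_field_derivative_transform_within_open[where S = "{..<0}"])
      (use less in \<open>auto simp: flat_def\<close>)
next
  case greater
  let ?p = "flat_poly n"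
  have 1: "((\<lambda>t. 1 / t) has_real_derivative - (1 / t)\<^sup>2) (at t)"
    using greater by (auto intro!: derivative_eq_intros simp: power2_eq_square)
  have 2: "((\<lambda>t. poly ?p (1 / t)) has_real_derivative poly (pderiv ?p) (1 / t) * - (1 / t)\<^sup>2) (at t)"
    by (rule DERIV_chain2[OF poly_DERIV 1])
  have 3: "((\<lambda>t. exp (- (1 / t))) has_real_derivative exp (- (1 / t)) * - (- (1 / t)\<^sup>2)) (at t)"
    by (rule DERIV_chain2[OF DERIV_exp DERIV_minus[OF 1]])
  have "((\<lambda>t. poly ?p (1 / t) * exp (- (1 / t))) has_real_derivative flat (Suc n) t) (at t)"
    using DERIV_mult[OF 2 3] greater by (simp add: flat_def algebra_simps power2_eq_square)
  then show ?thesis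
    by (rule has_field_derivative_transform_within_open[where S = "{0<..}"])
      (use greater in \<open>auto simp: flat_def\<close>)
next
  case equal
  have "((\<lambda>h. flat n h / h) \<longlongrightarrow> 0) (at_left 0)"
    by (rule tendsto_eventually) (auto simp: flat_def eventually_at_filter)
  \<comment> \<open>With u = 1/h the quotient becomes u P(u) exp(-u), where P is
    \<open>flat_poly n\<close>, and tends to 0 as u grows.\<close>
  moreover have "((\<lambda>h. flat n h / h) \<longlongrightarrow> 0) (at_right 0)"
    unfolding filterlim_at_right_to_top
  proof (rule Lim_transform_eventually)
    show "((\<lambda>u. poly ([:0, 1:] * flat_poly n) u * exp (- u)) \<longlongrightarrow> 0) at_top"
      by (rule poly_mult_exp_minus_tendsto_0)
    show "\<forall>\<^sub>F u in at_top. poly ([:0, 1:] * flat_poly n) u * exp (- u) = flat n (inverse u) / inverse u"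
      using eventually_gt_at_top[of 0]
      by eventually_elim (simp add: flat_def divide_inverse)
  qed
  ultimately have "((\<lambda>h. flat n h / h) \<longlongrightarrow> 0) (at 0)"
    by (rule filterlim_split_at)
  then show ?thesis
    using equal by (simp add: DERIV_def flat_def)
qed

lemma flat_0_eq_0_iff: "flat 0 t = 0 \<longleftrightarrow> t \<le> 0"
  by (simp add: flat_def)

lemma flat_0_nonneg: "flat 0 t \<ge> 0"
  by (simp add: flat_def)

lemma smooth_flat: "smooth u \<Longrightarrow> smooth (\<lambda>x. flat 0 (u x))"
  by (rule smooth_compose_real[where G = flat and S = UNIV]) (simp_all add: flat_has_derivative)

lemma smooth_inverse:
  assumes "smooth u" "\<And>x. u x > 0"
  shows "smooth (\<lambda>x. inverse (u x) :: real)"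
proof -
  have "((\<lambda>t. (-1) ^ n * fact n * inverse t ^ Suc n) has_real_derivative
      (-1) ^ Suc n * fact (Suc n) * inverse t ^ Suc (Suc n)) (at t)" if "t \<in> {0<..}" for n and t :: real
    using DERIV_cmult[OF DERIV_power[OF DERIV_inverse, of t "Suc n"], of "(-1) ^ n * fact n"] that
    by (simp add: mult_ac power2_eq_square)
  from smooth_compose_real[where G = "\<lambda>n t. (-1) ^ n * fact n * inverse t ^ Suc n" and S
      = "{0<..}", OF assms(1) _ this]
  show ?thesis
    using assms(2) by simp
qed

text \<open>The norm is not smooth at 0 but its square is; hence s = |x|^2/R^2. At every point 2 - s
  or s - 1 is positive, so the denominator of \<eta> is positive. The numerator vanishes for s \<ge>
  2, and the other summand of the denominator for s \<le> 1.\<close>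

lemma ex_cutoff:
  assumes "R > 0"
  shows "\<exists>\<eta> :: ('n::finite) space \<Rightarrow> complex. smooth \<eta> \<and> (\<forall>x. norm x \<le> R \<longrightarrow> \<eta> x = 1)
      \<and> (\<forall>x. norm x \<ge> 2 * R \<longrightarrow> \<eta> x = 0)"
proof -
  define s where "s x = (norm x)\<^sup>2 / R\<^sup>2" for x :: "'n space"
  have s: "s = (\<lambda>x. (\<Sum>i\<in>UNIV. x $ i * x $ i) * (1 / R\<^sup>2))"
    by (simp add: s_def fun_eq_iff power2_norm_eq_inner inner_vec_def)
  have smooth_s: "smooth s"
    unfolding s by (intro smooth_mult smooth_sum smooth_component smooth_const)
  define \<eta> where "\<eta> x = (of_real (flat 0 (2 - s x) * inverse (flat 0 (2 - s x) + flat 0 (s x -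
      1))) :: complex)" for x
  have pos: "flat 0 (2 - s x) + flat 0 (s x - 1) > 0" for x
    using flat_0_nonneg[of "2 - s x"] flat_0_nonneg[of "s x - 1"] flat_0_eq_0_iff[of "2 - s x"]
        flat_0_eq_0_iff[of "s x - 1"]
    by linarith
  have "smooth \<eta>"
    unfolding \<eta>_def
    by (intro smooth_of_real smooth_mult smooth_inverse pos smooth_add smooth_flat smooth_diff
        smooth_s smooth_const)
  moreover have "\<eta> x = 1" if "norm x \<le> R" for x
  proof -
    have "s x \<le> 1"
      using that assms by (simp add: s_def power_mono)
    then have "flat 0 (s x - 1) = 0"
      by (simp add: flat_0_eq_0_iff)
    then show ?thesis
      using pos[of x] by (simp add: \<eta>_def)
  qed
  moreover have "\<eta> x = 0" if "norm x \<ge> 2 * R" for x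
  proof -
    have "(2 * R)\<^sup>2 \<le> (norm x)\<^sup>2"
      using that assms by (intro power_mono) auto
    then have "4 * R\<^sup>2 \<le> (norm x)\<^sup>2"
      by (simp add: power_mult_distrib)
    then have "2 * R\<^sup>2 \<le> (norm x)\<^sup>2"
      using zero_le_power2[of R] by linarith
    then have "s x \<ge> 2"
      using assms by (simp add: s_def pos_le_divide_eq)
    then have "flat 0 (2 - s x) = 0"
      by (simp add: flat_0_eq_0_iff)
    then show ?thesis
      by (simp add: \<eta>_def)
  qed
  ultimately show ?thesis
    by blast
qed

lemma mi_derivative_outside:
  assumes "\<And>x. norm x \<ge> R \<Longrightarrow> f x = 0" "norm x > R"
  shows "mi_derivative \<alpha> f x = 0"
proof -
  have "open {x :: 'a space. norm x > R}"
    by (intro open_Collect_less continuous_intros)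
  then have "mi_derivative \<alpha> f x = mi_derivative \<alpha> (\<lambda>x. 0) x"
    by (rule mi_derivative_cong_open) (use assms in auto)
  then show ?thesis
    by (simp add: mi_derivative_zero)
qed

lemma schwartz_compact_support:
  fixes f :: "('n::{finite,linorder}) space \<Rightarrow> complex"
  assumes f: "smooth f" "\<And>x. norm x \<ge> R \<Longrightarrow> f x = 0"
  shows "f \<in> schwartz"
proof (rule schwartzI)
  fix p :: real and \<alpha> :: "'n multi_index"
  assume "p > 0"
  have "compact (mi_derivative \<alpha> f ` cball 0 R)"
    by (intro compact_continuous_image smooth_continuous_on smooth_mi_derivative f) simp
  then have "bounded (mi_derivative \<alpha> f ` cball 0 R)"
    by (rule compact_imp_bounded)
  then obtain B where "\<forall>y\<in>mi_derivative \<alpha> f ` cball 0 R. norm y \<le> B"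
    unfolding bounded_iff ..
  then have B: "norm (mi_derivative \<alpha> f x) \<le> B" if "norm x \<le> R" for x
    using that by simp
  show "\<exists>C. \<forall>x. (1 + norm x) powr p * norm (mi_derivative \<alpha> f x) \<le> C"
  proof (intro exI allI)
    fix x
    \<comment> \<open>Absolute values, since for negative R the ball is empty and B
      arbitrary.\<close>
    show "(1 + norm x) powr p * norm (mi_derivative \<alpha> f x) \<le> (1 + \<bar>R\<bar>) powr p * \<bar>B\<bar>"
    proof (cases "norm x \<le> R")
      case True
      then show ?thesis
        using B[OF True] \<open>p > 0\<close> by (intro mult_mono powr_mono2) auto
    next
      case False
      then show ?thesis
        using mi_derivative_outside[of R f x \<alpha>] f(2) by simp
    qed
  qed
qed (rule f)

section \<open>The growth of the coefficients\<close>

text \<open>The hypothesis concerns a fixed function composed with \<phi>, but here the centre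
  \<phi> x of the monomial depends on x. In a factor t_i - \<phi>_i(x), the part t_i is absorbed
  into g and the number \<phi>_i(x) is at most R in modulus; so g has to vary in the induction on
  \<mu>.\<close>

lemma weighted_bound_compact:
  fixes \<phi> :: "('n::{finite,linorder}) space \<Rightarrow> 'n space"
  assumes sm: "smooth \<psi>" "smooth \<phi>" and H: "\<And>f. f \<in> schwartz \<Longrightarrow> (\<lambda>x. \<psi> x * f (\<phi> x)) \<in> schwartz"
    and "p > 0" and g: "smooth g" "\<And>x. norm x \<ge> R' \<Longrightarrow> g x = 0"
  shows "\<exists>C. \<forall>x. norm (\<phi> x) \<le> R \<longrightarrow>
    (1 + norm x) powr p * norm (mi_derivative \<alpha> (\<lambda>t. \<psi> t * (taylor_monomial (\<phi> x) \<mu> (\<phi> t) * g (\<phi>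
        t))) x) \<le> C"
  using g
proof (induction \<mu> arbitrary: g rule: multi_index_induct)
  case zero
  have "g \<in> schwartz"
    using zero by (rule schwartz_compact_support)
  from schwartz_norm_upper[OF H[OF this] \<open>p > 0\<close>] show ?case
    by (auto simp: taylor_monomial_def)
next
  case (step \<mu> i)
  let ?D = "\<lambda>\<mu> g x. mi_derivative \<alpha> (\<lambda>t. \<psi> t * (taylor_monomial (\<phi> x) \<mu> (\<phi> t) * g (\<phi> t))) x"
  let ?g = "\<lambda>t. of_real (t $ i) * g t"
  have smg: "smooth ?g"
    by (intro smooth_mult smooth_of_real smooth_component step)
  obtain C where C: "\<And>x. norm (\<phi> x) \<le> R \<Longrightarrow> (1 + norm x) powr p * norm (?D \<mu> g x) \<le> C"
    using step.IH[OF step.prems] by blast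
  obtain C' where C': "\<And>x. norm (\<phi> x) \<le> R \<Longrightarrow> (1 + norm x) powr p * norm (?D \<mu> ?g x) \<le> C'"
    using step.IH[OF smg] step.prems(2) by auto
  have "(1 + norm x) powr p * norm (?D (\<mu> + axis i 1) g x) \<le> C' + R * C" if x: "norm (\<phi> x) \<le> R" for x
  proof -
    define c where "c = (of_nat (Suc (\<mu> $ i)) :: complex)"
    have sm': "smooth (\<lambda>t. \<psi> t * (taylor_monomial (\<phi> x) \<nu> (\<phi> t) * u (\<phi> t)))" if "smooth u" for \<nu> u
      by (intro smooth_mult smooth_taylor_monomial_compose smooth_compose[OF that] sm)
    have tm: "c * taylor_monomial (\<phi> x) (\<mu> + axis i 1) z
        = of_real (z $ i - \<phi> x $ i) * taylor_monomial (\<phi> x) \<mu> z" for z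
      unfolding c_def taylor_monomial_def by (rule monomial_add_axis)
    have "c * (\<psi> t * (taylor_monomial (\<phi> x) (\<mu> + axis i 1) (\<phi> t) * g (\<phi> t))) =
        \<psi> t * (taylor_monomial (\<phi> x) \<mu> (\<phi> t) * ?g (\<phi> t)) -
        of_real (\<phi> x $ i) * (\<psi> t * (taylor_monomial (\<phi> x) \<mu> (\<phi> t) * g (\<phi> t)))" for t
    proof -
      have "c * (\<psi> t * (taylor_monomial (\<phi> x) (\<mu> + axis i 1) (\<phi> t) * g (\<phi> t))) =
          \<psi> t * (c * taylor_monomial (\<phi> x) (\<mu> + axis i 1) (\<phi> t) * g (\<phi> t))"
        by (simp only: mult_ac)
      then show ?thesis
        unfolding tm by (simp add: algebra_simps)
    qed
    then have "mi_derivative \<alpha> (\<lambda>t. c * (\<psi> t * (taylor_monomial (\<phi> x) (\<mu> + axis i 1) (\<phi> t) * g (\<phi>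
        t)))) x =
        ?D \<mu> ?g x - of_real (\<phi> x $ i) * ?D \<mu> g x"
      using sm'[OF smg] sm'[OF step.prems(1)] by (simp add: mi_derivative_diff mi_derivative_cmult
          smooth_mult)
    then have eq: "c * ?D (\<mu> + axis i 1) g x = ?D \<mu> ?g x - of_real (\<phi> x $ i) * ?D \<mu> g x"
      by (simp add: mi_derivative_cmult sm' step.prems)
    have "norm (?D (\<mu> + axis i 1) g x) \<le> norm c * norm (?D (\<mu> + axis i 1) g x)"
    proof -
      have "1 \<le> norm c"
        unfolding c_def norm_of_nat by simp
      then show ?thesis
        by (simp add: mult_le_cancel_right1)
    qed
    also have "\<dots> = norm (?D \<mu> ?g x - of_real (\<phi> x $ i) * ?D \<mu> g x)"
      by (simp only: norm_mult[symmetric] eq)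
    also have "\<dots> \<le> norm (?D \<mu> ?g x) + \<bar>\<phi> x $ i\<bar> * norm (?D \<mu> g x)"
      using norm_triangle_ineq4[of "?D \<mu> ?g x" "of_real (\<phi> x $ i) * ?D \<mu> g x"] by (simp add: norm_mult)
    also have "\<dots> \<le> norm (?D \<mu> ?g x) + R * norm (?D \<mu> g x)"
      using component_le_norm_cart[of "\<phi> x" i] x by (intro add_left_mono mult_right_mono) auto
    finally have "(1 + norm x) powr p * norm (?D (\<mu> + axis i 1) g x) \<le>
        (1 + norm x) powr p * (norm (?D \<mu> ?g x) + R * norm (?D \<mu> g x))"
      by (intro mult_left_mono) auto
    also have "\<dots> = (1 + norm x) powr p * norm (?D \<mu> ?g x) + R * ((1 + norm x) powr p * norm (?D \<mu> g x))"
      by (simp add: algebra_simps)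
    also have "\<dots> \<le> C' + R * C"
      using C[OF x] C'[OF x] x norm_ge_zero[of "\<phi> x"] by (intro add_mono mult_left_mono) linarith+
    finally show ?thesis .
  qed
  then show ?case
    by blast
qed

text \<open>Cutting off makes the hypothesis applicable to the monomials. The extra 1 in the radius
  gives an open set around x on which the cutoff, composed with \<phi>, equals 1, so that
  derivatives at x do not notice it.\<close>

lemma F_fun_bound_compact:
  fixes \<phi> :: "('n::{finite,linorder}) space \<Rightarrow> 'n space"
  assumes sm: "smooth \<psi>" "smooth \<phi>" and H: "\<And>f. f \<in> schwartz \<Longrightarrow> (\<lambda>x. \<psi> x * f (\<phi> x)) \<in> schwartz"
    and "p > 0"
  shows "\<exists>C. \<forall>x. norm (\<phi> x) \<le> R \<longrightarrow> (1 + norm x) powr p * norm (F_fun \<phi> \<psi> \<alpha> \<mu> x) \<le> C"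
proof -
  have "\<bar>R\<bar> + 1 > 0"
    by simp
  from ex_cutoff[OF this] obtain \<eta> :: "'n space \<Rightarrow> complex"
    where \<eta>: "smooth \<eta>" "\<And>x. norm x \<le> \<bar>R\<bar> + 1 \<Longrightarrow> \<eta> x = 1"
    "\<And>x. norm x \<ge> 2 * (\<bar>R\<bar> + 1) \<Longrightarrow> \<eta> x = 0"
    by blast
  have "F_fun \<phi> \<psi> \<alpha> \<mu> x = mi_derivative \<alpha> (\<lambda>t. \<psi> t * (taylor_monomial (\<phi> x) \<mu> (\<phi> t) * \<eta> (\<phi> t))) x"
    if x: "norm (\<phi> x) \<le> R" for x
    unfolding F_fun_eq[OF sm(2,1)]
  proof (rule mi_derivative_cong_open)
    show "open {t. norm (\<phi> t) < \<bar>R\<bar> + 1}"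
      by (intro open_Collect_less continuous_on_norm smooth_continuous_on sm continuous_on_const)
  qed (use x \<eta>(2) in auto)
  then show ?thesis
    using weighted_bound_compact[OF sm H \<open>p > 0\<close> \<eta>(1,3), where R = R and \<alpha> = \<alpha> and \<mu> = \<mu>] by auto
qed

text \<open>The gliding hump: rapidly decreasing multiples of a bump, translated to well separated points.\<close>
lemma bump_series:
  fixes y :: "nat \<Rightarrow> ('n::{finite,linorder}) space"
  assumes h: "smooth h" "\<And>x. norm x \<ge> 1 \<Longrightarrow> h x = 0"
    and y: "\<And>n. norm (y n) + 3 < norm (y (Suc n))"
  shows "\<exists>f\<in>schwartz. \<forall>n \<nu>. mi_derivative \<nu> f (y n) =
    of_real ((1 + norm (y n)) powr - real (Suc n)) * mi_derivative \<nu> h 0"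
proof -
  \<comment> \<open>The exponent n + 1 is the one for which \<open>F_fun_growth\<close> selects y n;
    it eventually exceeds any given p.\<close>
  define c where "c n = (of_real ((1 + norm (y n)) powr - real (Suc n)) :: complex)" for n
  define f where "f t = (\<Sum>n. c n * h (t - y n))" for t
  have mono: "norm (y m) + 3 < norm (y n)" if "m < n" for m n
    using that
  proof (induction n)
    case (Suc n)
    then show ?case
      using y[of n] by (cases "m = n") auto
  qed simp
  have sep: "norm (y m - y n) \<ge> 3" if "m \<noteq> n" for m n
    using mono[of m n] mono[of n m] that norm_triangle_ineq2[of "y m" "y n"]
      norm_triangle_ineq2[of "y n" "y m"] by (cases m n rule: linorder_cases) (auto simp:
          norm_minus_commute)
  define near where "near t N \<longleftrightarrow> (\<forall>s\<in>ball t (1 / 2). \<forall>n. n \<noteq> N \<longrightarrow> h (s - y n) = 0)" for t N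
  \<comment> \<open>3 - 3/2 - 1/2 = 1: a ball of radius 1/2 around a point closer than 3/2 to y N
    misses the open unit balls around the other centres. If no centre is closer than 3/2, no bump is
    met, as 3/2 - 1/2 = 1.\<close>
  have near1: "near t N" if "norm (t - y N) < 3 / 2" for t N
    unfolding near_def
  proof (intro ballI allI impI h)
    fix s n assume "s \<in> ball t (1 / 2)" "n \<noteq> N"
    then have "norm (t - s) < 1 / 2" "norm (y n - y N) \<ge> 3"
      using sep by (auto simp: dist_norm)
    moreover have "norm (y n - y N) \<le> norm (s - y n) + norm (t - s) + norm (t - y N)"
      using norm_triangle_ineq[of "t - s" "s - y n"] norm_triangle_ineq4[of "t - y N" "t - y n"] by simp
    ultimately show "norm (s - y n) \<ge> 1"
      using that by linarith
  qed
  have near2: "\<exists>N. near t N" for t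
  proof (cases "\<exists>N. norm (t - y N) < 3 / 2")
    case False
    \<comment> \<open>Every bump vanishes on the ball, so the index 0 is arbitrary.\<close>
    have "near t 0"
      unfolding near_def
    proof (intro ballI allI impI h)
      fix s n assume "s \<in> ball t (1 / 2)"
      then have "norm (t - s) < 1 / 2" "norm (t - y n) \<ge> 3 / 2"
        using False by (auto simp: dist_norm not_less)
      then show "norm (s - y n) \<ge> 1"
        using norm_triangle_ineq[of "t - s" "s - y n"] by simp
    qed
    then show ?thesis ..
  qed (use near1 in blast)
  have smN: "smooth (\<lambda>s. h (s - y N))" for N
    using smooth_compose[OF h(1) smooth_diff[OF smooth_ident smooth_const]] .
  have h_schwartz: "h \<in> schwartz"
    using h by (rule schwartz_compact_support)
  have f_near: "f s = c N * h (s - y N)" if "near t N" "s \<in> ball t (1 / 2)" for s t N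
    unfolding f_def using that by (subst suminf_finite[of "{N}"]) (auto simp: near_def)
  have deriv: "mi_derivative \<nu> f t = c N * mi_derivative \<nu> h (t - y N)" if "near t N" for t N \<nu>
  proof -
    have "mi_derivative \<nu> f t = mi_derivative \<nu> (\<lambda>s. c N * h (s - y N)) t"
      by (rule mi_derivative_cong_open[where S = "ball t (1 / 2)"]) (use f_near[OF that] in auto)
    then show ?thesis
      by (simp add: mi_derivative_cmult smN mi_derivative_shift h)
  qed
  have "smooth f"
  proof (rule smooth_local)
    fix t
    obtain N where "near t N"
      using near2 by blast
    then show "\<exists>S g. open S \<and> t \<in> S \<and> smooth g \<and> (\<forall>s\<in>S. f s = g s)"
      using f_near smooth_mult[OF smooth_const smN]
      by (intro exI[of _ "ball t (1 / 2)"] exI[of _ "\<lambda>s. c N * h (s - y N)"]) auto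
  qed
  moreover have "\<exists>C. \<forall>t. (1 + norm t) powr p * norm (mi_derivative \<alpha> f t) \<le> C" if p: "p > 0" for p \<alpha>
  proof -
    obtain M where M: "\<And>x. norm (mi_derivative \<alpha> h x) \<le> M"
    proof
      fix x
      have "norm (mi_derivative \<alpha> h x) \<le> (1 + norm x) powr 1 * norm (mi_derivative \<alpha> h x)"
        by (simp add: mult_le_cancel_right1)
      also have "\<dots> \<le> schwartz_norm 1 \<alpha> h"
        by (rule schwartz_norm_upper[OF h_schwartz zero_less_one])
      finally show "norm (mi_derivative \<alpha> h x) \<le> schwartz_norm 1 \<alpha> h" .
    qed
    have M0: "M \<ge> 0"
      using order_trans[OF norm_ge_zero M] .
    \<comment> \<open>For n + 1 \<ge> p the power to be bounded is at most 1; the sum takes care of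
      the finitely many smaller n.\<close>
    define K where "K = 1 + (\<Sum>n<nat \<lceil>p\<rceil>. (1 + norm (y n)) powr p)"
    have K: "(1 + norm (y N)) powr (p - real (Suc N)) \<le> K" for N
    proof (cases "p \<le> real (Suc N)")
      case True
      then have "(1 + norm (y N)) powr (p - real (Suc N)) \<le> (1 + norm (y N)) powr 0"
        by (intro powr_mono) auto
      also have "\<dots> \<le> K"
        by (simp add: K_def sum_nonneg)
      finally show ?thesis .
    next
      case False
      then have N: "N < nat \<lceil>p\<rceil>"
        by linarith
      have "(1 + norm (y N)) powr (p - real (Suc N)) \<le> (1 + norm (y N)) powr p"
        by (intro powr_mono) auto
      also have "\<dots> \<le> (\<Sum>n<nat \<lceil>p\<rceil>. (1 + norm (y n)) powr p)"
        using N by (intro member_le_sum[of N _ "\<lambda>n. (1 + norm (y n)) powr p"]) auto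
      finally show ?thesis
        by (simp add: K_def)
    qed
    have K0: "K \<ge> 0"
      by (simp add: K_def sum_nonneg add_nonneg_nonneg)
    have "(1 + norm t) powr p * norm (mi_derivative \<alpha> f t) \<le> 2 powr p * K * M" for t
    proof -
      obtain N where N: "near t N"
        using near2 by blast
      show ?thesis
      proof (cases "norm (t - y N) \<le> 1")
        case False
        then have "mi_derivative \<alpha> h (t - y N) = 0"
          using mi_derivative_outside[of 1 h] h(2) by simp
        then show ?thesis
          using K0 M0 by (simp add: deriv[OF N])
      next
        case True
        \<comment> \<open>In the unit ball around y N, 1 + |t| \<le> 2 + |y N| \<le> 2 (1 + |y N|);
          this is the origin of the factor 2^p.\<close>
        have "norm t \<le> norm (t - y N) + norm (y N)"
          using norm_triangle_ineq[of "t - y N" "y N"] by simp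
        then have "1 + norm t \<le> 2 * (1 + norm (y N))"
          unfolding distrib_left using True norm_ge_zero[of "y N"] by linarith
        then have "(1 + norm t) powr p \<le> (2 * (1 + norm (y N))) powr p"
          using p by (intro powr_mono2) auto
        then have "(1 + norm t) powr p * norm (mi_derivative \<alpha> f t) \<le>
            (2 * (1 + norm (y N))) powr p * ((1 + norm (y N)) powr - real (Suc N) * M)"
          unfolding deriv[OF N] norm_mult c_def norm_of_real
          by (intro mult_mono) (auto intro: M)
        also have "\<dots> = 2 powr p * (1 + norm (y N)) powr (p - real (Suc N)) * M"
          unfolding powr_diff powr_minus
          by (simp add: powr_mult divide_inverse del: distrib_left_numeral)
        also have "\<dots> \<le> 2 powr p * K * M"
          by (intro mult_right_mono mult_left_mono K M0) simp
        finally show ?thesis .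
      qed
    qed
    then show ?thesis
      by blast
  qed
  ultimately have "f \<in> schwartz"
    by (rule schwartzI)
  moreover have "mi_derivative \<nu> f (y n) = c n * mi_derivative \<nu> h 0" for n \<nu>
    using deriv[OF near1[of "y n" n]] by simp
  ultimately show ?thesis
    unfolding c_def by blast
qed

lemma F_fun_growth:
  fixes \<phi> :: "('n::{finite,linorder}) space \<Rightarrow> 'n space"
  assumes sm: "smooth \<psi>" "smooth \<phi>" and H: "\<And>f. f \<in> schwartz \<Longrightarrow> (\<lambda>x. \<psi> x * f (\<phi> x)) \<in> schwartz"
    and "p > 0" and \<mu>: "mi_size \<mu> \<le> mi_size \<alpha>"
  shows "\<exists>q::real. q > 0 \<and>
    bdd_above (range (\<lambda>x. (1 + norm x) powr p / (1 + norm (\<phi> x)) powr q * norm (F_fun \<phi> \<psi> \<alpha> \<mu> x)))"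
proof (rule ccontr)
  define G where "G x = (1 + norm x) powr p * norm (F_fun \<phi> \<psi> \<alpha> \<mu> x)" for x
  have G0: "G x \<ge> 0" for x
    by (simp add: G_def)
  assume "\<not> ?thesis"
  \<comment> \<open>The condition fails for every q > 0, in particular for the exponents q = n + 1,
    which tend to infinity.\<close>
  then have "\<not> bdd_above (range (\<lambda>x. G x / (1 + norm (\<phi> x)) powr real (Suc n)))" for n
    unfolding G_def using of_nat_0_less_iff[of "Suc n"] by (auto simp del: of_nat_Suc)
  then have unbdd: "\<exists>x. G x / (1 + norm (\<phi> x)) powr real (Suc n) > C" for n C
    by (rule contrapos_np) (auto simp: not_less intro!: bdd_aboveI[of _ C] simp del: of_nat_Suc)
  have ex: "\<exists>x. G x > real n * (1 + norm (\<phi> x)) powr real (Suc n) \<and> norm (\<phi> x) > R" for n R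
  proof -
    obtain C where C: "\<And>x. norm (\<phi> x) \<le> R \<Longrightarrow> G x \<le> C"
      unfolding G_def using F_fun_bound_compact[OF sm H \<open>p > 0\<close>] by blast
    \<comment> \<open>Where |\<phi> x| \<le> R the quotient is at most G x \<le> C, so exceeding C
      expels x from this region; exceeding n gives the lower bound.\<close>
    obtain x where x: "G x / (1 + norm (\<phi> x)) powr real (Suc n) > max C (real n)"
      using unbdd by blast
    have ge1: "(1 + norm (\<phi> x)) powr real (Suc n) \<ge> 1"
      by (rule ge_one_powr_ge_zero) simp_all
    then have "G x / (1 + norm (\<phi> x)) powr real (Suc n) \<le> G x"
      using G0[of x] by (intro divide_le_eq[THEN iffD2]) (auto simp: mult_le_cancel_left1)
    then have "norm (\<phi> x) > R"
      using C[of x] x by force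
    moreover have "real n < G x / (1 + norm (\<phi> x)) powr real (Suc n)"
      using x by simp
    then have "G x > real n * (1 + norm (\<phi> x)) powr real (Suc n)"
      using ge1 by (simp add: less_divide_eq)
    ultimately show ?thesis
      by blast
  qed
  \<comment> \<open>The points are chosen successively; the gap 3 is the separation required by
    \<open>bump_series\<close>.\<close>
  have "\<exists>x. \<forall>n. G (x n) > real n * (1 + norm (\<phi> (x n))) powr real (Suc n)
      \<and> norm (\<phi> (x n)) + 3 < norm (\<phi> (x (Suc n)))"
    by (rule dependent_nat_choice) (use ex in blast)+
  then obtain x where x: "\<And>n. G (x n) > real n * (1 + norm (\<phi> (x n))) powr real (Suc n)"
    "\<And>n. norm (\<phi> (x n)) + 3 < norm (\<phi> (x (Suc n)))"
    by blast
  obtain \<eta> :: "'n space \<Rightarrow> complex" where \<eta>: "smooth \<eta>" "\<And>x. norm x \<le> 1 / 2 \<Longrightarrow> \<eta> x = 1"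
    "\<And>x. norm x \<ge> 1 \<Longrightarrow> \<eta> x = 0"
    using ex_cutoff[of "1 / 2 :: real"] by auto
  \<comment> \<open>The jet of h at 0 singles out \<mu>: in the chain rule at x n only the
    coefficient with index \<mu> remains.\<close>
  define h where "h t = taylor_monomial 0 \<mu> t * \<eta> t" for t
  have h: "smooth h" "\<And>x. norm x \<ge> 1 \<Longrightarrow> h x = 0"
    unfolding h_def using \<eta> by (auto intro: smooth_mult smooth_taylor_monomial)
  have jet: "mi_derivative \<nu> h 0 = (if \<nu> = \<mu> then 1 else 0)" for \<nu>
  proof -
    have "mi_derivative \<nu> h 0 = mi_derivative \<nu> (taylor_monomial 0 \<mu>) 0"
      by (rule mi_derivative_cong_open[where S = "ball 0 (1 / 2)"]) (auto simp: h_def \<eta>(2))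
    then show ?thesis
      by (simp add: mi_derivative_taylor_monomial)
  qed
  obtain f where f: "f \<in> schwartz" and fd: "\<And>n \<nu>. mi_derivative \<nu> f (\<phi> (x n)) =
      of_real ((1 + norm (\<phi> (x n))) powr - real (Suc n)) * mi_derivative \<nu> h 0"
    using bump_series[where h = h and y = "\<lambda>n. \<phi> (x n)", OF h x(2)] by blast
  let ?C = "schwartz_norm p \<alpha> (\<lambda>t. \<psi> t * f (\<phi> t))"
  \<comment> \<open>The height of the n-th bump is the reciprocal of the power in the choice of x n,
    so a single finite seminorm exceeds every n.\<close>
  have "real n < ?C" for n
  proof -
    let ?w = "(1 + norm (\<phi> (x n))) powr real (Suc n)"
    have w: "?w > 0"
      by simp
    have "mi_derivative \<alpha> (\<lambda>t. \<psi> t * f (\<phi> t)) (x n) =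
        (\<Sum>\<nu> | mi_size \<nu> \<le> mi_size \<alpha>. if \<nu> = \<mu> then of_real (inverse ?w) * F_fun \<phi> \<psi> \<alpha> \<mu> (x n) else 0)"
      unfolding faa_di_bruno_leibniz[OF sm(1) schwartz_smooth[OF f] sm(2)] fd jet powr_minus
      by (rule sum.cong) auto
    also have "\<dots> = of_real (inverse ?w) * F_fun \<phi> \<psi> \<alpha> \<mu> (x n)"
      using \<mu> by (simp add: sum.delta[OF finite_mi_size_le])
    finally have "(1 + norm (x n)) powr p * norm (mi_derivative \<alpha> (\<lambda>t. \<psi> t * f (\<phi> t)) (x n))
        = G (x n) / ?w"
      using w by (simp add: G_def norm_mult norm_inverse divide_inverse mult_ac del: of_nat_Suc)
    moreover have "real n < G (x n) / ?w"
      using x(1)[of n] w by (simp add: pos_less_divide_eq)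
    ultimately show ?thesis
      using schwartz_norm_upper[OF H[OF f] \<open>p > 0\<close>, of "x n" \<alpha>] by linarith
  qed
  then show False
    using reals_Archimedean2[of ?C] by (meson less_asym)
qed

theorem theorem2p2:
  fixes \<psi> :: "('n::{finite,linorder}) space \<Rightarrow> complex"
    and \<phi> :: "'n space \<Rightarrow> 'n space"
  assumes "smooth \<psi>" and "smooth \<phi>"
  shows
    "((\<forall>f\<in>schwartz. (\<lambda>x. \<psi> x * f (\<phi> x)) \<in> schwartz)
      \<longleftrightarrow>
      weighted_composition \<psi> \<phi> ` schwartz \<subseteq> schwartz \<and>
      continuous_map schwartz_topology schwartz_topology (weighted_composition \<psi> \<phi>))
    \<and>
    (weighted_composition \<psi> \<phi> ` schwartz \<subseteq> schwartz \<and>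
      continuous_map schwartz_topology schwartz_topology (weighted_composition \<psi> \<phi>)
      \<longleftrightarrow>
      (\<forall>\<alpha> \<mu> :: 'n multi_index. mi_size \<mu> \<le> mi_size \<alpha> \<longrightarrow>
        (\<forall>p::real. p > 0 \<longrightarrow> (\<exists>q::real. q > 0 \<and>
          bdd_above (range (\<lambda>x. (1 + norm x) powr p / (1 + norm (\<phi> x)) powr q *
            norm (F_fun \<phi> \<psi> \<alpha> \<mu> x)))))))"
    (is "(?i \<longleftrightarrow> ?ii) \<and> (?ii \<longleftrightarrow> ?iii)")
proof -
  have "?i" if "?ii"
    using that by (auto simp: weighted_composition_def)
  moreover have "?iii" if "?i"
    using that by (intro allI impI F_fun_growth[OF assms]) blast+
  moreover have "?ii" if "?iii"
    using that by (intro conjI weighted_composition_continuous[OF assms]) simp_all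
  ultimately show ?thesis
    by blast
qed

end
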